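(* Let $\mathfrak h$ be a real nilpotent Lie algebra of type $\{n,2\}$, $n\ge3$, let $T\cong\mathrm{SO}_2(\mathbb R)$ be a group of automorphisms of $\mathfrak h$ such that $\mathfrak h$ is $T$-undecomposable, and let $\alpha_h,\beta$ be the coefficients of the action of $T$ described in the context. Assume $\beta=1$ and that the smallest coefficient $\alpha_h$ is zero. Then there are an integer $l\ge0$ and a basis $\{e_1,\dots,e_n,x,y\}$ of $\mathfrak h$, with $\{x,y\}$ a basis of $\mathfrak h'$, with respect to which $T$ operates as the group of automorphisms $\exp(\partial(t))$, $t\in\mathbb R$, where $$\partial(t)=t\cdot\Big((\oplus 0)\oplus(\oplus J)\oplus(\oplus 2J)\oplus\dots\oplus(\oplus (l+1)J)\Big)\oplus t\cdot J,$$ the diagonal block $(\oplus iJ)$ having dimension $d_i\times d_i$ ($0\le i\le l+1$, with $d_i$ even for $i>0$), and $\mathfrak h$ is described by the pair of alternating matrices $(T_1,T_2)$, where $$T_1=\left(\begin{array}{c|c|c|c|c|c} 0&W_0&&&&\\ \hline -W_0'&0&W_1&&&\\ \hline &-W_1'&0&W_2&&\\ \hline &&-W_2'&\ddots&\ddots&\\ \hline &&&\ddots&0&W_{l}\\ \hline &&&&-W_{l}'&0 \end{array}\right)$$ and $T_2$ is the alternating matrix obtained from $T_1$ by replacing each block $W_i$ by $W_i(\oplus J)$ (and $-W_i'$ by $-(W_i(\oplus J))'$). The blocks $W_i$ have dimension $d_i\times d_{i+1}$ and: (i) the block $W_0$ has, in the most general case, the echelon form $$W_0=\left(\begin{array}{c|c|cc|c}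 0&\oplus L_1 & 0 & 0 & 0\\ \hline 0&0&I_{2s}&0&\Omega_{2s}\\ 0&0&0&I_{2t}&0 \end{array}\right),$$ where $L_1=(1,0)$, $s\ge0$, $t\ge0$, and where the first zero columns, as well as the blocks $L_1$, may be absent; (ii) for any $i>0$, the block $W_i$ is the real form of a complex matrix $\widehat W_i$ of the almost echelon form $\widehat W_i=(0\,|\,\widetilde I_{r_i})$ (and, in particular, $\widehat W_l=\widetilde I_{r_l}$ if $l>0$), where $\widetilde I_{r_i}$ is obtained from the complex identity matrix $I_{r_i}$ by possibly adding zero rows; and no two successive columns of $T_1$ of indices $2j-1,2j$ are both zero, where the columns are numbered $1,\dots,n$ if $n$ is even and $0,1,\dots,n-1$ if $n$ is odd.
   Context: All Lie algebras are real and finite-dimensional. A nilpotent Lie algebra $\mathfrak h$ of type $\{n,2\}$ is one of dimension $n+2$ whose commutator ideal $\mathfrak h'$ is $2$-dimensional and coincides with the centre of $\mathfrak h$. Given a basis $\{e_1,\dots,e_n,x,y\}$ of $\mathfrak h$ with $\{x,y\}$ a basis of $\mathfrak h'$, the pair of alternating $n\times n$ real matrices $(T_1=(a_{ij}),T_2=(b_{ij}))$ describing $\mathfrak h$ is defined by $[e_i,e_j]=a_{ij}x+b_{ij}y$. Let $J=\begin{pmatrix}0&1\\-1&0\end{pmatrix}$ and $\Omega=\begin{pmatrix}0&1\\1&0\end{pmatrix}$. $A\oplus B$ is the block diagonal matrix with blocks $A,B$; $(\oplus A)=A\oplus\cdots\oplus A$ (a number of copies determined by the sizes; $(\oplus 0)$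 is a zero square matrix, possibly of odd size). $A'$ is the transpose of $A$; $I_k$ is the $k\times k$ identity; $\Omega_{2s}=\Omega\oplus\cdots\oplus\Omega$ ($s$ copies). In block matrices blank blocks are zero and $0$ denotes a zero block of suitable size. Matrices of linear maps act on coordinate columns. Action of $T$: let $T\cong\mathrm{SO}_2(\mathbb R)$ be a group of automorphisms of $\mathfrak h$ and $\mathfrak t$ the corresponding Lie algebra of derivations. Write $n=2m$ or $n=2m+1$. By complete reducibility there is a basis $\{e_1,\dots,e_n,x,y\}$ with $\{x,y\}$ a basis of $\mathfrak h'$ in which $\mathfrak t$ consists of the matrices $\partial(t)=(\alpha_1tJ\oplus\cdots\oplus\alpha_mtJ)\oplus\beta tJ$ if $n=2m$, and $\partial(t)=(0\oplus\alpha_1tJ\oplus\cdots\oplus\alpha_mtJ)\oplus\beta tJ$ if $n=2m+1$ (with a $1\times1$ block $0$ first), $t\in\mathbb R$, where $\beta tJ$ acts on $\langle x,y\rangle$; one can choose $0\le\alpha_1\le\dots\le\alpha_m$ and (rescaling $t$) $\beta\in\{0,1\}$. The coefficients $\alpha_h$ are $\alpha_1,\dots,\alpha_m$, together with $\alpha_0=0$ if $n$ is odd. $\mathfrak h$ is $T$-decomposable if it contains two proper $T$-invariant ideals $\mathfrak i_1,\mathfrak i_2$ such that $\mathfrak h$ is the direct sum of $\mathfrak i_1$ and $\mathfrak i_2$ with amalgamated centre, that is, $\mathfrak h=\mathfrak i_1+\mathfrak i_2$, $[\mathfrak i_1,\mathfrak i_2]=0$ and $\mathfrak i_1\cap\mathfrak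 i_2=\mathfrak h'$; otherwise it is $T$-undecomposable. Real form: the real form of a complex matrix is the real matrix obtained by replacing each entry $a+ib$ ($a,b\in\mathbb R$) by the block $\begin{pmatrix}a&b\\-b&a\end{pmatrix}$. $\widetilde I_{r}$ denotes a matrix with $r$ columns and rank $r$ obtained from $I_r$ by inserting (possibly no) zero rows in unspecified positions. In $(0\,|\,\widetilde I_{r})$ the zero columns may be absent. *)

theory Defs
  imports "HOL-Analysis.Analysis" "Jordan_Normal_Form.Matrix"
begin

text \<open>
  The underlying space is a type of class \<open>euclidean_space\<close>; the bracket is not related to the
  inner product, which only supplies the (canonical) topology of a finite-dimensional space.
\<close>

definition lie_algebra :: "('a::euclidean_space \<Rightarrow> 'a \<Rightarrow> 'a) \<Rightarrow> bool" where
  "lie_algebra br \<longleftrightarrow> bilinear br \<and> (\<forall>u. br u u = 0) \<and>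
     (\<forall>u v w. br u (br v w) + br v (br w u) + br w (br u v) = 0)"

definition commutator_ideal :: "('a::euclidean_space \<Rightarrow> 'a \<Rightarrow> 'a) \<Rightarrow> 'a set" where
  "commutator_ideal br = span {br u v | u v. True}"

definition lie_centre :: "('a::euclidean_space \<Rightarrow> 'a \<Rightarrow> 'a) \<Rightarrow> 'a set" where
  "lie_centre br = {u. \<forall>v. br u v = 0}"

primrec lower_central :: "('a::euclidean_space \<Rightarrow> 'a \<Rightarrow> 'a) \<Rightarrow> nat \<Rightarrow> 'a set" where
  "lower_central br 0 = UNIV"
| "lower_central br (Suc k) = span {br u v | u v. v \<in> lower_central br k}"

definition nilpotent_lie :: "('a::euclidean_space \<Rightarrow> 'a \<Rightarrow> 'a) \<Rightarrow> bool" where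
  "nilpotent_lie br \<longleftrightarrow> lie_algebra br \<and> (\<exists>k. lower_central br k = {0})"

definition nilpotent_type2 :: "('a::euclidean_space \<Rightarrow> 'a \<Rightarrow> 'a) \<Rightarrow> nat \<Rightarrow> bool" where
  "nilpotent_type2 br n \<longleftrightarrow> nilpotent_lie br \<and> DIM('a) = n + 2 \<and>
     dim (commutator_ideal br) = 2 \<and> commutator_ideal br = lie_centre br"

definition lie_automorphism ::
  "('a::euclidean_space \<Rightarrow> 'a \<Rightarrow> 'a) \<Rightarrow> ('a \<Rightarrow> 'a) \<Rightarrow> bool" where
  "lie_automorphism br f \<longleftrightarrow> linear f \<and> bij f \<and> (\<forall>u v. f (br u v) = br (f u) (f v))"

definition lie_derivation ::
  "('a::euclidean_space \<Rightarrow> 'a \<Rightarrow> 'a) \<Rightarrow> ('a \<Rightarrow> 'a) \<Rightarrow> bool" where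
  "lie_derivation br D \<longleftrightarrow> linear D \<and> (\<forall>u v. D (br u v) = br (D u) v + br u (D v))"

definition lie_ideal :: "('a::euclidean_space \<Rightarrow> 'a \<Rightarrow> 'a) \<Rightarrow> 'a set \<Rightarrow> bool" where
  "lie_ideal br I \<longleftrightarrow> subspace I \<and> (\<forall>u. \<forall>v\<in>I. br u v \<in> I)"

definition SO2 :: "(real^2^2) set" where
  "SO2 = {A. rotation_matrix A}"

text \<open>
  The isomorphism is one of topological groups; since \<open>SO2\<close> is compact, continuity of the inverse
  is automatic.
\<close>

definition SO2_automorphism_group ::
  "('a::euclidean_space \<Rightarrow> 'a \<Rightarrow> 'a) \<Rightarrow> ('a \<Rightarrow> 'a) set \<Rightarrow> bool" where
  "SO2_automorphism_group br T \<longleftrightarrow> (\<forall>f\<in>T. lie_automorphism br f) \<and>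
     (\<exists>\<rho>. bij_betw \<rho> SO2 T \<and>
          (\<forall>A\<in>SO2. \<forall>B\<in>SO2. \<rho> (A ** B) = \<rho> A \<circ> \<rho> B) \<and>
          (\<forall>u. continuous_on SO2 (\<lambda>A. \<rho> A u)))"

definition T_invariant :: "('a \<Rightarrow> 'a) set \<Rightarrow> 'a set \<Rightarrow> bool" where
  "T_invariant T S \<longleftrightarrow> (\<forall>f\<in>T. f ` S \<subseteq> S)"

definition T_decomposable ::
  "('a::euclidean_space \<Rightarrow> 'a \<Rightarrow> 'a) \<Rightarrow> ('a \<Rightarrow> 'a) set \<Rightarrow> bool" where
  "T_decomposable br T \<longleftrightarrow> (\<exists>I1 I2.
     lie_ideal br I1 \<and> lie_ideal br I2 \<and> I1 \<noteq> UNIV \<and> I2 \<noteq> UNIV \<and>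
     T_invariant T I1 \<and> T_invariant T I2 \<and>
     {u + v | u v. u \<in> I1 \<and> v \<in> I2} = UNIV \<and>
     (\<forall>u\<in>I1. \<forall>v\<in>I2. br u v = 0) \<and>
     I1 \<inter> I2 = commutator_ideal br)"

definition exp_map :: "('a::euclidean_space \<Rightarrow> 'a) \<Rightarrow> 'a \<Rightarrow> 'a" where
  "exp_map D u = (\<Sum>k. (D ^^ k) u /\<^sub>R fact k)"

definition derivation_algebra ::
  "('a::euclidean_space \<Rightarrow> 'a \<Rightarrow> 'a) \<Rightarrow> ('a \<Rightarrow> 'a) set \<Rightarrow> ('a \<Rightarrow> 'a) set" where
  "derivation_algebra br T =
     {D. lie_derivation br D \<and> (\<forall>r. exp_map (\<lambda>u. r *\<^sub>R D u) \<in> T)}"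

text \<open>
  An ordered basis \<open>e\<^sub>1, \<dots>, e\<^sub>n, x, y\<close> is the list \<open>es @ [x, y]\<close>, so that \<open>e\<^sub>i\<close> is \<open>es ! (i - 1)\<close>.
\<close>

definition adapted_basis ::
  "('a::euclidean_space \<Rightarrow> 'a \<Rightarrow> 'a) \<Rightarrow> nat \<Rightarrow> 'a list \<Rightarrow> 'a \<Rightarrow> 'a \<Rightarrow> bool" where
  "adapted_basis br n es x y \<longleftrightarrow> length es = n \<and> distinct (es @ [x, y]) \<and>
     independent (set (es @ [x, y])) \<and> span (set (es @ [x, y])) = UNIV \<and>
     span {x, y} = commutator_ideal br"

definition has_matrix :: "'a::euclidean_space list \<Rightarrow> ('a \<Rightarrow> 'a) \<Rightarrow> real mat \<Rightarrow> bool" where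
  "has_matrix bs D M \<longleftrightarrow> linear D \<and> M \<in> carrier_mat (length bs) (length bs) \<and>
     (\<forall>j<length bs. D (bs ! j) = (\<Sum>i<length bs. M $$ (i, j) *\<^sub>R bs ! i))"

definition alternating_mat :: "nat \<Rightarrow> real mat \<Rightarrow> bool" where
  "alternating_mat n A \<longleftrightarrow> A \<in> carrier_mat n n \<and> transpose_mat A = - A"

definition described_by ::
  "('a::euclidean_space \<Rightarrow> 'a \<Rightarrow> 'a) \<Rightarrow> 'a list \<Rightarrow> 'a \<Rightarrow> 'a \<Rightarrow> real mat \<Rightarrow> real mat \<Rightarrow> bool" where
  "described_by br es x y T1 T2 \<longleftrightarrow>
     alternating_mat (length es) T1 \<and> alternating_mat (length es) T2 \<and>
     (\<forall>i<length es. \<forall>j<length es.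
        br (es ! i) (es ! j) = T1 $$ (i, j) *\<^sub>R x + T2 $$ (i, j) *\<^sub>R y)"

definition J_mat :: "real mat" where
  "J_mat = mat_of_rows_list 2 [[0, 1], [-1, 0]]"

definition Omega_mat :: "real mat" where
  "Omega_mat = mat_of_rows_list 2 [[0, 1], [1, 0]]"

definition L1_mat :: "real mat" where
  "L1_mat = mat_of_rows_list 2 [[1, 0]]"

definition copies :: "nat \<Rightarrow> 'a::zero mat \<Rightarrow> 'a mat" where
  "copies k A = diag_block_mat (replicate k A)"

definition append_cols :: "'a::zero mat \<Rightarrow> 'a mat \<Rightarrow> 'a mat" (infixr "@\<^sub>c" 65) where
  "A @\<^sub>c B = four_block_mat A B (0\<^sub>m 0 (dim_col A)) (0\<^sub>m 0 (dim_col B))"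

definition block_mat :: "'a::zero mat list list \<Rightarrow> 'a mat" where
  "block_mat Bss = foldr (@\<^sub>r) (map (\<lambda>Bs. foldr (@\<^sub>c) Bs (0\<^sub>m 0 0)) Bss) (0\<^sub>m 0 0)"

definition real_form :: "complex mat \<Rightarrow> real mat" where
  "real_form A = mat (2 * dim_row A) (2 * dim_col A) (\<lambda>(i, j).
     let z = A $$ (i div 2, j div 2)
     in mat_of_rows_list 2 [[Re z, Im z], [- Im z, Re z]] $$ (i mod 2, j mod 2))"

text \<open>
  A matrix arises from the identity matrix of size \<open>r\<close> by inserting zero rows iff its nonzero
  rows, in order, are the rows of that identity matrix.
\<close>

definition identity_with_zero_rows :: "nat \<Rightarrow> complex mat \<Rightarrow> bool" where
  "identity_with_zero_rows r A \<longleftrightarrow> dim_col A = r \<and>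
     filter (\<lambda>v. v \<noteq> 0\<^sub>v r) (rows A) = rows (1\<^sub>m r)"

text \<open>Only the values \<open>\<alpha> 1, \<dots>, \<alpha> (n div 2)\<close> are relevant; \<open>\<alpha>\<^sub>0 = 0\<close> is added for odd \<open>n\<close>.\<close>

definition action_matrix :: "nat \<Rightarrow> (nat \<Rightarrow> real) \<Rightarrow> real \<Rightarrow> real \<Rightarrow> real mat" where
  "action_matrix n \<alpha> \<beta> t = diag_block_mat
     ((if odd n then [0\<^sub>m 1 1] else []) @
      map (\<lambda>h. (\<alpha> h * t) \<cdot>\<^sub>m J_mat) [1..<Suc (n div 2)] @ [(\<beta> * t) \<cdot>\<^sub>m J_mat])"

definition action_coefficients ::
  "('a::euclidean_space \<Rightarrow> 'a \<Rightarrow> 'a) \<Rightarrow> ('a \<Rightarrow> 'a) set \<Rightarrow> nat \<Rightarrow> (nat \<Rightarrow> real) \<Rightarrow> real \<Rightarrow> bool" where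
  "action_coefficients br T n \<alpha> \<beta> \<longleftrightarrow>
     (\<forall>h\<in>{1..n div 2}. 0 \<le> \<alpha> h) \<and> mono_on {1..n div 2} \<alpha> \<and> \<beta> \<in> {0, 1} \<and>
     (\<exists>es x y. adapted_basis br n es x y \<and>
        derivation_algebra br T =
          {D. \<exists>t. has_matrix (es @ [x, y]) D (action_matrix n \<alpha> \<beta> t)})"

definition coefficient_set :: "nat \<Rightarrow> (nat \<Rightarrow> real) \<Rightarrow> real set" where
  "coefficient_set n \<alpha> = (if odd n then {0} else {}) \<union> \<alpha> ` {1..n div 2}"

definition normal_derivation :: "nat \<Rightarrow> (nat \<Rightarrow> nat) \<Rightarrow> real \<Rightarrow> real mat" where
  "normal_derivation l d t = diag_block_mat
     [t \<cdot>\<^sub>m diag_block_mat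
        (0\<^sub>m (d 0) (d 0) # map (\<lambda>i. copies (d i div 2) (real i \<cdot>\<^sub>m J_mat)) [1..<l + 2]),
      t \<cdot>\<^sub>m J_mat]"

definition chain_mat :: "nat \<Rightarrow> (nat \<Rightarrow> nat) \<Rightarrow> (nat \<Rightarrow> real mat) \<Rightarrow> real mat" where
  "chain_mat l d W = block_mat
     (map (\<lambda>i. map (\<lambda>j. if j = i + 1 then W i
                        else if i = j + 1 then - transpose_mat (W j)
                        else 0\<^sub>m (d i) (d j)) [0..<l + 2]) [0..<l + 2])"

text \<open>Here \<open>z\<close> is the number of leading zero columns and \<open>p\<close> the number of blocks \<open>(1, 0)\<close>.\<close>

definition W0_form :: "nat \<Rightarrow> nat \<Rightarrow> nat \<Rightarrow> nat \<Rightarrow> real mat" where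
  "W0_form z p s t = block_mat
     [[0\<^sub>m p z,       copies p L1_mat,      0\<^sub>m p (2 * s),       0\<^sub>m p (2 * t),       0\<^sub>m p (2 * s)],
      [0\<^sub>m (2 * s) z,   0\<^sub>m (2 * s) (2 * p),      1\<^sub>m (2 * s),         0\<^sub>m (2 * s) (2 * t),   copies s Omega_mat],
      [0\<^sub>m (2 * t) z,   0\<^sub>m (2 * t) (2 * p),      0\<^sub>m (2 * t) (2 * s),   1\<^sub>m (2 * t),         0\<^sub>m (2 * t) (2 * s)]]"

text \<open>Column numbering starts with 1 if \<open>n\<close> is even and with 0 if \<open>n\<close> is odd.\<close>

definition numbered_col :: "nat \<Rightarrow> real mat \<Rightarrow> nat \<Rightarrow> real Matrix.vec" where
  "numbered_col n A k = col A (if even n then k - 1 else k)"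

end

theory Submission
  imports Defs
begin

text \<open>
  Let \<open>V\<close> be the span of \<open>e\<^sub>1, \<dots>, e\<^sub>n\<close>, decomposed into the weight spaces of the generator \<open>D\<close> of \<open>T\<close>.
  Equivariance of the bracket with values in the centre, which has weight 1, makes weight spaces commute unless
  their weights are neighbours in the chain \<open>0, 1, 2, \<dots>\<close> (or add up to 1); as weight 0 occurs,
  undecomposability leaves only integral weights. The bracket is then a chain of pairings
  \<open>V\<^sub>i \<times> V\<^sub>i\<^sub>+\<^sub>1 \<rightarrow> \<complex>\<close>, where \<open>V\<^sub>0\<close> is a real space and the others are complex ones. A
  decomposition is the same as a family of idempotents of the \<open>V\<^sub>i\<close> that are adjoint to each other.
  An idempotent of \<open>V\<^sub>1\<close> extends along the chain as soon as it respects the flag of iterated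
  annihilators, so the problem is reduced to a real space \<open>V\<^sub>0\<close> paired with a complex space \<open>V\<^sub>1\<close>
  carrying a flag. There an explicit compatible idempotent of complex
  rank one or two must be the identity. Hence \<open>(dim\<^sub>\<real> V\<^sub>0, dim\<^sub>\<complex> V\<^sub>1)\<close> is \<open>(1, 1)\<close>,
  \<open>(2, 1)\<close> or \<open>(2, 2)\<close>, with \<open>W\<^sub>0\<close> equal to \<open>L\<^sub>1\<close>, \<open>I\<^sub>2\<close> or \<open>(I\<^sub>2 | \<Omega>)\<close>, and bases of the
  other \<open>V\<^sub>i\<close> are successive dual bases.
\<close>

subsection \<open>Pairings of finite-dimensional spaces\<close>

text \<open>The condition on the centre makes \<open>V 0\<close> nondegenerate against
  \<open>V 1\<close>, but about a later space it only says that no nonzero vector is orthogonal to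
  both neighbours. Nondegeneracy of each pairing in its second argument has to be extracted from
  undecomposability, by descending induction from the end of the chain: a vector orthogonal to
  everything on its left would split off. From then on adjoints in the next space are unique, so
  that one local idempotent determines everything above it. Among complex spaces the rest would be
  plain linear algebra. The obstacle is that \<open>V 0\<close> is only real, so its position in the
  complex dual of \<open>V 1\<close> matters. It may contain a complex line; or the smallest nonzero
  member of the flag may contain a nonzero vector on which all of \<open>V 0\<close> takes real
  values; or neither happens. In the last case no single line splits off: two conjugate lines are
  needed, and they produce the block \<open>\<Omega>\<close>.\<close>

lemma linear_separation:
  fixes S :: "'a::euclidean_space set"
  assumes S: "subspace S" and p: "p \<notin> S"
  shows "\<exists>\<mu>::'a \<Rightarrow> real. linear \<mu> \<and> \<mu> p = 1 \<and> (\<forall>s\<in>S. \<mu> s = 0)"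
proof -
  obtain y z where y: "y \<in> span S" and z: "\<And>w. w \<in> span S \<Longrightarrow> Linear_Algebra.orthogonal z w"
    and pyz: "p = y + z"
    using orthogonal_subspace_decomp_exists by blast
  have y': "y \<in> S" using y S by (metis span_eq_iff)
  have z0: "z \<noteq> 0" using pyz y' p by auto
  have zS: "inner z s = 0" if "s \<in> S" for s
    using z[of s] that by (simp add: span_base Linear_Algebra.orthogonal_def)
  have "linear (\<lambda>x. inner z x / inner z z)"
    by (intro linearI) (simp_all add: inner_add_right add_divide_distrib)
  moreover have "inner z p / inner z z = 1"
    using z0 zS[OF y'] by (simp add: pyz inner_add_right)
  moreover have "\<forall>s\<in>S. inner z s / inner z z = 0" using zS by simp
  ultimately show ?thesis by blast
qed

text \<open>A Fredholm alternative. The inner product turns functionals into vectors, and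
  \<open>\<phi>\<close> is sought in the image of \<open>U\<close> under \<open>A\<close>, modulo
  the functionals that vanish on \<open>W\<close>. If it is not there, its component orthogonal to
  that sum lies in \<open>W\<close> and is annihilated by \<open>U\<close>, against the kernel
  condition.\<close>

lemma bilinear_representation:
  fixes b :: "'a::euclidean_space \<Rightarrow> 'b::euclidean_space \<Rightarrow> real"
  assumes b: "bilinear b" and U: "subspace U" and W: "subspace W" and \<phi>: "linear \<phi>"
    and ker: "\<And>w. w \<in> W \<Longrightarrow> (\<And>u. u \<in> U \<Longrightarrow> b u w = 0) \<Longrightarrow> \<phi> w = 0"
  shows "\<exists>u\<in>U. \<forall>w\<in>W. \<phi> w = b u w"
proof -
  define A where "A u = (\<Sum>e\<in>Basis. b u e *\<^sub>R e)" for u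
  define p where "p = (\<Sum>e\<in>Basis. \<phi> e *\<^sub>R e)"
  have lb: "linear (b u)" for u using b by (simp add: bilinear_def)
  have Riesz: "f w = inner (\<Sum>e\<in>Basis. f e *\<^sub>R e) w" if "linear f" for f :: "'b \<Rightarrow> real" and w
  proof -
    have "f w = f (\<Sum>e\<in>Basis. inner w e *\<^sub>R e)" by (simp add: euclidean_representation)
    also have "\<dots> = (\<Sum>e\<in>Basis. inner w e * f e)"
      using that by (simp add: linear_sum linear_cmul)
    also have "\<dots> = inner (\<Sum>e\<in>Basis. f e *\<^sub>R e) w"
      by (simp add: inner_sum_left inner_commute[of w] mult.commute)
    finally show ?thesis .
  qed
  have A: "b u w = inner (A u) w" for u w unfolding A_def by (rule Riesz[OF lb])
  have P: "\<phi> w = inner p w" for w unfolding p_def by (rule Riesz[OF \<phi>])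
  have linA: "linear A"
  proof (rule linearI)
    show "A (x + y) = A x + A y" for x y
      by (simp add: A_def bilinear_ladd[OF b] scaleR_add_left sum.distrib)
    show "A (c *\<^sub>R x) = c *\<^sub>R A x" for c x
      by (simp add: A_def bilinear_lmul[OF b] scaleR_sum_right)
  qed
  define N where "N = {z. \<forall>w\<in>W. inner z w = 0}"
  have N: "subspace N" by (auto simp: N_def subspace_def inner_add_left)
  define S where "S = {x + y |x y. x \<in> A ` U \<and> y \<in> N}"
  have S: "subspace S" unfolding S_def
    by (intro subspace_sums linear_subspace_image linA U N)
  show ?thesis
  proof (cases "p \<in> S")
    case True
    then obtain u z where "u \<in> U" "z \<in> N" "p = A u + z" by (auto simp: S_def)
    then show ?thesis by (intro bexI[of _ u]) (auto simp: P A inner_add_left N_def)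
  next
    case False
    obtain y z where y: "y \<in> span S" and z: "\<And>w. w \<in> span S \<Longrightarrow> Linear_Algebra.orthogonal z w"
      and pyz: "p = y + z"
      using orthogonal_subspace_decomp_exists by blast
    have y': "y \<in> S" using y S by (metis span_eq_iff)
    have zS: "inner z s = 0" if "s \<in> S" for s
      using z[of s] that by (simp add: span_base Linear_Algebra.orthogonal_def)
    have zA: "inner z (A u) = 0" if "u \<in> U" for u
    proof -
      have "A u + 0 \<in> S" unfolding S_def using that subspace_0[OF N] by blast
      then show ?thesis using zS by simp
    qed
    have zN: "inner z t = 0" if "t \<in> N" for t
    proof -
      have "A 0 + t \<in> S" unfolding S_def using that subspace_0[OF U] by blast
      then show ?thesis using zS linear_0[OF linA] by simp
    qed
    \<comment> \<open>\<open>W\<close> is its own double orthogonal complement: the remainder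
      \<open>t\<close> of \<open>z\<close> lies in \<open>N\<close>, to which \<open>z\<close> is
      orthogonal, so \<open>t\<close> vanishes.\<close>
    obtain w t where w: "w \<in> span W" and t: "\<And>v. v \<in> span W \<Longrightarrow> Linear_Algebra.orthogonal t v"
      and zwt: "z = w + t"
      using orthogonal_subspace_decomp_exists by blast
    have w': "w \<in> W" using w W by (metis span_eq_iff)
    have tN: "t \<in> N" using t by (auto simp: N_def span_base Linear_Algebra.orthogonal_def)
    then have "inner t w = 0" using w' by (simp add: N_def)
    moreover have "inner z t = inner w t + inner t t" by (simp add: zwt inner_add_left)
    ultimately have "t = 0" using zN[OF tN] by (simp add: inner_commute)
    then have zW: "z \<in> W" using zwt w' by simp
    have "\<phi> z = 0" using ker[OF zW] zA by (simp add: A inner_commute)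
    moreover have "inner p z = inner y z + inner z z" by (simp add: pyz inner_add_left)
    ultimately have "z = 0" using P[of z] zS[OF y'] by (simp add: inner_commute)
    then have False using False pyz y' by simp
    then show ?thesis ..
  qed
qed

text \<open>The vector \<open>w'\<close> need not be unique, so a pointwise choice need not be
  linear. It is made on a basis of \<open>W\<close> only; the vectors at which the linear extension
  works form a subspace.\<close>

lemma bilinear_adjoint:
  fixes g :: "'u::real_vector \<Rightarrow> 'w::euclidean_space \<Rightarrow> real"
    and h :: "'u \<Rightarrow> 'v::euclidean_space \<Rightarrow> real"
  assumes g: "bilinear g" and h: "bilinear h" and W: "subspace W" and W': "subspace W'"
    and ex: "\<And>w. w \<in> W \<Longrightarrow> \<exists>w'\<in>W'. \<forall>u\<in>U. g u w = h u w'"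
  shows "\<exists>L. linear L \<and> (\<forall>w\<in>W. L w \<in> W' \<and> (\<forall>u\<in>U. g u w = h u (L w)))"
proof -
  obtain B where B: "B \<subseteq> W" "independent B" "W \<subseteq> span B"
    using basis_exists by metis
  obtain f where f: "\<And>w. w \<in> W \<Longrightarrow> f w \<in> W' \<and> (\<forall>u\<in>U. g u w = h u (f w))"
    using ex by metis
  obtain L where L: "linear L" "\<And>x. x \<in> B \<Longrightarrow> L x = f x"
    using linear_independent_extend[OF B(2), of f] by blast
  define Z where "Z = {w. L w \<in> W' \<and> (\<forall>u\<in>U. g u w = h u (L w))}"
  have "subspace Z"
    unfolding subspace_def Z_def using W'
    by (auto simp: linear_0[OF L(1)] linear_add[OF L(1)] linear_cmul[OF L(1)] subspace_0 subspace_add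
        subspace_mul bilinear_radd[OF g] bilinear_radd[OF h] bilinear_rmul[OF g] bilinear_rmul[OF h]
        bilinear_rzero[OF g] bilinear_rzero[OF h])
  moreover have "B \<subseteq> Z" using f B(1) L(2) by (auto simp: Z_def)
  ultimately have "span B \<subseteq> Z" by (rule span_minimal[rotated])
  then show ?thesis using L(1) B(3) unfolding Z_def by blast
qed

subsection \<open>Undecomposable chains of pairings\<close>

text \<open>
  \<open>J\<close> is the complex structure on \<open>V 1, V 2, \<dots>\<close>, and \<open>b\<close> is the real part of the pairings, which are
  conjugate linear in the first and linear in the second argument. The last assumption
  is undecomposability: the maps \<open>E j\<close> are the projections belonging to a decomposition.
\<close>

locale graded_pairing =
  fixes V :: "nat \<Rightarrow> 'a::euclidean_space set" and J :: "'a \<Rightarrow> 'a" and b :: "'a \<Rightarrow> 'a \<Rightarrow> real"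
    and M :: nat
  assumes V: "subspace (V j)"
    and J: "linear J"
    and JV: "v \<in> V (Suc j) \<Longrightarrow> J v \<in> V (Suc j)"
    and JJ: "v \<in> V (Suc j) \<Longrightarrow> J (J v) = - v"
    and b: "bilinear b"
    and bJJ: "u \<in> V (Suc j) \<Longrightarrow> v \<in> V (Suc (Suc j)) \<Longrightarrow> b (J u) (J v) = b u v"
    and V_top: "M < j \<Longrightarrow> V j = {0}"
    and V_0: "V 0 \<noteq> {0}"
    and left_nondeg: "u \<in> V 0 \<Longrightarrow> (\<And>v. v \<in> V (Suc 0) \<Longrightarrow> b u v = 0) \<Longrightarrow> u = 0"
    and indecomposable: "(\<And>j. linear (E j)) \<Longrightarrow> (\<And>j v. v \<in> V j \<Longrightarrow> E j v \<in> V j) \<Longrightarrow>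
      (\<And>j v. v \<in> V j \<Longrightarrow> E j (E j v) = E j v) \<Longrightarrow>
      (\<And>j v. v \<in> V (Suc j) \<Longrightarrow> E (Suc j) (J v) = J (E (Suc j) v)) \<Longrightarrow>
      (\<And>j u v. u \<in> V j \<Longrightarrow> v \<in> V (Suc j) \<Longrightarrow> b (E j u) v = b u (E (Suc j) v)) \<Longrightarrow>
      (\<forall>j. \<forall>v\<in>V j. E j v = 0) \<or> (\<forall>j. \<forall>v\<in>V j. E j v = v)"
begin

lemma b_left [simp]:
  "b (x + y) z = b x z + b y z" "b (x - y) z = b x z - b y z" "b (c *\<^sub>R x) z = c * b x z"
  "b (- x) z = - b x z" "b 0 z = 0"
  using bilinear_ladd[OF b] bilinear_lsub[OF b] bilinear_lmul[OF b] bilinear_lneg[OF b] bilinear_lzero[OF b]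
  by auto

lemma b_right [simp]:
  "b z (x + y) = b z x + b z y" "b z (x - y) = b z x - b z y" "b z (c *\<^sub>R x) = c * b z x"
  "b z (- x) = - b z x" "b z 0 = 0"
  using bilinear_radd[OF b] bilinear_rsub[OF b] bilinear_rmul[OF b] bilinear_rneg[OF b] bilinear_rzero[OF b]
  by auto

lemma J_simps [simp]:
  "J (x + y) = J x + J y" "J (x - y) = J x - J y" "J (c *\<^sub>R x) = c *\<^sub>R J x" "J (- x) = - J x" "J 0 = 0"
  using linear_add[OF J] linear_diff[OF J] linear_cmul[OF J] linear_neg[OF J] linear_0[OF J] by auto

lemma V_closed [simp, intro]:
  "0 \<in> V j" "x \<in> V j \<Longrightarrow> y \<in> V j \<Longrightarrow> x + y \<in> V j" "x \<in> V j \<Longrightarrow> y \<in> V j \<Longrightarrow> x - y \<in> V j"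
  "x \<in> V j \<Longrightarrow> c *\<^sub>R x \<in> V j" "x \<in> V j \<Longrightarrow> - x \<in> V j"
  using V[of j] by (auto simp: subspace_0 subspace_add subspace_diff subspace_mul subspace_neg)

text \<open>\<open>J\<close> has square \<open>-1\<close> and preserves the real part of the
  pairing, hence is skew for it.\<close>

lemma b_J_right: "u \<in> V (Suc j) \<Longrightarrow> v \<in> V (Suc (Suc j)) \<Longrightarrow> b u (J v) = - b (J u) v"
  using bJJ[OF JV, of u j v] JJ[of u j] by simp

section \<open>The flag of iterated annihilators\<close>

definition perp :: "nat \<Rightarrow> 'a set \<Rightarrow> 'a set" where
  "perp j S = {u \<in> V j. \<forall>v\<in>S. b u v = 0}"

text \<open>
  Mutually adjoint maps preserve the iterated annihilators; lemma \<open>extend_step\<close> is the converse.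
\<close>

inductive flag :: "nat \<Rightarrow> 'a set \<Rightarrow> bool" where
  top: "flag j (V j)"
| perp: "flag (Suc j) S \<Longrightarrow> flag j (perp j S)"

lemma subspace_perp: "subspace (perp j S)"
  by (auto simp: perp_def subspace_def)

lemma flag_subspace: "flag j S \<Longrightarrow> subspace S"
  by (induction rule: flag.induct) (auto simp: V subspace_perp)

lemma flag_subset: "flag j S \<Longrightarrow> S \<subseteq> V j"
  by (induction rule: flag.induct) (auto simp: perp_def)

text \<open>No complex structure is assumed on \<open>V 0\<close>, hence \<open>0 < j\<close>. Above
  level 0 the annihilator of a \<open>J\<close>-invariant set is invariant because \<open>J\<close>
  is skew.\<close>

lemma flag_J: "flag j S \<Longrightarrow> 0 < j \<Longrightarrow> v \<in> S \<Longrightarrow> J v \<in> S"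
proof (induction arbitrary: v rule: flag.induct)
  case (top j)
  then show ?case using JV[of v "j - 1"] by simp
next
  case (perp j S)
  then obtain i where j: "j = Suc i" by (cases j) auto
  have v: "v \<in> V (Suc i)" "\<And>s. s \<in> S \<Longrightarrow> b v s = 0"
    using perp.prems by (auto simp: perp_def j)
  have "b (J v) s = 0" if s: "s \<in> S" for s
    using b_J_right[OF v(1), of s] flag_subset[OF perp.hyps] s v(2)[OF perp.IH[OF _ s]]
    by (auto simp: j)
  then show ?case using JV[OF v(1)] by (simp add: perp_def j)
qed

text \<open>Annihilators reverse inclusions and the whole space contains every other member, so
  comparability descends from level \<open>Suc j\<close> to level \<open>j\<close>.\<close>

lemma flag_linear: "flag j S \<Longrightarrow> flag j S' \<Longrightarrow> S \<subseteq> S' \<or> S' \<subseteq> S"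
proof (induction arbitrary: S' rule: flag.induct)
  case (top j)
  then show ?case using flag_subset by blast
next
  case (perp j S)
  from perp.prems show ?case
  proof cases
    case top
    then show ?thesis by (auto simp: perp_def)
  next
    case (perp S2)
    then show ?thesis using perp.IH[of S2] by (auto simp: perp_def)
  qed
qed

lemma flag_dim_subset: "flag j S \<Longrightarrow> flag j S' \<Longrightarrow> dim S \<le> dim S' \<Longrightarrow> S \<subseteq> S'"
  using flag_linear[of j S S'] subspace_dim_equal[of S' S] flag_subspace by blast

section \<open>Complex functionals and idempotents that preserve the flag\<close>

lemma complex_functional:
  assumes S: "subspace S" and SJ: "\<And>s. s \<in> S \<Longrightarrow> J s \<in> S" and v: "v \<in> V (Suc j)" "v \<notin> S"
  shows "\<exists>\<mu>::'a \<Rightarrow> real. linear \<mu> \<and> \<mu> v = 1 \<and> \<mu> (J v) = 0 \<and> (\<forall>s\<in>S. \<mu> s = 0)"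
proof -
  define S' where "S' = {s + t |s t. s \<in> S \<and> t \<in> span {J v}}"
  have S': "subspace S'" unfolding S'_def by (intro subspace_sums S subspace_span)
  have "v \<notin> S'"
  proof
    assume "v \<in> S'"
    then obtain s c where s: "s \<in> S" "v = s + c *\<^sub>R J v" by (auto simp: S'_def span_singleton)
    then have "v - c *\<^sub>R J v \<in> S" by (metis add_diff_cancel_right')
    \<comment> \<open>Applying \<open>1 + c J\<close> to \<open>v - c J v\<close> gives
      \<open>(1 + c * c) v\<close>, a nonzero real multiple of \<open>v\<close>.\<close>
    then have "(v - c *\<^sub>R J v) + c *\<^sub>R J (v - c *\<^sub>R J v) \<in> S"
      using SJ[of "v - c *\<^sub>R J v"] by (intro subspace_add[OF S] subspace_mul[OF S])
    then have "(1 + c * c) *\<^sub>R v \<in> S" using JJ[OF v(1)] by (simp add: algebra_simps)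
    then have "(1 / (1 + c * c)) *\<^sub>R ((1 + c * c) *\<^sub>R v) \<in> S" using S by (rule subspace_mul[rotated])
    moreover have "1 + c * c \<noteq> 0" by (smt (verit) zero_le_square)
    ultimately show False using v(2) by simp
  qed
  then obtain \<mu> :: "'a \<Rightarrow> real" where \<mu>: "linear \<mu>" "\<mu> v = 1" "\<And>s. s \<in> S' \<Longrightarrow> \<mu> s = 0"
    using linear_separation[OF S'] by blast
  have "s \<in> S'" if "s \<in> S" for s
    unfolding S'_def using that span_0[of "{J v}"] by (metis (mono_tags, lifting) add.right_neutral mem_Collect_eq)
  moreover have "J v \<in> S'"
    unfolding S'_def using subspace_0[OF S] span_base[of "J v" "{J v}"]
    by (metis (mono_tags, lifting) add.left_neutral insertI1 mem_Collect_eq)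
  ultimately show ?thesis using \<mu> by blast
qed

text \<open>This is \<open>v \<otimes> \<lambda>\<close> for the complex functional \<open>\<lambda> w = \<mu> w - \<i> \<mu> (J w)\<close> with real part \<open>\<mu>\<close>.\<close>

definition rank_one :: "('a \<Rightarrow> real) \<Rightarrow> 'a \<Rightarrow> 'a \<Rightarrow> 'a" where
  "rank_one \<mu> v w = \<mu> w *\<^sub>R v - \<mu> (J w) *\<^sub>R J v"

text \<open>The index is shifted: the condition concerns \<open>V (Suc j)\<close>, since level 0
  carries no complex structure. Preservation of the flag is what allows the adjoint to be continued
  to higher levels.\<close>

definition flag_idempotent :: "nat \<Rightarrow> ('a \<Rightarrow> 'a) \<Rightarrow> bool" where
  "flag_idempotent j E \<longleftrightarrow> linear E \<and>
     (\<forall>v\<in>V (Suc j). E v \<in> V (Suc j) \<and> E (E v) = E v \<and> E (J v) = J (E v)) \<and>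
     (\<forall>S. flag (Suc j) S \<longrightarrow> (\<forall>v\<in>S. E v \<in> S))"

lemma linear_rank_one: "linear \<mu> \<Longrightarrow> linear (rank_one \<mu> v)"
  by (intro linearI) (simp_all add: rank_one_def linear_add linear_cmul algebra_simps)

lemma rank_one_simps:
  assumes "linear \<mu>" "v \<in> V (Suc j)" "\<mu> v = 1" "\<mu> (J v) = 0"
  shows "rank_one \<mu> v v = v" "rank_one \<mu> v (J v) = J v"
  using assms JJ[OF assms(2)] by (simp_all add: rank_one_def linear_neg)

lemma rank_one_J:
  assumes "linear \<mu>" "v \<in> V (Suc j)" "w \<in> V (Suc j)"
  shows "rank_one \<mu> v (J w) = J (rank_one \<mu> v w)"
  using assms JJ[OF assms(2)] JJ[OF assms(3)] by (simp add: rank_one_def linear_neg)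

lemma rank_one_idem:
  assumes "linear \<mu>" "v \<in> V (Suc j)" "\<mu> v = 1" "\<mu> (J v) = 0"
  shows "rank_one \<mu> v (rank_one \<mu> v w) = rank_one \<mu> v w"
proof -
  let ?r = "rank_one \<mu> v"
  have "?r (?r w) = \<mu> w *\<^sub>R ?r v - \<mu> (J w) *\<^sub>R ?r (J v)"
    using linear_rank_one[OF assms(1), of v]
    by (subst (2) rank_one_def) (simp add: linear_diff linear_cmul)
  then show ?thesis using rank_one_simps[OF assms] by (simp add: rank_one_def)
qed

text \<open>Each member of the flag either contains the image of the idempotent or lies in its
  kernel.\<close>

lemma flag_idempotent_rank_one:
  assumes \<mu>: "linear \<mu>" and v: "v \<in> V (Suc j)" "\<mu> v = 1" "\<mu> (J v) = 0"
    and S: "\<And>S. flag (Suc j) S \<Longrightarrow> v \<in> S \<or> (\<forall>s\<in>S. \<mu> s = 0)"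
  shows "flag_idempotent j (rank_one \<mu> v)"
  unfolding flag_idempotent_def
proof (intro conjI ballI allI impI)
  show "linear (rank_one \<mu> v)" by (rule linear_rank_one[OF \<mu>])
  show "rank_one \<mu> v (rank_one \<mu> v w) = rank_one \<mu> v w" for w by (rule rank_one_idem[OF \<mu> v])
  show "rank_one \<mu> v w \<in> V (Suc j)" for w using v(1) JV by (auto simp: rank_one_def)
  show "rank_one \<mu> v (J w) = J (rank_one \<mu> v w)" if "w \<in> V (Suc j)" for w
    by (rule rank_one_J[OF \<mu> v(1) that])
  show "rank_one \<mu> v s \<in> S" if S1: "flag (Suc j) S" and s: "s \<in> S" for S s
    using S[OF S1]
  proof
    assume "v \<in> S"
    then show ?thesis unfolding rank_one_def
      using flag_subspace[OF S1] flag_J[OF S1] by (intro subspace_diff subspace_mul) auto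
  next
    assume "\<forall>s\<in>S. \<mu> s = 0"
    then have "rank_one \<mu> v s = 0" using s flag_J[OF S1] by (simp add: rank_one_def)
    then show ?thesis using flag_subspace[OF S1] by (simp add: subspace_0)
  qed
qed

section \<open>Right nondegeneracy and adjoints along the chain\<close>

definition right_nondeg :: "nat \<Rightarrow> bool" where
  "right_nondeg j \<longleftrightarrow> (\<forall>v\<in>V (Suc j). (\<forall>u\<in>V j. b u v = 0 \<and> b u (J v) = 0) \<longrightarrow> v = 0)"

text \<open>Orthogonality of \<open>J v\<close> follows on replacing \<open>u\<close> by
  \<open>J u\<close>, which is possible once the left space is complex. Over \<open>V 0\<close> the
  two real equations of \<open>right_nondeg\<close> together express complex orthogonality.\<close>

lemma right_nondegD:
  assumes R: "right_nondeg (Suc j)" and v: "v \<in> V (Suc (Suc j))"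
    and 0: "\<And>u. u \<in> V (Suc j) \<Longrightarrow> b u v = 0"
  shows "v = 0"
proof -
  have "b u v = 0 \<and> b u (J v) = 0" if u: "u \<in> V (Suc j)" for u
    using 0[OF u] 0[OF JV[OF u]] b_J_right[OF u v] by simp
  then show ?thesis using R v unfolding right_nondeg_def by blast
qed

lemma bilinear_flip: "bilinear (\<lambda>v u. b u v)"
  using b by (auto simp: bilinear_def)

lemma left_rep:
  assumes "linear \<phi>" "\<And>w. w \<in> V (Suc j) \<Longrightarrow> (\<And>u. u \<in> V j \<Longrightarrow> b u w = 0) \<Longrightarrow> \<phi> w = 0"
  shows "\<exists>u\<in>V j. \<forall>w\<in>V (Suc j). \<phi> w = b u w"
  using bilinear_representation[OF b V V assms] .

lemma right_rep:
  assumes "linear \<phi>" "\<And>u. u \<in> perp j (V (Suc j)) \<Longrightarrow> \<phi> u = 0"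
  shows "\<exists>v\<in>V (Suc j). \<forall>u\<in>V j. \<phi> u = b u v"
  using bilinear_representation[OF bilinear_flip V V assms(1)] assms(2) by (auto simp: perp_def)

text \<open>A vector outside \<open>S\<close> is separated from \<open>S\<close> by a functional,
  and right nondegeneracy provides a vector of \<open>V (Suc j)\<close> representing it; that vector
  lies in the annihilator of \<open>S\<close>.\<close>

lemma double_perp:
  assumes R: "right_nondeg (Suc j)" and S: "flag (Suc (Suc j)) S"
  shows "S = {v \<in> V (Suc (Suc j)). \<forall>u\<in>perp (Suc j) S. b u v = 0}"
proof (intro equalityI subsetI)
  fix v assume "v \<in> S"
  then show "v \<in> {v \<in> V (Suc (Suc j)). \<forall>u\<in>perp (Suc j) S. b u v = 0}"
    using flag_subset[OF S] by (auto simp: perp_def)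
next
  fix v assume v: "v \<in> {v \<in> V (Suc (Suc j)). \<forall>u\<in>perp (Suc j) S. b u v = 0}"
  show "v \<in> S"
  proof (rule ccontr)
    assume "v \<notin> S"
    then obtain \<mu> :: "'a \<Rightarrow> real" where \<mu>: "linear \<mu>" "\<mu> v = 1" "\<forall>s\<in>S. \<mu> s = 0"
      using linear_separation[OF flag_subspace[OF S]] by blast
    obtain u where u: "u \<in> V (Suc j)" "\<forall>w\<in>V (Suc (Suc j)). \<mu> w = b u w"
      using left_rep[OF \<mu>(1), of "Suc j"] right_nondegD[OF R] linear_0[OF \<mu>(1)] by metis
    then have "u \<in> perp (Suc j) S"
    proof -
      have "b u s = 0" if "s \<in> S" for s
        using bspec[OF u(2) subsetD[OF flag_subset[OF S] that]] \<mu>(3) that by simp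
      then show ?thesis using u(1) by (simp add: perp_def)
    qed
    then have "b u v = 0" "v \<in> V (Suc (Suc j))" using v by auto
    then show False using u(2) \<mu>(2) by force
  qed
qed

text \<open>As a functional of \<open>u\<close>, \<open>b (E u) v\<close> vanishes on the
  annihilator of the whole next space, because this annihilator belongs to the flag and
  \<open>E\<close> preserves it; so a vector represents it. Right nondegeneracy makes that vector
  unique, which transfers idempotence and commutation with \<open>J\<close> to the adjoint, and
  \<open>double_perp\<close> transfers the flag.\<close>

lemma extend_step:
  assumes R: "right_nondeg (Suc j)" and E: "flag_idempotent j E"
  shows "\<exists>E'. flag_idempotent (Suc j) E' \<and>
    (\<forall>u\<in>V (Suc j). \<forall>v\<in>V (Suc (Suc j)). b (E u) v = b u (E' v))"
proof -
  have linE: "linear E" and EV: "\<And>v. v \<in> V (Suc j) \<Longrightarrow> E v \<in> V (Suc j)"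
    and EE: "\<And>v. v \<in> V (Suc j) \<Longrightarrow> E (E v) = E v"
    and EJ: "\<And>v. v \<in> V (Suc j) \<Longrightarrow> E (J v) = J (E v)"
    and ES: "\<And>S v. flag (Suc j) S \<Longrightarrow> v \<in> S \<Longrightarrow> E v \<in> S"
    using E unfolding flag_idempotent_def by blast+
  have bE: "bilinear (\<lambda>u v. b (E u) v)"
    using b linear_compose[OF linE] unfolding bilinear_def comp_def by blast
  have "\<exists>w\<in>V (Suc (Suc j)). \<forall>u\<in>V (Suc j). b (E u) v = b u w" if v: "v \<in> V (Suc (Suc j))" for v
  proof (rule right_rep)
    show "linear (\<lambda>u. b (E u) v)" using bE by (simp add: bilinear_def)
    fix u assume "u \<in> perp (Suc j) (V (Suc (Suc j)))"
    then have "E u \<in> perp (Suc j) (V (Suc (Suc j)))" using ES flag.intros by blast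
    then show "b (E u) v = 0" using v by (auto simp: perp_def)
  qed
  from bilinear_adjoint[OF bE b V V this]
  obtain E' where E': "linear E'" "\<And>v. v \<in> V (Suc (Suc j)) \<Longrightarrow> E' v \<in> V (Suc (Suc j))"
    "\<And>u v. v \<in> V (Suc (Suc j)) \<Longrightarrow> u \<in> V (Suc j) \<Longrightarrow> b (E u) v = b u (E' v)"
    by blast
  have eqI: "x = y" if "x \<in> V (Suc (Suc j))" "y \<in> V (Suc (Suc j))"
    "\<And>u. u \<in> V (Suc j) \<Longrightarrow> b u x = b u y" for x y
    using right_nondegD[OF R, of "x - y"] that by auto
  have "flag_idempotent (Suc j) E'" unfolding flag_idempotent_def
  proof (intro conjI ballI allI impI)
    show "linear E'" by fact
    show "E' v \<in> V (Suc (Suc j))" if "v \<in> V (Suc (Suc j))" for v using E'(2)[OF that] .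
    show "E' (E' v) = E' v" if v: "v \<in> V (Suc (Suc j))" for v
    proof (rule eqI)
      fix u assume u: "u \<in> V (Suc j)"
      show "b u (E' (E' v)) = b u (E' v)"
        using E'(3)[OF v u] E'(3)[OF E'(2)[OF v] u] E'(3)[OF v EV[OF u]] EE[OF u] by simp
    qed (use v E'(2) in auto)
    show "E' (J v) = J (E' v)" if v: "v \<in> V (Suc (Suc j))" for v
    proof (rule eqI)
      fix u assume u: "u \<in> V (Suc j)"
      have "b u (E' (J v)) = b (E u) (J v)" using E'(3)[OF JV[OF v] u] by simp
      also have "\<dots> = - b (E (J u)) v" using b_J_right[OF EV[OF u] v] EJ[OF u] by simp
      also have "\<dots> = - b (J u) (E' v)" using E'(3)[OF v JV[OF u]] by simp
      also have "\<dots> = b u (J (E' v))" using b_J_right[OF u E'(2)[OF v]] by simp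
      finally show "b u (E' (J v)) = b u (J (E' v))" .
    qed (use v E'(2) JV in auto)
    show "E' v \<in> S" if S: "flag (Suc (Suc j)) S" and v: "v \<in> S" for S v
    proof -
      have v2: "v \<in> V (Suc (Suc j))" using flag_subset[OF S] v by blast
      have "b u (E' v) = 0" if u: "u \<in> perp (Suc j) S" for u
      proof -
        have "E u \<in> perp (Suc j) S" using ES[OF flag.perp[OF S] u] .
        then show ?thesis using E'(3)[OF v2] u v by (auto simp: perp_def)
      qed
      then show ?thesis by (subst double_perp[OF R S]) (use E'(2)[OF v2] in auto)
    qed
  qed
  then show ?thesis using E'(3) by blast
qed

text \<open>The form in which undecomposability is applied: the maps up to level \<open>j\<close>
  and an idempotent at level \<open>Suc j\<close> are prescribed, and the levels above are filled in
  by iterating \<open>extend_step\<close>.\<close>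

lemma indecomposable_glue:
  assumes R: "\<And>i. Suc j \<le> i \<Longrightarrow> right_nondeg i" and E: "flag_idempotent j E"
    and G: "\<And>i. i \<le> j \<Longrightarrow> linear (G i)" "\<And>i v. i \<le> j \<Longrightarrow> v \<in> V i \<Longrightarrow> G i v \<in> V i"
      "\<And>i v. i \<le> j \<Longrightarrow> v \<in> V i \<Longrightarrow> G i (G i v) = G i v"
      "\<And>i v. Suc i \<le> j \<Longrightarrow> v \<in> V (Suc i) \<Longrightarrow> G (Suc i) (J v) = J (G (Suc i) v)"
      "\<And>i u v. i < j \<Longrightarrow> u \<in> V i \<Longrightarrow> v \<in> V (Suc i) \<Longrightarrow> b (G i u) v = b u (G (Suc i) v)"
      "\<And>u v. u \<in> V j \<Longrightarrow> v \<in> V (Suc j) \<Longrightarrow> b (G j u) v = b u (E v)"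
  shows "(\<forall>i\<le>j. \<forall>v\<in>V i. G i v = 0) \<and> (\<forall>v\<in>V (Suc j). E v = 0) \<or>
    (\<forall>i\<le>j. \<forall>v\<in>V i. G i v = v) \<and> (\<forall>v\<in>V (Suc j). E v = v)"
proof -
  \<comment> \<open>The \<open>n\<close>-th chosen map acts on \<open>V (Suc (j + n))\<close>; the
    clause for \<open>n = 0\<close> makes the sequence start with \<open>E\<close>.\<close>
  define P where "P n F \<longleftrightarrow> flag_idempotent (j + n) F \<and> (n = 0 \<longrightarrow> F = E)" for n F
  define Q where "Q n F F' \<longleftrightarrow>
    (\<forall>u\<in>V (Suc (j + n)). \<forall>v\<in>V (Suc (Suc (j + n))). b (F u) v = b u (F' v))" for n F F'
  have "\<exists>F. \<forall>n. P n (F n) \<and> Q n (F n) (F (Suc n))"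
  proof (rule dependent_nat_choice)
    show "\<exists>F. P 0 F" using E by (auto simp: P_def)
    show "\<exists>F'. P (Suc n) F' \<and> Q n F F'" if "P n F" for F n
      using extend_step[OF R, of "j + n" F] that unfolding P_def Q_def by auto
  qed
  then obtain F where F: "\<And>n. P n (F n)" "\<And>n. Q n (F n) (F (Suc n))" by blast
  define H where "H i = (if i \<le> j then G i else F (i - Suc j))" for i
  have Fid: "flag_idempotent (i - 1) (F (i - Suc j))" if ij: "\<not> i \<le> j" for i
  proof -
    obtain n where "i = Suc (j + n)" using ij less_iff_Suc_add[of j i] unfolding not_le by blast
    then show ?thesis using F(1)[of n] by (simp add: P_def)
  qed
  have Suc1: "Suc (i - 1) = i" if "\<not> i \<le> j" for i using that by simp
  have F0: "F 0 = E" using F(1)[of 0] by (simp add: P_def)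
  have "(\<forall>i. \<forall>v\<in>V i. H i v = 0) \<or> (\<forall>i. \<forall>v\<in>V i. H i v = v)"
  proof (rule indecomposable)
    show "linear (H i)" for i
      using G(1)[of i] Fid[of i] by (auto simp: H_def flag_idempotent_def)
    show "H i v \<in> V i" if "v \<in> V i" for i v
      using G(2)[of i v] Fid[of i] Suc1[of i] that by (auto simp: H_def flag_idempotent_def)
    show "H i (H i v) = H i v" if "v \<in> V i" for i v
      using G(3)[of i v] Fid[of i] Suc1[of i] that by (auto simp: H_def flag_idempotent_def)
    show "H (Suc i) (J v) = J (H (Suc i) v)" if "v \<in> V (Suc i)" for i v
      using G(4)[of i v] Fid[of "Suc i"] that by (auto simp: H_def flag_idempotent_def)
    fix i u v assume uv: "u \<in> V i" "v \<in> V (Suc i)"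
    consider "i < j" | "i = j" | "j < i" by linarith
    then show "b (H i u) v = b u (H (Suc i) v)"
    proof cases
      case 1
      then show ?thesis using G(5)[of i u v] uv by (simp add: H_def)
    next
      case 2
      then show ?thesis using G(6)[of u v] uv F0 by (simp add: H_def)
    next
      case 3
      then obtain n where n: "i = Suc (j + n)" using less_iff_Suc_add[of j i] by blast
      then show ?thesis using F(2)[of n] uv by (simp add: H_def Q_def)
    qed
  qed
  then show ?thesis
  proof
    assume *: "\<forall>i. \<forall>v\<in>V i. H i v = 0"
    have "G i v = 0" if "i \<le> j" "v \<in> V i" for i v
      using *[rule_format, of v i] that by (simp add: H_def)
    moreover have "E v = 0" if "v \<in> V (Suc j)" for v
      using *[rule_format, OF that] by (simp add: H_def F0)
    ultimately show ?thesis by blast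
  next
    assume *: "\<forall>i. \<forall>v\<in>V i. H i v = v"
    have "G i v = v" if "i \<le> j" "v \<in> V i" for i v
      using *[rule_format, of v i] that by (simp add: H_def)
    moreover have "E v = v" if "v \<in> V (Suc j)" for v
      using *[rule_format, OF that] by (simp add: H_def F0)
    ultimately show ?thesis by blast
  qed
qed

text \<open>A vector \<open>v\<close> orthogonal to everything on its left spans a complex line that
  splits off: take zero on the levels up to \<open>i\<close> and a rank-one idempotent onto this
  line at level \<open>Suc i\<close>. Adjointness between the two levels holds because both sides
  vanish.\<close>

lemma right_nondeg: "right_nondeg i"
proof -
  \<comment> \<open>Descending induction on the level: \<open>k\<close> bounds the distance to
    \<open>M\<close>, above which all spaces are zero.\<close>
  have "right_nondeg i" if "M \<le> i + k" for i k
    using that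
  proof (induction k arbitrary: i)
    case 0
    then show ?case using V_top[of "Suc i"] by (simp add: right_nondeg_def)
  next
    case (Suc k)
    have R: "right_nondeg i'" if "Suc i \<le> i'" for i' using Suc.IH[of i'] Suc.prems that by simp
    show ?case
    proof (rule ccontr)
      assume "\<not> right_nondeg i"
      then obtain v where v: "v \<in> V (Suc i)" "v \<noteq> 0"
        and v0: "\<And>u. u \<in> V i \<Longrightarrow> b u v = 0 \<and> b u (J v) = 0"
        by (auto simp: right_nondeg_def)
      \<comment> \<open>The union of the members that miss \<open>v\<close>. They form a chain, so
        it is a subspace, and \<open>{0}\<close> is added for the case that there are none.\<close>
      define C where "C = \<Union> {S. flag (Suc i) S \<and> v \<notin> S} \<union> {0}"
      have C: "subspace C" unfolding subspace_def
      proof (intro conjI ballI allI)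
        show "0 \<in> C" by (simp add: C_def)
        show "c *\<^sub>R x \<in> C" if "x \<in> C" for c x
          using that flag_subspace subspace_mul by (fastforce simp: C_def)
        fix x y assume "x \<in> C" "y \<in> C"
        moreover have "x + y \<in> C" if "x \<in> S" "flag (Suc i) S" "v \<notin> S" "y \<in> S'" "flag (Suc i) S'" "v \<notin> S'" for S S'
        proof -
          have "x + y \<in> S \<or> x + y \<in> S'"
            using flag_linear[OF that(2,5)] that flag_subspace subspace_add by (metis subsetD)
          then show ?thesis using that by (auto simp: C_def)
        qed
        ultimately show "x + y \<in> C" by (auto simp: C_def)
      qed
      have CJ: "J s \<in> C" if "s \<in> C" for s using that flag_J by (auto simp: C_def)
      have "v \<notin> C" using v by (auto simp: C_def)
      then have "\<exists>\<mu>::'a \<Rightarrow> real. linear \<mu> \<and> \<mu> v = 1 \<and> \<mu> (J v) = 0 \<and> (\<forall>s\<in>C. \<mu> s = 0)"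
        by (intro complex_functional[OF C _ v(1)]) (auto intro: CJ)
      then obtain \<mu> :: "'a \<Rightarrow> real"
        where \<mu>: "linear \<mu>" "\<mu> v = 1" "\<mu> (J v) = 0" "\<And>s. s \<in> C \<Longrightarrow> \<mu> s = 0"
        by blast
      have E: "flag_idempotent i (rank_one \<mu> v)"
        by (rule flag_idempotent_rank_one[OF \<mu>(1) v(1) \<mu>(2,3)]) (use \<mu>(4) in \<open>auto simp: C_def\<close>)
      have "rank_one \<mu> v v = v" by (rule rank_one_simps(1)[OF \<mu>(1) v(1) \<mu>(2,3)])
      moreover obtain u where "u \<in> V 0" "u \<noteq> 0" using V_0 V_closed(1) by blast
      \<comment> \<open>The first alternative contradicts \<open>v \<noteq> 0\<close>, the second
        contradicts that \<open>V 0\<close> is nonzero.\<close>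
      moreover have "(\<forall>i'\<le>i. \<forall>v\<in>V i'. 0 = (0::'a)) \<and> (\<forall>w\<in>V (Suc i). rank_one \<mu> v w = 0) \<or>
        (\<forall>i'\<le>i. \<forall>v\<in>V i'. 0 = v) \<and> (\<forall>w\<in>V (Suc i). rank_one \<mu> v w = w)"
        by (rule indecomposable_glue[OF R E]) (auto simp: v0 rank_one_def linear_zero)
      ultimately show False using v by auto
    qed
  qed
  from this[of i M] show ?thesis by simp
qed

text \<open>Here \<open>\<xi> k\<close> is the real part of the \<open>k\<close>-th complex coordinate.\<close>

definition complex_basis :: "nat \<Rightarrow> nat \<Rightarrow> (nat \<Rightarrow> 'a) \<Rightarrow> (nat \<Rightarrow> 'a \<Rightarrow> real) \<Rightarrow> bool" where
  "complex_basis j q c \<xi> \<longleftrightarrow> (\<forall>k<q. c k \<in> V j \<and> linear (\<xi> k)) \<and>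
     (\<forall>k<q. \<forall>m<q. \<xi> k (c m) = (if k = m then 1 else 0) \<and> \<xi> k (J (c m)) = 0) \<and>
     (\<forall>v\<in>V j. v = (\<Sum>k<q. \<xi> k v *\<^sub>R c k - \<xi> k (J v) *\<^sub>R J (c k)))"

text \<open>A basis adapted to the flag: each member is cut out by the vanishing of some complex
  coordinates. Thanks to this a dual basis in the next space yields an identity matrix with inserted
  zero rows.\<close>

definition coordinate_flags :: "nat \<Rightarrow> nat \<Rightarrow> (nat \<Rightarrow> 'a \<Rightarrow> real) \<Rightarrow> bool" where
  "coordinate_flags j q \<xi> \<longleftrightarrow> (\<forall>S. flag j S \<longrightarrow>
     (\<exists>I. I \<subseteq> {..<q} \<and> S = {v \<in> V j. \<forall>k\<in>I. \<xi> k v = 0 \<and> \<xi> k (J v) = 0}))"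

lemma coordinate_flagsE:
  assumes "coordinate_flags j q \<xi>" "flag j S"
  obtains I where "I \<subseteq> {..<q}" "S = {v \<in> V j. \<forall>k\<in>I. \<xi> k v = 0 \<and> \<xi> k (J v) = 0}"
  using assms unfolding coordinate_flags_def by meson

section \<open>The pairing of the real space \<open>V 0\<close> with \<open>V 1\<close>\<close>

definition real_basis :: "nat \<Rightarrow> (nat \<Rightarrow> 'a) \<Rightarrow> (nat \<Rightarrow> 'a \<Rightarrow> real) \<Rightarrow> bool" where
  "real_basis q f \<eta> \<longleftrightarrow> (\<forall>k<q. f k \<in> V 0 \<and> linear (\<eta> k)) \<and>
     (\<forall>k<q. \<forall>m<q. \<eta> k (f m) = (if k = m then 1 else 0)) \<and> V 0 \<subseteq> span (f ` {..<q})"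

text \<open>Idempotence of \<open>E0\<close> is inherited from its adjoint by left nondegeneracy,
  and the nonzero fixed vector \<open>w\<close> excludes the zero alternative of
  undecomposability.\<close>

lemma idempotent_trivial:
  assumes E: "flag_idempotent 0 E" and E0: "linear E0" "\<And>u. u \<in> V 0 \<Longrightarrow> E0 u \<in> V 0"
    and adj: "\<And>u v. u \<in> V 0 \<Longrightarrow> v \<in> V (Suc 0) \<Longrightarrow> b (E0 u) v = b u (E v)"
    and w: "w \<in> V (Suc 0)" "E w = w" "w \<noteq> 0"
  shows "(\<forall>u\<in>V 0. E0 u = u) \<and> (\<forall>v\<in>V (Suc 0). E v = v)"
proof -
  have EV: "\<And>v. v \<in> V (Suc 0) \<Longrightarrow> E v \<in> V (Suc 0)" "\<And>v. v \<in> V (Suc 0) \<Longrightarrow> E (E v) = E v"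
    using E unfolding flag_idempotent_def by blast+
  have idem: "E0 (E0 u) = E0 u" if u: "u \<in> V 0" for u
  proof -
    have "E0 (E0 u) - E0 u = 0"
      by (rule left_nondeg) (use E0(2) u EV in \<open>auto simp: adj\<close>)
    then show ?thesis by simp
  qed
  have "(\<forall>i\<le>0. \<forall>v\<in>V i. E0 v = 0) \<and> (\<forall>v\<in>V (Suc 0). E v = 0) \<or>
    (\<forall>i\<le>0. \<forall>v\<in>V i. E0 v = v) \<and> (\<forall>v\<in>V (Suc 0). E v = v)"
    by (rule indecomposable_glue[OF right_nondeg E]) (use E0 adj idem in auto)
  then show ?thesis using w by auto
qed

text \<open>If the rank-one idempotent is the identity, \<open>V 1\<close> is a complex line, so a
  flag member can only be 0 or \<open>V 1\<close>.\<close>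

lemma rank_one_basis:
  assumes \<mu>: "linear \<mu>" and v: "v \<in> V (Suc 0)" "\<mu> v = 1" "\<mu> (J v) = 0"
    and S: "\<And>S. flag (Suc 0) S \<Longrightarrow> v \<in> S \<or> (\<forall>s\<in>S. \<mu> s = 0)"
    and id: "\<And>x. x \<in> V (Suc 0) \<Longrightarrow> rank_one \<mu> v x = x"
  shows "complex_basis (Suc 0) 1 (\<lambda>_. v) (\<lambda>_. \<mu>)" "coordinate_flags (Suc 0) 1 (\<lambda>_. \<mu>)"
proof -
  show "complex_basis (Suc 0) 1 (\<lambda>_. v) (\<lambda>_. \<mu>)"
    using \<mu> v id by (auto simp: complex_basis_def rank_one_def)
  show "coordinate_flags (Suc 0) 1 (\<lambda>_. \<mu>)"
    unfolding coordinate_flags_def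
  proof (intro allI impI)
    fix S assume F: "flag (Suc 0) S"
    note sub = flag_subspace[OF F]
    show "\<exists>I. I \<subseteq> {..<1::nat} \<and> S = {v \<in> V (Suc 0). \<forall>k\<in>I. \<mu> v = 0 \<and> \<mu> (J v) = 0}"
    proof (cases "v \<in> S")
      case True
      have "x \<in> S" if "x \<in> V (Suc 0)" for x
      proof -
        have "rank_one \<mu> v x \<in> S" unfolding rank_one_def
          using True flag_J[OF F _ True] by (intro subspace_diff[OF sub] subspace_mul[OF sub]) auto
        then show ?thesis using id[OF that] by simp
      qed
      then show ?thesis using flag_subset[OF F] by (intro exI[of _ "{}"]) auto
    next
      case False
      then have 0: "\<mu> s = 0" if "s \<in> S" for s using S[OF F] that by blast
      have "x \<in> S" if "x \<in> V (Suc 0)" "\<mu> x = 0" "\<mu> (J x) = 0" for x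
        using id[OF that(1)] that(2,3) subspace_0[OF sub] by (simp add: rank_one_def)
      moreover have "J s \<in> S" if "s \<in> S" for s using flag_J[OF F _ that] by simp
      ultimately have "S = {v \<in> V (Suc 0). \<forall>k\<in>{0::nat}. \<mu> v = 0 \<and> \<mu> (J v) = 0}"
        using flag_subset[OF F] 0 by blast
      then show ?thesis by (intro exI[of _ "{0}"]) simp
    qed
  qed
qed

text \<open>The numbers are the entries of \<open>W\<^sub>0\<close>, with rows
  \<open>f 0, f 1\<close> and columns \<open>c 0, J (c 0), c 1, J (c 1)\<close>.\<close>

definition standard_start :: "nat \<Rightarrow> nat \<Rightarrow> (nat \<Rightarrow> 'a) \<Rightarrow> (nat \<Rightarrow> 'a) \<Rightarrow> bool" where
  "standard_start p q f c \<longleftrightarrow>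
     p = 1 \<and> q = 1 \<and> b (f 0) (c 0) = 1 \<and> b (f 0) (J (c 0)) = 0 \<or>
     p = 2 \<and> q = 1 \<and> b (f 0) (c 0) = 1 \<and> b (f 0) (J (c 0)) = 0 \<and>
       b (f 1) (c 0) = 0 \<and> b (f 1) (J (c 0)) = 1 \<or>
     p = 2 \<and> q = 2 \<and> b (f 0) (c 0) = 1 \<and> b (f 0) (J (c 0)) = 0 \<and>
       b (f 0) (c 1) = 0 \<and> b (f 0) (J (c 1)) = 1 \<and>
       b (f 1) (c 0) = 0 \<and> b (f 1) (J (c 0)) = 1 \<and>
       b (f 1) (c 1) = 1 \<and> b (f 1) (J (c 1)) = 0"

abbreviation has_standard_start :: bool where
  "has_standard_start \<equiv> \<exists>p q f \<eta> c \<xi>. real_basis p f \<eta> \<and> complex_basis (Suc 0) q c \<xi> \<and>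
    coordinate_flags (Suc 0) q \<xi> \<and> standard_start p q f c"

text \<open>The case in which the real space \<open>V 0\<close>, seen in the dual of \<open>V 1\<close>, contains a complex line.\<close>

lemma start_complex:
  assumes u: "u \<in> V 0" "u' \<in> V 0" "u \<noteq> 0" and uu: "\<And>v. v \<in> V (Suc 0) \<Longrightarrow> b u' v = b u (J v)"
  shows has_standard_start
proof -
  have "\<exists>v\<in>V (Suc 0). b u v \<noteq> 0" using left_nondeg[OF u(1)] u(3) by blast
  then have "flag (Suc 0) (V (Suc 0)) \<and> (\<exists>v\<in>V (Suc 0). b u v \<noteq> 0)" using flag.top by blast
  \<comment> \<open>By minimality every member of the flag either contains \<open>S\<close>, and
    with it the vector \<open>v\<close> below, or lies in the kernel of \<open>b u\<close>.\<close>
  from ex_has_least_nat[of "\<lambda>S. flag (Suc 0) S \<and> (\<exists>v\<in>S. b u v \<noteq> 0)", OF this, of dim]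
  obtain S v0 where S: "flag (Suc 0) S" "v0 \<in> S" "b u v0 \<noteq> 0"
    and Smin: "\<And>S'. flag (Suc 0) S' \<Longrightarrow> \<exists>v\<in>S'. b u v \<noteq> 0 \<Longrightarrow> dim S \<le> dim S'" by blast
  note sub = flag_subspace[OF S(1)]
  have v0: "v0 \<in> V (Suc 0)" using S flag_subset by blast
  \<comment> \<open>\<open>v\<close> is \<open>v0\<close> divided by its value under the complex
    functional with real part \<open>b u\<close>; \<open>N\<close> is the squared modulus of that
    value.\<close>
  define N where "N = b u v0 * b u v0 + b u (J v0) * b u (J v0)"
  have N: "N \<noteq> 0" using S(3) by (simp add: N_def add_nonneg_eq_0_iff)
  define v where "v = (b u v0 / N) *\<^sub>R v0 + (b u (J v0) / N) *\<^sub>R J v0"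
  have vS: "v \<in> S" unfolding v_def
    using S flag_J[OF S(1)] by (intro subspace_add[OF sub] subspace_mul[OF sub]) auto
  then have v: "v \<in> V (Suc 0)" using S flag_subset by blast
  have bv: "b u v = 1" "b u (J v) = 0"
    using N JJ[OF v0] by (simp_all add: v_def N_def add_divide_distrib[symmetric])
  have lin: "linear (b u)" using b by (simp add: bilinear_def)
  have flags: "v \<in> S' \<or> (\<forall>s\<in>S'. b u s = 0)" if "flag (Suc 0) S'" for S'
    using Smin[OF that] flag_dim_subset[OF S(1) that] vS by blast
  let ?E = "rank_one (b u) v"
  have E: "flag_idempotent 0 ?E" by (rule flag_idempotent_rank_one[OF lin v bv flags])
  \<comment> \<open>The adjoint of the idempotent. It has values in \<open>V 0\<close> because
    \<open>b u (J x)\<close> is \<open>b u' x\<close> with \<open>u'\<close> in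
    \<open>V 0\<close>.\<close>
  define E0 where "E0 a = b a v *\<^sub>R u - b a (J v) *\<^sub>R u'" for a
  have "(\<forall>a\<in>V 0. E0 a = a) \<and> (\<forall>x\<in>V (Suc 0). ?E x = x)"
  proof (rule idempotent_trivial[OF E])
    show "linear E0" by (intro linearI) (simp_all add: E0_def algebra_simps)
    show "E0 a \<in> V 0" for a using u by (auto simp: E0_def)
    show "b (E0 a) x = b a (?E x)" if "x \<in> V (Suc 0)" for a x
      using uu[OF that] by (simp add: E0_def rank_one_def)
    show "?E v = v" by (rule rank_one_simps[OF lin v bv])
    show "v \<noteq> 0" using bv by auto
  qed (fact v)
  then have E0: "\<And>a. a \<in> V 0 \<Longrightarrow> E0 a = a" and id: "\<And>x. x \<in> V (Suc 0) \<Longrightarrow> ?E x = x" by auto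
  have u'v: "b u' v = 0" "b u' (J v) = -1" using uu[OF v] uu[OF JV[OF v]] bv JJ[OF v] by auto
  \<comment> \<open>The sign makes the pairing of \<open>f 1\<close> with \<open>J v\<close> equal
    to 1.\<close>
  define f where "f k = (if k = 0 then u else - u')" for k :: nat
  define \<eta> where "\<eta> k = (if k = 0 then (\<lambda>a. b a v) else (\<lambda>a. b a (J v)))" for k :: nat
  have "real_basis 2 f \<eta>" unfolding real_basis_def
  proof (intro conjI)
    show "\<forall>k<2. f k \<in> V 0 \<and> linear (\<eta> k)"
      using u b by (auto simp: f_def \<eta>_def bilinear_def)
    show "\<forall>k<2. \<forall>m<2. \<eta> k (f m) = (if k = m then 1 else 0)"
      using bv u'v by (auto simp: f_def \<eta>_def less_2_cases_iff)
    show "V 0 \<subseteq> span (f ` {..<2})"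
    proof
      fix a assume "a \<in> V 0"
      then have "a = b a v *\<^sub>R f 0 + b a (J v) *\<^sub>R f 1" using E0[of a] by (simp add: E0_def f_def)
      moreover have "b a v *\<^sub>R f 0 + b a (J v) *\<^sub>R f 1 \<in> span (f ` {..<2})"
        by (intro span_add span_mul span_base) auto
      ultimately show "a \<in> span (f ` {..<2})" by simp
    qed
  qed
  moreover have "standard_start 2 1 f (\<lambda>_. v)"
    using bv u'v by (simp add: standard_start_def f_def)
  ultimately show ?thesis using rank_one_basis[OF lin v bv flags id] by blast
qed

text \<open>The case of a real vector in the smallest member of the flag.\<close>

lemma start_real:
  assumes r: "r \<in> V (Suc 0)" "r \<noteq> 0" "\<And>a. a \<in> V 0 \<Longrightarrow> b a (J r) = 0"
    and flags: "\<And>S. flag (Suc 0) S \<Longrightarrow> S \<noteq> {0} \<Longrightarrow> r \<in> S"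
  shows has_standard_start
proof -
  \<comment> \<open>The right kernel of the real pairing contains \<open>J r\<close> but not
    \<open>r\<close>. A functional that vanishes on it is represented by a vector \<open>a0\<close>
    of \<open>V 0\<close>, from which the adjoint is built.\<close>
  define Z where "Z = {v \<in> V (Suc 0). \<forall>a\<in>V 0. b a v = 0}"
  have Z: "subspace Z" by (auto simp: Z_def subspace_def)
  have "r \<notin> Z" using right_nondeg[of 0] r by (auto simp: Z_def right_nondeg_def)
  then obtain \<mu> :: "'a \<Rightarrow> real" where \<mu>: "linear \<mu>" "\<mu> r = 1" "\<And>s. s \<in> Z \<Longrightarrow> \<mu> s = 0"
    using linear_separation[OF Z] by blast
  have \<mu>J: "\<mu> (J r) = 0" using r JV by (intro \<mu>(3)) (auto simp: Z_def)
  obtain a0 where a0: "a0 \<in> V 0" "\<And>w. w \<in> V (Suc 0) \<Longrightarrow> \<mu> w = b a0 w"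
    using left_rep[OF \<mu>(1), of 0] \<mu>(3) by (auto simp: Z_def)
  have flags': "r \<in> S \<or> (\<forall>s\<in>S. \<mu> s = 0)" if "flag (Suc 0) S" for S
    using flags[OF that] linear_0[OF \<mu>(1)] by (cases "S = {0}") auto
  let ?E = "rank_one \<mu> r"
  have E: "flag_idempotent 0 ?E" by (rule flag_idempotent_rank_one[OF \<mu>(1) r(1) \<mu>(2) \<mu>J flags'])
  define E0 where "E0 a = b a r *\<^sub>R a0" for a
  have "(\<forall>a\<in>V 0. E0 a = a) \<and> (\<forall>x\<in>V (Suc 0). ?E x = x)"
  proof (rule idempotent_trivial[OF E])
    show "linear E0" by (intro linearI) (simp_all add: E0_def algebra_simps)
    show "E0 a \<in> V 0" for a using a0 by (auto simp: E0_def)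
    show "b (E0 a) x = b a (?E x)" if "a \<in> V 0" "x \<in> V (Suc 0)" for a x
      using a0(2)[OF that(2)] r(3)[OF that(1)] by (simp add: E0_def rank_one_def)
    show "?E r = r" by (rule rank_one_simps[OF \<mu>(1) r(1) \<mu>(2) \<mu>J])
  qed (fact r)+
  then have E0: "\<And>a. a \<in> V 0 \<Longrightarrow> E0 a = a" and id: "\<And>x. x \<in> V (Suc 0) \<Longrightarrow> ?E x = x" by auto
  have "b a0 r = 1" using a0(2)[OF r(1)] \<mu>(2) by simp
  have "real_basis 1 (\<lambda>_. a0) (\<lambda>_ a. b a r)" unfolding real_basis_def
  proof (intro conjI)
    show "V 0 \<subseteq> span ((\<lambda>_. a0) ` {..<1::nat})"
    proof
      fix a assume "a \<in> V 0"
      then have "a = b a r *\<^sub>R a0" using E0[of a] by (simp add: E0_def)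
      moreover have "b a r *\<^sub>R a0 \<in> span ((\<lambda>_. a0) ` {..<1::nat})"
        by (intro span_mul span_base) auto
      ultimately show "a \<in> span ((\<lambda>_. a0) ` {..<1::nat})" by simp
    qed
  qed (use a0 b \<open>b a0 r = 1\<close> in \<open>auto simp: bilinear_def\<close>)
  moreover have "standard_start 1 1 (\<lambda>_. a0) (\<lambda>_. r)"
    using \<open>b a0 r = 1\<close> r(3)[OF a0(1)] by (simp add: standard_start_def)
  ultimately show ?thesis using rank_one_basis[OF \<mu>(1) r(1) \<mu>(2) \<mu>J flags' id] by blast
qed

text \<open>\<open>notB\<close> says that in the complex dual of \<open>V 1\<close> the real space
  \<open>V 0\<close> meets its multiple by the imaginary unit trivially. Its complex span is then a
  copy of \<open>V 0 \<times> V 0\<close>, where conjugation changes the sign of the second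
  component; \<open>h\<close> and \<open>g\<close> are the pairings before and after this change,
  and \<open>\<sigma>\<close> is the adjoint of the conjugation.\<close>

lemma conjugation_exists:
  assumes notB: "\<And>u u'. u \<in> V 0 \<Longrightarrow> u' \<in> V 0 \<Longrightarrow> (\<And>v. v \<in> V (Suc 0) \<Longrightarrow> b u' v = b u (J v)) \<Longrightarrow> u = 0"
  shows "\<exists>\<sigma>. linear \<sigma> \<and> (\<forall>w\<in>V (Suc 0). \<sigma> w \<in> V (Suc 0) \<and>
    (\<forall>a\<in>V 0. b a (\<sigma> w) = b a w \<and> b a (J (\<sigma> w)) = - b a (J w)))"
proof -
  define g :: "'a \<times> 'a \<Rightarrow> 'a \<Rightarrow> real" where "g p w = b (fst p) w - b (snd p) (J w)" for p w
  define h :: "'a \<times> 'a \<Rightarrow> 'a \<Rightarrow> real" where "h p w = b (fst p) w + b (snd p) (J w)" for p w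
  have g: "bilinear g" unfolding bilinear_def
    by (intro conjI allI linearI) (simp_all add: g_def algebra_simps)
  have h: "bilinear h" unfolding bilinear_def
    by (intro conjI allI linearI) (simp_all add: h_def algebra_simps)
  have h': "bilinear (\<lambda>w p. h p w)" using h by (auto simp: bilinear_def)
  have "\<exists>w'\<in>V (Suc 0). \<forall>p\<in>V 0 \<times> V 0. g p w = h p w'" if w: "w \<in> V (Suc 0)" for w
  proof (rule bilinear_representation[OF h' V subspace_Times[OF V V]])
    show "linear (\<lambda>p. g p w)" using g by (simp add: bilinear_def)
    fix p assume p: "p \<in> V 0 \<times> V 0" and 0: "\<And>u. u \<in> V (Suc 0) \<Longrightarrow> h p u = 0"
    obtain a a' where a: "p = (a, a')" "a \<in> V 0" "a' \<in> V 0" using p by auto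
    have 1: "b a v + b a' (J v) = 0" if "v \<in> V (Suc 0)" for v using 0[OF that] a by (simp add: h_def)
    have "a' = 0"
    proof (rule notB)
      show "b (- a) v = b a' (J v)" if "v \<in> V (Suc 0)" for v using 1[OF that] by simp
    qed (use a in auto)
    then have "a = 0" using left_nondeg[OF a(2)] 1 by auto
    then show "g p w = 0" using \<open>a' = 0\<close> a by (simp add: g_def)
  qed
  from bilinear_adjoint[OF g h V V this]
  obtain \<sigma> where \<sigma>: "linear \<sigma>" "\<And>w. w \<in> V (Suc 0) \<Longrightarrow> \<sigma> w \<in> V (Suc 0)"
    "\<And>w p. w \<in> V (Suc 0) \<Longrightarrow> p \<in> V 0 \<times> V 0 \<Longrightarrow> g p w = h p (\<sigma> w)" by blast
  have "b a (\<sigma> w) = b a w \<and> b a (J (\<sigma> w)) = - b a (J w)" if "w \<in> V (Suc 0)" "a \<in> V 0" for a w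
    using \<sigma>(3)[OF that(1), of "(a, 0)"] \<sigma>(3)[OF that(1), of "(0, a)"] that by (simp add: g_def h_def)
  then show ?thesis using \<sigma>(1,2) by blast
qed


text \<open>
  The remaining case; \<open>\<sigma>\<close> is the conjugation of \<open>V 1\<close> defined by \<open>V 0\<close>. The flag and its conjugate are in a relative position as in a Bruhat decomposition:
  \<open>G\<close> is the first member whose conjugate meets the smallest member \<open>K\<close>, in \<open>w\<close> say, and the
  idempotent \<open>w \<otimes> \<lambda> + \<sigma> w \<otimes> \<sigma> \<lambda>\<close>, with \<open>\<lambda>\<close> vanishing on the conjugate of the predecessor \<open>H\<close>
  of \<open>G\<close>, preserves the flag.
\<close>

lemma start_conjugate:
  assumes \<sigma>: "linear \<sigma>" "\<And>w. w \<in> V (Suc 0) \<Longrightarrow> \<sigma> w \<in> V (Suc 0)"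
      "\<And>w a. w \<in> V (Suc 0) \<Longrightarrow> a \<in> V 0 \<Longrightarrow> b a (\<sigma> w) = b a w"
      "\<And>w a. w \<in> V (Suc 0) \<Longrightarrow> a \<in> V 0 \<Longrightarrow> b a (J (\<sigma> w)) = - b a (J w)"
    and K: "flag (Suc 0) K" "K \<noteq> {0}" "\<And>S. flag (Suc 0) S \<Longrightarrow> S \<noteq> {0} \<Longrightarrow> K \<subseteq> S"
    and noreal: "\<And>r. r \<in> K \<Longrightarrow> (\<And>a. a \<in> V 0 \<Longrightarrow> b a (J r) = 0) \<Longrightarrow> r = 0"
  shows has_standard_start
proof -
  have s[simp]: "\<sigma> (x + y) = \<sigma> x + \<sigma> y" "\<sigma> (x - y) = \<sigma> x - \<sigma> y" "\<sigma> (c *\<^sub>R x) = c *\<^sub>R \<sigma> x"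
    "\<sigma> (- x) = - \<sigma> x" "\<sigma> 0 = 0" for x y c
    using linear_add[OF \<sigma>(1)] linear_diff[OF \<sigma>(1)] linear_cmul[OF \<sigma>(1)] linear_neg[OF \<sigma>(1)]
      linear_0[OF \<sigma>(1)] by auto
  have eqI: "x = y" if x: "x \<in> V (Suc 0)" and y: "y \<in> V (Suc 0)"
    and e: "\<And>a. a \<in> V 0 \<Longrightarrow> b a x = b a y" "\<And>a. a \<in> V 0 \<Longrightarrow> b a (J x) = b a (J y)" for x y
  proof -
    have "x - y \<in> V (Suc 0)" using x y by auto
    moreover have "\<forall>a\<in>V 0. b a (x - y) = 0 \<and> b a (J (x - y)) = 0" using e by simp
    ultimately have "x - y = 0" using right_nondeg[of 0] unfolding right_nondeg_def by blast
    then show ?thesis by simp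
  qed
  have ss: "\<sigma> (\<sigma> w) = w" if w: "w \<in> V (Suc 0)" for w
    by (rule eqI) (use w \<sigma>(2)[OF w] \<sigma>(2)[OF \<sigma>(2)[OF w]] \<sigma>(3,4)[OF w] \<sigma>(3,4)[OF \<sigma>(2)[OF w]] in auto)
  have sJ: "\<sigma> (J w) = - J (\<sigma> w)" if w: "w \<in> V (Suc 0)" for w
  proof (rule eqI)
    show "\<sigma> (J w) \<in> V (Suc 0)" "- J (\<sigma> w) \<in> V (Suc 0)" using w \<sigma>(2) JV by auto
    show "b a (\<sigma> (J w)) = b a (- J (\<sigma> w))" if "a \<in> V 0" for a
      using \<sigma>(3)[OF JV[OF w] that] \<sigma>(4)[OF w that] by simp
    show "b a (J (\<sigma> (J w))) = b a (J (- J (\<sigma> w)))" if "a \<in> V 0" for a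
      using \<sigma>(4)[OF JV[OF w] that] \<sigma>(3)[OF w that] JJ[OF w] JJ[OF \<sigma>(2)[OF w]] by simp
  qed
  have KV: "x \<in> V (Suc 0)" if "x \<in> K" for x using flag_subset[OF K(1)] that by blast
  note Ksub = flag_subspace[OF K(1)]
  define P where "P S \<longleftrightarrow> flag (Suc 0) S \<and> (\<exists>w\<in>K. w \<noteq> 0 \<and> \<sigma> w \<in> S)" for S
  obtain k0 where "k0 \<in> K" "k0 \<noteq> 0" using K(2) subspace_0[OF Ksub] by blast
  then have "P (V (Suc 0))" using \<sigma>(2) KV flag.top unfolding P_def by blast
  from ex_has_least_nat[of P, OF this, of dim]
  obtain G where G: "P G" and Gmin: "\<And>S. P S \<Longrightarrow> dim G \<le> dim S" by blast
  obtain w where w: "w \<in> K" "w \<noteq> 0" "\<sigma> w \<in> G" and FG: "flag (Suc 0) G" using G by (auto simp: P_def)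
  have wV: "w \<in> V (Suc 0)" using KV w by blast
  note swV = \<sigma>(2)[OF wV]
  note Gsub = flag_subspace[OF FG]
  \<comment> \<open>Otherwise \<open>w + \<sigma> w\<close>, and once this is zero also
    \<open>J w\<close>, is a vector of \<open>K\<close> on which \<open>V 0\<close> takes real
    values, so that \<open>noreal\<close> forces both to vanish.\<close>
  have "\<not> dim G \<le> dim K"
  proof
    assume "dim G \<le> dim K"
    then have swK: "\<sigma> w \<in> K" using flag_dim_subset[OF FG K(1)] w by blast
    have "w + \<sigma> w = 0"
      by (rule noreal) (use w swK \<sigma>(4)[OF wV] in \<open>auto intro: subspace_add[OF Ksub]\<close>)
    then have sw: "\<sigma> w = - w" by (simp add: eq_neg_iff_add_eq_0 add.commute)
    have JK: "J w \<in> K" using flag_J[OF K(1) _ w(1)] by simp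
    have "J w = 0"
      by (rule noreal) (use JK \<sigma>(3)[OF wV] JJ[OF wV] sw in auto)
    then show False using JJ[OF wV] w(2) by simp
  qed
  then have "flag (Suc 0) K \<and> dim K < dim G" using K(1) by simp
  moreover have "\<forall>S. flag (Suc 0) S \<and> dim S < dim G \<longrightarrow> dim S \<le> dim G" by auto
  ultimately obtain H where FH: "flag (Suc 0) H" "dim H < dim G"
    and Hmax: "\<And>S. flag (Suc 0) S \<Longrightarrow> dim S < dim G \<Longrightarrow> dim S \<le> dim H"
    using ex_has_greatest_nat[of "\<lambda>S. flag (Suc 0) S \<and> dim S < dim G" K dim "dim G"] by blast
  have KH: "K \<subseteq> H"
    using flag_dim_subset[OF K(1) FH(1)] Hmax[OF K(1)] \<open>\<not> dim G \<le> dim K\<close> by simp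
  have HV: "x \<in> V (Suc 0)" if "x \<in> H" for x using flag_subset[OF FH(1)] that by blast
  have split: "S \<subseteq> H \<or> G \<subseteq> S" if "flag (Suc 0) S" for S
    using flag_dim_subset[OF that FH(1)] flag_dim_subset[OF FG that] Hmax[OF that] by force
  have swH: "\<sigma> w \<notin> H"
    using Gmin[of H] FH w unfolding P_def by force
  have "w \<notin> \<sigma> ` H" using swH ss HV by force
  have "\<exists>\<mu>::'a \<Rightarrow> real. linear \<mu> \<and> \<mu> w = 1 \<and> \<mu> (J w) = 0 \<and> (\<forall>s\<in>\<sigma> ` H. \<mu> s = 0)"
  proof (rule complex_functional[OF _ _ wV \<open>w \<notin> \<sigma> ` H\<close>])
    show "subspace (\<sigma> ` H)" by (rule linear_subspace_image[OF \<sigma>(1) flag_subspace[OF FH(1)]])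
    fix s assume "s \<in> \<sigma> ` H"
    then obtain h where h: "s = \<sigma> h" "h \<in> H" by blast
    have "J s = \<sigma> (- J h)" using sJ[OF HV[OF h(2)]] h by simp
    moreover have "- J h \<in> H"
      using flag_J[OF FH(1) _ h(2)] subspace_neg[OF flag_subspace[OF FH(1)]] by simp
    ultimately show "J s \<in> \<sigma> ` H" by blast
  qed
  then obtain \<mu> :: "'a \<Rightarrow> real" where \<mu>: "linear \<mu>" "\<mu> w = 1" "\<mu> (J w) = 0"
    and \<mu>H: "\<And>h. h \<in> H \<Longrightarrow> \<mu> (\<sigma> h) = 0" by blast
  have m[simp]: "\<mu> (x + y) = \<mu> x + \<mu> y" "\<mu> (x - y) = \<mu> x - \<mu> y" "\<mu> (c *\<^sub>R x) = c * \<mu> x"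
    "\<mu> (- x) = - \<mu> x" "\<mu> 0 = 0" for x y c
    using linear_add[OF \<mu>(1)] linear_diff[OF \<mu>(1)] linear_cmul[OF \<mu>(1)] linear_neg[OF \<mu>(1)]
      linear_0[OF \<mu>(1)] by auto
  have wH: "w \<in> H" using w KH by blast
  have JH: "J h \<in> H" if "h \<in> H" for h using flag_J[OF FH(1) _ that] by simp
  have \<mu>JH: "\<mu> (J (\<sigma> h)) = 0" if "h \<in> H" for h
    using \<mu>H[OF JH[OF that]] sJ[OF HV[OF that]] by simp
  \<comment> \<open>Since \<open>w\<close> lies in \<open>H\<close>, \<open>\<mu>\<close> vanishes
    on the complex line of \<open>\<sigma> w\<close>; hence the two rank-one maps in
    \<open>E\<close> annihilate each other.\<close>
  note \<mu>w = \<mu>(2,3) \<mu>H[OF wH] \<mu>JH[OF wH]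
  let ?r = "rank_one \<mu> w"
  define E where "E x = ?r x + \<sigma> (?r (\<sigma> x))" for x
  have Eeq: "E x = \<mu> x *\<^sub>R w - \<mu> (J x) *\<^sub>R J w + \<mu> (\<sigma> x) *\<^sub>R \<sigma> w + \<mu> (J (\<sigma> x)) *\<^sub>R J (\<sigma> w)" for x
    using sJ[OF wV] by (simp add: E_def rank_one_def)
  have EV: "E x \<in> V (Suc 0)" for x
    unfolding Eeq using wV swV JV by auto
  have linE: "linear E"
    by (intro linearI) (simp_all add: Eeq algebra_simps)
  have e[simp]: "E (x + y) = E x + E y" "E (x - y) = E x - E y" "E (c *\<^sub>R x) = c *\<^sub>R E x" for x y c
    using linear_add[OF linE] linear_diff[OF linE] linear_cmul[OF linE] by auto
  have E4: "E w = w" "E (J w) = J w" "E (\<sigma> w) = \<sigma> w" "E (J (\<sigma> w)) = J (\<sigma> w)"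
    using \<mu>w ss[OF wV] sJ[OF wV] sJ[OF swV] JJ[OF wV] JJ[OF swV] by (simp_all add: Eeq)
  have EE: "E (E x) = E x" for x
  proof -
    have "E (E x) = E (\<mu> x *\<^sub>R w - \<mu> (J x) *\<^sub>R J w + \<mu> (\<sigma> x) *\<^sub>R \<sigma> w + \<mu> (J (\<sigma> x)) *\<^sub>R J (\<sigma> w))"
      by (rule arg_cong[OF Eeq])
    also have "\<dots> = \<mu> x *\<^sub>R w - \<mu> (J x) *\<^sub>R J w + \<mu> (\<sigma> x) *\<^sub>R \<sigma> w + \<mu> (J (\<sigma> x)) *\<^sub>R J (\<sigma> w)"
      by (simp only: e E4)
    also have "\<dots> = E x" by (rule Eeq[symmetric])
    finally show ?thesis .
  qed
  have EJ: "E (J x) = J (E x)" if "x \<in> V (Suc 0)" for x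
  proof -
    have "E (J x) = \<mu> (J x) *\<^sub>R w + \<mu> x *\<^sub>R J w - \<mu> (J (\<sigma> x)) *\<^sub>R \<sigma> w + \<mu> (\<sigma> x) *\<^sub>R J (\<sigma> w)"
      unfolding Eeq by (simp add: sJ[OF that] JJ[OF that] JJ[OF \<sigma>(2)[OF that]])
    moreover have "J (E x) = \<mu> x *\<^sub>R J w + \<mu> (J x) *\<^sub>R w + \<mu> (\<sigma> x) *\<^sub>R J (\<sigma> w) - \<mu> (J (\<sigma> x)) *\<^sub>R \<sigma> w"
      unfolding Eeq by (simp add: JJ[OF wV] JJ[OF swV])
    ultimately show ?thesis by simp
  qed
  have ES: "E x \<in> S" if S: "flag (Suc 0) S" and x: "x \<in> S" for S x
  proof (cases "S = {0}")
    case True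
    then show ?thesis using x by (simp add: Eeq)
  next
    case False
    note Ssub = flag_subspace[OF S]
    have wS: "w \<in> S" using K(3)[OF S False] w by blast
    have JwS: "J w \<in> S" using flag_J[OF S _ wS] by simp
    show ?thesis
    proof (cases "S \<subseteq> H")
      case True
      then have "\<mu> (\<sigma> x) = 0" "\<mu> (J (\<sigma> x)) = 0" using x \<mu>H \<mu>JH by blast+
      then show ?thesis
        unfolding Eeq using wS JwS by (auto intro: subspace_diff[OF Ssub] subspace_mul[OF Ssub])
    next
      case False
      then have swS: "\<sigma> w \<in> S" using split[OF S] w by blast
      then have "J (\<sigma> w) \<in> S" using flag_J[OF S _ swS] by simp
      then show ?thesis unfolding Eeq using swS wS JwS
        by (intro subspace_add[OF Ssub] subspace_diff[OF Ssub] subspace_mul[OF Ssub]) auto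
    qed
  qed
  have E: "flag_idempotent 0 E"
    unfolding flag_idempotent_def using linE EV EE EJ ES by blast
  \<comment> \<open>The coefficients of \<open>b a w\<close> and \<open>b a (J w)\<close> in
    \<open>b a (E x)\<close>. On the right kernel of the real pairing \<open>\<sigma>\<close> is
    \<open>-1\<close>, so both functionals vanish there and are represented by vectors of
    \<open>V 0\<close>.\<close>
  define \<phi> where "\<phi> x = \<mu> x + \<mu> (\<sigma> x)" for x
  define \<psi> where "\<psi> x = - \<mu> (J x) - \<mu> (J (\<sigma> x))" for x
  have neg: "\<sigma> x = - x" if x: "x \<in> V (Suc 0)" and 0: "\<And>a. a \<in> V 0 \<Longrightarrow> b a x = 0" for x
    by (rule eqI) (use x 0 \<sigma>(2)[OF x] \<sigma>(3,4)[OF x] in auto)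
  have "\<exists>u\<in>V 0. \<forall>x\<in>V (Suc 0). \<phi> x = b u x"
    by (rule left_rep) (use neg in \<open>auto simp: \<phi>_def intro!: linearI simp: algebra_simps\<close>)
  then obtain f0 where f0: "f0 \<in> V 0" "\<And>x. x \<in> V (Suc 0) \<Longrightarrow> b f0 x = \<phi> x" by metis
  have "\<exists>u\<in>V 0. \<forall>x\<in>V (Suc 0). \<psi> x = b u x"
    by (rule left_rep) (use neg in \<open>auto simp: \<psi>_def intro!: linearI simp: algebra_simps\<close>)
  then obtain f1 where f1: "f1 \<in> V 0" "\<And>x. x \<in> V (Suc 0) \<Longrightarrow> b f1 x = \<psi> x" by metis
  define E0 where "E0 a = b a w *\<^sub>R f0 + b a (J w) *\<^sub>R f1" for a
  have "(\<forall>a\<in>V 0. E0 a = a) \<and> (\<forall>x\<in>V (Suc 0). E x = x)"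
  proof (rule idempotent_trivial[OF E])
    show "linear E0" by (intro linearI) (simp_all add: E0_def algebra_simps)
    show "E0 a \<in> V 0" for a using f0 f1 by (auto simp: E0_def)
    show "b (E0 a) x = b a (E x)" if a: "a \<in> V 0" and x: "x \<in> V (Suc 0)" for a x
      by (simp add: \<sigma>(3,4)[OF wV a] f0(2)[OF x] f1(2)[OF x] E0_def Eeq \<phi>_def \<psi>_def algebra_simps)
  qed (use wV E4 w in auto)
  then have E0: "\<And>a. a \<in> V 0 \<Longrightarrow> E0 a = a" and id: "\<And>x. x \<in> V (Suc 0) \<Longrightarrow> E x = x" by auto
  have bf: "b f0 w = 1" "b f0 (J w) = 0" "b f1 w = 0" "b f1 (J w) = 1"
    using f0(2)[OF wV] f0(2)[OF JV[OF wV]] f1(2)[OF wV] f1(2)[OF JV[OF wV]] \<mu>w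
      sJ[OF wV] JJ[OF wV] JJ[OF swV] by (simp_all add: \<phi>_def \<psi>_def)
  have bfs: "b f0 (\<sigma> w) = 1" "b f0 (J (\<sigma> w)) = 0" "b f1 (\<sigma> w) = 0" "b f1 (J (\<sigma> w)) = -1"
    using bf \<sigma>(3,4)[OF wV f0(1)] \<sigma>(3,4)[OF wV f1(1)] by auto
  define f where "f k = (if k = 0 then f0 else f1)" for k :: nat
  define \<eta> where "\<eta> k = (if k = 0 then (\<lambda>a. b a w) else (\<lambda>a. b a (J w)))" for k :: nat
  \<comment> \<open>With \<open>\<sigma> w\<close> as second basis vector the right half of
    \<open>W\<^sub>0\<close> would be \<open>diag(1, -1)\<close>; the factor \<open>- J\<close>
    turns it into \<open>\<Omega>\<close>.\<close>
  define c where "c k = (if k = 0 then w else - J (\<sigma> w))" for k :: nat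
  define \<xi> where "\<xi> k = (if k = 0 then \<mu> else (\<lambda>x. - \<mu> (J (\<sigma> x))))" for k :: nat
  have "real_basis 2 f \<eta>" unfolding real_basis_def
  proof (intro conjI)
    show "\<forall>k<2. f k \<in> V 0 \<and> linear (\<eta> k)"
      using f0 f1 b by (auto simp: f_def \<eta>_def bilinear_def)
    show "\<forall>k<2. \<forall>m<2. \<eta> k (f m) = (if k = m then 1 else 0)"
      using bf by (auto simp: f_def \<eta>_def less_2_cases_iff)
    show "V 0 \<subseteq> span (f ` {..<2})"
    proof
      fix a assume "a \<in> V 0"
      then have "a = b a w *\<^sub>R f 0 + b a (J w) *\<^sub>R f 1" using E0[of a] by (simp add: E0_def f_def)
      moreover have "b a w *\<^sub>R f 0 + b a (J w) *\<^sub>R f 1 \<in> span (f ` {..<2})"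
        by (intro span_add span_mul span_base) auto
      ultimately show "a \<in> span (f ` {..<2})" by simp
    qed
  qed
  moreover have "complex_basis (Suc 0) 2 c \<xi>" unfolding complex_basis_def
  proof (intro conjI)
    have "linear (\<lambda>x. - \<mu> (J (\<sigma> x)))" by (intro linearI) simp_all
    then show "\<forall>k<2. c k \<in> V (Suc 0) \<and> linear (\<xi> k)"
      using wV swV JV \<mu>(1) by (auto simp: c_def \<xi>_def)
    show "\<forall>k<2. \<forall>m<2. \<xi> k (c m) = (if k = m then 1 else 0) \<and> \<xi> k (J (c m)) = 0"
      using \<mu>w sJ[OF wV] sJ[OF swV] ss[OF wV] JJ[OF wV] JJ[OF swV]
      by (auto simp: c_def \<xi>_def less_2_cases_iff)
    show "\<forall>v\<in>V (Suc 0). v = (\<Sum>k<2. \<xi> k v *\<^sub>R c k - \<xi> k (J v) *\<^sub>R J (c k))"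
    proof
      fix v assume v: "v \<in> V (Suc 0)"
      show "v = (\<Sum>k<2. \<xi> k v *\<^sub>R c k - \<xi> k (J v) *\<^sub>R J (c k))"
        using id[OF v] sJ[OF v] JJ[OF v] JJ[OF swV] JJ[OF \<sigma>(2)[OF v]]
        by (simp add: numeral_2_eq_2 \<xi>_def c_def Eeq algebra_simps)
    qed
  qed
  moreover have "coordinate_flags (Suc 0) 2 \<xi>" unfolding coordinate_flags_def
  proof (intro allI impI)
    fix S assume S: "flag (Suc 0) S"
    note Ssub = flag_subspace[OF S]
    have SV: "x \<in> V (Suc 0)" if "x \<in> S" for x using flag_subset[OF S] that by blast
    have JS: "J x \<in> S" if "x \<in> S" for x using flag_J[OF S _ that] by simp
    have \<xi>1: "\<xi> 1 x = - \<mu> (J (\<sigma> x))" "\<xi> 1 (J x) = - \<mu> (\<sigma> x)" if "x \<in> V (Suc 0)" for x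
      using sJ[OF that] JJ[OF \<sigma>(2)[OF that]] by (simp_all add: \<xi>_def)
    \<comment> \<open>A nonzero member inside \<open>H\<close> is the complex line of
      \<open>w\<close>; one containing \<open>G\<close> contains both lines and is all of
      \<open>V 1\<close>.\<close>
    consider "S = {0}" | "S \<noteq> {0}" "S \<subseteq> H" | "S \<noteq> {0}" "G \<subseteq> S" using split[OF S] by blast
    then show "\<exists>I\<subseteq>{..<2}. S = {v \<in> V (Suc 0). \<forall>k\<in>I. \<xi> k v = 0 \<and> \<xi> k (J v) = 0}"
    proof cases
      case 1
      have "x = 0" if "x \<in> V (Suc 0)" "\<xi> 0 x = 0" "\<xi> 0 (J x) = 0" "\<xi> 1 x = 0" "\<xi> 1 (J x) = 0" for x
        using id[OF that(1)] that \<xi>1[OF that(1)] by (simp add: Eeq \<xi>_def)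
      moreover have "\<xi> k 0 = 0" for k by (simp add: \<xi>_def)
      ultimately have "S = {v \<in> V (Suc 0). \<forall>k\<in>{0, 1}. \<xi> k v = 0 \<and> \<xi> k (J v) = 0}"
        unfolding 1 by auto
      then show ?thesis by (intro exI[of _ "{0, 1}"]) simp
    next
      case 2
      have wS: "w \<in> S" using K(3)[OF S 2(1)] w by blast
      have "x \<in> S" if "x \<in> V (Suc 0)" "\<xi> 1 x = 0" "\<xi> 1 (J x) = 0" for x
      proof -
        have "x = \<mu> x *\<^sub>R w - \<mu> (J x) *\<^sub>R J w"
          using id[OF that(1)] that \<xi>1[OF that(1)] by (simp add: Eeq)
        moreover have "\<mu> x *\<^sub>R w - \<mu> (J x) *\<^sub>R J w \<in> S"
          using wS JS[OF wS] by (intro subspace_diff[OF Ssub] subspace_mul[OF Ssub])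
        ultimately show ?thesis by simp
      qed
      moreover have "\<xi> 1 x = 0 \<and> \<xi> 1 (J x) = 0" if "x \<in> S" for x
        using \<xi>1[OF SV[OF that]] \<mu>H \<mu>JH that 2(2) by auto
      ultimately have "S = {v \<in> V (Suc 0). \<forall>k\<in>{1}. \<xi> k v = 0 \<and> \<xi> k (J v) = 0}"
        using SV by blast
      then show ?thesis by (intro exI[of _ "{1}"]) simp
    next
      case 3
      have wS: "w \<in> S" using K(3)[OF S 3(1)] w by blast
      have swS: "\<sigma> w \<in> S" using 3 w by blast
      have "E x \<in> S" for x unfolding Eeq using wS swS JS
        by (intro subspace_add[OF Ssub] subspace_diff[OF Ssub] subspace_mul[OF Ssub]) auto
      then have "x \<in> S" if "x \<in> V (Suc 0)" for x using id[OF that] by metis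
      then have "S = V (Suc 0)" using SV by blast
      then show ?thesis by (intro exI[of _ "{}"]) simp
    qed
  qed
  moreover have "standard_start 2 2 f c"
    using bf bfs JJ[OF swV] by (simp add: standard_start_def f_def c_def)
  ultimately show ?thesis by blast
qed

lemma V_1_nonzero: "V (Suc 0) \<noteq> {0}"
proof
  assume 0: "V (Suc 0) = {0}"
  have "u = 0" if "u \<in> V 0" for u using left_nondeg[OF that] 0 by simp
  then show False using V_0 V_closed(1)[of 0] by blast
qed

lemma start_exists:
  has_standard_start
proof (cases "\<exists>u\<in>V 0. \<exists>u'\<in>V 0. u \<noteq> 0 \<and> (\<forall>v\<in>V (Suc 0). b u' v = b u (J v))")
  case True
  then show ?thesis using start_complex by blast
next
  case False
  have notB: "u = 0" if "u \<in> V 0" "u' \<in> V 0" "\<And>v. v \<in> V (Suc 0) \<Longrightarrow> b u' v = b u (J v)" for u u'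
    using False that by blast
  have "flag (Suc 0) (V (Suc 0)) \<and> V (Suc 0) \<noteq> {0}" using flag.top V_1_nonzero by blast
  from ex_has_least_nat[of "\<lambda>S. flag (Suc 0) S \<and> S \<noteq> {0}", OF this, of dim]
  obtain K where K: "flag (Suc 0) K" "K \<noteq> {0}"
    and Kmin: "\<And>S. flag (Suc 0) S \<Longrightarrow> S \<noteq> {0} \<Longrightarrow> dim K \<le> dim S" by blast
  have KS: "K \<subseteq> S" if "flag (Suc 0) S" "S \<noteq> {0}" for S
    using flag_dim_subset[OF K(1) that(1)] Kmin[OF that] by blast
  show ?thesis
  proof (cases "\<exists>r\<in>K. r \<noteq> 0 \<and> (\<forall>a\<in>V 0. b a (J r) = 0)")
    case True
    then obtain r where r: "r \<in> K" "r \<noteq> 0" "\<And>a. a \<in> V 0 \<Longrightarrow> b a (J r) = 0" by blast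
    have "r \<in> V (Suc 0)" using r(1) flag_subset[OF K(1)] by blast
    then show ?thesis
    proof (rule start_real)
      show "r \<in> S" if "flag (Suc 0) S" "S \<noteq> {0}" for S using KS[OF that] r(1) by blast
    qed (fact r)+
  next
    case nr: False
    have "\<exists>\<sigma>. linear \<sigma> \<and> (\<forall>w\<in>V (Suc 0). \<sigma> w \<in> V (Suc 0) \<and>
      (\<forall>a\<in>V 0. b a (\<sigma> w) = b a w \<and> b a (J (\<sigma> w)) = - b a (J w)))"
      by (rule conjugation_exists) (rule notB)
    then obtain \<sigma> where \<sigma>: "linear \<sigma>" "\<And>w. w \<in> V (Suc 0) \<Longrightarrow> \<sigma> w \<in> V (Suc 0)"
      "\<And>w a. w \<in> V (Suc 0) \<Longrightarrow> a \<in> V 0 \<Longrightarrow> b a (\<sigma> w) = b a w"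
      "\<And>w a. w \<in> V (Suc 0) \<Longrightarrow> a \<in> V 0 \<Longrightarrow> b a (J (\<sigma> w)) = - b a (J w)"
      by blast
    show ?thesis
    proof (rule start_conjugate[OF \<sigma> K])
      show "K \<subseteq> S" if "flag (Suc 0) S" "S \<noteq> {0}" for S using KS[OF that] .
      show "r = 0" if "r \<in> K" "\<And>a. a \<in> V 0 \<Longrightarrow> b a (J r) = 0" for r using nr that by blast
    qed
  qed
qed


section \<open>Successive dual bases\<close>

definition incidence :: "nat set \<Rightarrow> nat \<Rightarrow> nat \<Rightarrow> real" where
  "incidence I k m = (if k = sorted_list_of_set I ! m then 1 else 0)"

text \<open>The left kernel of the pairing belongs to the flag, so it is cut out by the coordinates
  with index in some \<open>I\<close>. These coordinates are represented by vectors
  \<open>c'\<close> of the next space, and right nondegeneracy makes \<open>c'\<close> a basis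
  there. The next flag is again a coordinate flag because its members are double
  annihilators.\<close>

lemma next_basis:
  assumes B: "complex_basis (Suc j) q c \<xi>" and F: "coordinate_flags (Suc j) q \<xi>"
  shows "\<exists>I q' c' \<xi>'. I \<subseteq> {..<q} \<and> card I = q' \<and> complex_basis (Suc (Suc j)) q' c' \<xi>' \<and>
    coordinate_flags (Suc (Suc j)) q' \<xi>' \<and>
    (\<forall>k<q. \<forall>m<q'. b (c k) (c' m) = incidence I k m \<and> b (c k) (J (c' m)) = 0)"
proof -
  have c: "\<And>k. k < q \<Longrightarrow> c k \<in> V (Suc j)" and lin: "\<And>k. k < q \<Longrightarrow> linear (\<xi> k)"
    and \<xi>c: "\<And>k m. k < q \<Longrightarrow> m < q \<Longrightarrow> \<xi> k (c m) = (if k = m then 1 else 0)"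
      "\<And>k m. k < q \<Longrightarrow> m < q \<Longrightarrow> \<xi> k (J (c m)) = 0"
    and expand: "\<And>v. v \<in> V (Suc j) \<Longrightarrow> v = (\<Sum>k<q. \<xi> k v *\<^sub>R c k - \<xi> k (J v) *\<^sub>R J (c k))"
    using B unfolding complex_basis_def by blast+
  let ?K = "perp (Suc j) (V (Suc (Suc j)))"
  have "flag (Suc j) ?K" by (intro flag.intros)
  then obtain I where I: "I \<subseteq> {..<q}" "?K = {v \<in> V (Suc j). \<forall>k\<in>I. \<xi> k v = 0 \<and> \<xi> k (J v) = 0}"
    by (rule coordinate_flagsE[OF F])
  have finI: "finite I" using I(1) finite_subset by blast
  define q' where "q' = card I"
  \<comment> \<open>The increasing enumeration of \<open>I\<close>; its order is responsible for the
    echelon form.\<close>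
  define ix where "ix m = sorted_list_of_set I ! m" for m
  have ix: "bij_betw ix {..<q'} I"
    unfolding ix_def q'_def using finI bij_betw_nth[of "sorted_list_of_set I" "{..<card I}" I] by simp
  have ixI: "ix m \<in> I" if "m < q'" for m using ix that by (auto simp: bij_betw_def)
  have ixq: "ix m < q" if "m < q'" for m using ixI[OF that] I(1) by auto
  have ix_eq: "ix m = ix m' \<longleftrightarrow> m = m'" if "m < q'" "m' < q'" for m m'
    using ix that by (auto simp: bij_betw_def inj_on_def)
  have "\<exists>v\<in>V (Suc (Suc j)). \<forall>u\<in>V (Suc j). \<xi> (ix m) u = b u v" if m: "m < q'" for m
    by (rule right_rep[OF lin[OF ixq[OF m]]]) (use ixI[OF m] I(2) in auto)
  then obtain c' where c': "\<And>m. m < q' \<Longrightarrow> c' m \<in> V (Suc (Suc j))"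
    "\<And>m u. m < q' \<Longrightarrow> u \<in> V (Suc j) \<Longrightarrow> b u (c' m) = \<xi> (ix m) u"
    by metis
  have Jc': "b u (J (c' m)) = - \<xi> (ix m) (J u)" if "m < q'" "u \<in> V (Suc j)" for m u
    using b_J_right[OF that(2) c'(1)[OF that(1)]] c'(2)[OF that(1) JV[OF that(2)]] by simp
  define \<xi>' where "\<xi>' m v = b (c (ix m)) v" for m v
  have Jmove: "b (c k) (J v) = - b (J (c k)) v" if "k < q" "v \<in> V (Suc (Suc j))" for k v
    using b_J_right[OF c[OF that(1)] that(2)] .
  have kill: "b (c k) v = 0 \<and> b (J (c k)) v = 0" if k: "k < q" "k \<notin> I" and v: "v \<in> V (Suc (Suc j))" for k v
  proof -
    have "c k \<in> ?K" unfolding I(2) using k c[OF k(1)] \<xi>c I(1) by auto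
    moreover have "J (c k) \<in> ?K"
      using flag_J[of "Suc j" ?K "c k"] flag.intros calculation by auto
    ultimately show ?thesis using v by (auto simp: perp_def)
  qed
  have expand_b: "b u v = (\<Sum>m<q'. \<xi> (ix m) u * b (c (ix m)) v - \<xi> (ix m) (J u) * b (J (c (ix m))) v)"
    if u: "u \<in> V (Suc j)" and v: "v \<in> V (Suc (Suc j))" for u v
  proof -
    have lb: "linear (\<lambda>u. b u v)" using b by (simp add: bilinear_def)
    have "b u v = b (\<Sum>k<q. \<xi> k u *\<^sub>R c k - \<xi> k (J u) *\<^sub>R J (c k)) v" using expand[OF u] by simp
    also have "\<dots> = (\<Sum>k<q. \<xi> k u * b (c k) v - \<xi> k (J u) * b (J (c k)) v)"
      by (simp add: linear_sum[OF lb])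
    also have "\<dots> = (\<Sum>k\<in>I. \<xi> k u * b (c k) v - \<xi> k (J u) * b (J (c k)) v)"
      by (rule sum.mono_neutral_right) (use I(1) kill[OF _ _ v] in auto)
    also have "\<dots> = (\<Sum>m<q'. \<xi> (ix m) u * b (c (ix m)) v - \<xi> (ix m) (J u) * b (J (c (ix m))) v)"
      by (rule sum.reindex_bij_betw[OF ix, symmetric])
    finally show ?thesis .
  qed
  have "complex_basis (Suc (Suc j)) q' c' \<xi>'" unfolding complex_basis_def
  proof (intro conjI allI impI ballI)
    show "c' m \<in> V (Suc (Suc j))" if "m < q'" for m by (rule c'(1)[OF that])
    show "linear (\<xi>' m)" if "m < q'" for m using b by (auto simp: \<xi>'_def[abs_def] bilinear_def)
    show "\<xi>' k (c' m) = (if k = m then 1 else 0)" if "k < q'" "m < q'" for k m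
      using c'(2)[OF that(2) c[OF ixq[OF that(1)]]] \<xi>c(1)[OF ixq[OF that(2)] ixq[OF that(1)]] ix_eq[OF that]
      by (auto simp: \<xi>'_def)
    show "\<xi>' k (J (c' m)) = 0" if "k < q'" "m < q'" for k m
      using Jc'[OF that(2) c[OF ixq[OF that(1)]]] \<xi>c(2)[OF ixq[OF that(2)] ixq[OF that(1)]]
      by (simp add: \<xi>'_def)
    fix v assume v: "v \<in> V (Suc (Suc j))"
    let ?s = "\<Sum>k<q'. \<xi>' k v *\<^sub>R c' k - \<xi>' k (J v) *\<^sub>R J (c' k)"
    have sV: "?s \<in> V (Suc (Suc j))"
      by (rule subspace_sum[OF V]) (use c'(1) JV in auto)
    have "v - ?s = 0"
    proof (rule right_nondegD[OF right_nondeg])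
      show "v - ?s \<in> V (Suc (Suc j))" using v sV by auto
      fix u assume u: "u \<in> V (Suc j)"
      have lb: "linear (b u)" using b by (simp add: bilinear_def)
      have "b u ?s = (\<Sum>k<q'. \<xi>' k v * b u (c' k) - \<xi>' k (J v) * b u (J (c' k)))"
        by (simp add: linear_sum[OF lb])
      also have "\<dots> = b u v"
        unfolding expand_b[OF u v]
        by (rule sum.cong) (use c'(2)[OF _ u] Jc'[OF _ u] Jmove[OF ixq v] in \<open>auto simp: \<xi>'_def\<close>)
      finally show "b u (v - ?s) = 0" by simp
    qed
    then show "v = ?s" by simp
  qed
  moreover have "coordinate_flags (Suc (Suc j)) q' \<xi>'" unfolding coordinate_flags_def
  proof (intro allI impI)
    fix S assume S: "flag (Suc (Suc j)) S"
    obtain I2 where I2: "I2 \<subseteq> {..<q}"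
      "perp (Suc j) S = {v \<in> V (Suc j). \<forall>k\<in>I2. \<xi> k v = 0 \<and> \<xi> k (J v) = 0}"
      by (rule coordinate_flagsE[OF F flag.perp[OF S]])
    \<comment> \<open>The annihilator of \<open>S\<close> is the complex span of the
      \<open>c k\<close> with \<open>k \<notin> I2\<close>, so \<open>S\<close> is cut out by the
      dual coordinates with \<open>ix m \<notin> I2\<close>.\<close>
    define L where "L = {m. m < q' \<and> ix m \<notin> I2}"
    have fwd: "\<xi>' m v = 0 \<and> \<xi>' m (J v) = 0" if v: "v \<in> S" and m: "m \<in> L" for v m
    proof -
      have mq: "m < q'" "ix m \<notin> I2" using m by (auto simp: L_def)
      have "c (ix m) \<in> perp (Suc j) S" unfolding I2(2) using mq c[OF ixq] \<xi>c ixq I2(1) by auto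
      then have "b (c (ix m)) s = 0" if "s \<in> S" for s using that by (auto simp: perp_def)
      then show ?thesis using v flag_J[OF S _ v] by (simp add: \<xi>'_def)
    qed
    have bwd: "v \<in> S" if v: "v \<in> V (Suc (Suc j))" and 0: "\<And>m. m \<in> L \<Longrightarrow> \<xi>' m v = 0 \<and> \<xi>' m (J v) = 0" for v
    proof (subst double_perp[OF right_nondeg S], intro CollectI conjI ballI v)
      fix u assume u: "u \<in> perp (Suc j) S"
      then have uV: "u \<in> V (Suc j)" by (simp add: perp_def)
      show "b u v = 0"
        unfolding expand_b[OF uV v]
      proof (rule sum.neutral, rule ballI)
        fix m assume m: "m \<in> {..<q'}"
        show "\<xi> (ix m) u * b (c (ix m)) v - \<xi> (ix m) (J u) * b (J (c (ix m))) v = 0"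
        proof (cases "m \<in> L")
          case True
          then show ?thesis using 0[OF True] Jmove[OF ixq v, of m] m by (simp add: \<xi>'_def)
        next
          case False
          then show ?thesis using u m unfolding I2(2) by (simp add: L_def)
        qed
      qed
    qed
    have "S = {v \<in> V (Suc (Suc j)). \<forall>k\<in>L. \<xi>' k v = 0 \<and> \<xi>' k (J v) = 0}"
      using fwd bwd flag_subset[OF S] by blast
    then show "\<exists>I\<subseteq>{..<q'}. S = {v \<in> V (Suc (Suc j)). \<forall>k\<in>I. \<xi>' k v = 0 \<and> \<xi>' k (J v) = 0}"
      by (intro exI[of _ L]) (auto simp: L_def)
  qed
  moreover have "b (c k) (c' m) = incidence I k m \<and> b (c k) (J (c' m)) = 0" if "k < q" "m < q'" for k m
    using c'(2)[OF that(2) c[OF that(1)]] Jc'[OF that(2) c[OF that(1)]] \<xi>c[OF ixq[OF that(2)] that(1)]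
    by (auto simp: incidence_def ix_def)
  ultimately show ?thesis using I(1) q'_def by blast
qed

text \<open>Each basis is built from its predecessor and the coordinate flag carried along with it,
  hence dependent choice. Beyond the end of the chain the bases are empty.\<close>

theorem normal_bases:
  "\<exists>p f \<eta> q c \<xi> I. real_basis p f \<eta> \<and> standard_start p (q (Suc 0)) f (c (Suc 0)) \<and>
    (\<forall>j. complex_basis (Suc j) (q (Suc j)) (c (Suc j)) (\<xi> (Suc j))) \<and>
    (\<forall>j. I (Suc j) \<subseteq> {..<q (Suc j)} \<and> card (I (Suc j)) = q (Suc (Suc j)) \<and>
      (\<forall>k<q (Suc j). \<forall>m<q (Suc (Suc j)).
        b (c (Suc j) k) (c (Suc (Suc j)) m) = incidence (I (Suc j)) k m \<and>
        b (c (Suc j) k) (J (c (Suc (Suc j)) m)) = 0))"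
proof -
  obtain p q f \<eta> c \<xi> where s: "real_basis p f \<eta>" "complex_basis (Suc 0) q c \<xi>"
    "coordinate_flags (Suc 0) q \<xi>" "standard_start p q f c"
    using start_exists by blast
  define P where "P j = (\<lambda>(q, c, \<xi>). complex_basis (Suc j) q c \<xi> \<and> coordinate_flags (Suc j) q \<xi> \<and>
    (j = 0 \<longrightarrow> standard_start p q f c))" for j
  define Q where "Q j = (\<lambda>(q, c, \<xi> :: nat \<Rightarrow> 'a \<Rightarrow> real) (q', c', \<xi>' :: nat \<Rightarrow> 'a \<Rightarrow> real). \<exists>I. I \<subseteq> {..<q} \<and> card I = q' \<and>
    (\<forall>k<q. \<forall>m<q'. b (c k) (c' m) = incidence I k m \<and> b (c k) (J (c' m)) = 0))"
    for j :: nat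
  have "\<exists>g. \<forall>n. P n (g n) \<and> Q n (g n) (g (Suc n))"
  proof (rule dependent_nat_choice)
    show "\<exists>x. P 0 x" using s by (auto simp: P_def)
    fix x n assume "P n x"
    then obtain q c \<xi>1 where x: "x = (q, c, \<xi>1)" "complex_basis (Suc n) q c \<xi>1"
      "coordinate_flags (Suc n) q \<xi>1" by (cases x) (auto simp: P_def)
    obtain I q' c' \<xi>' where "I \<subseteq> {..<q}" "card I = q'" "complex_basis (Suc (Suc n)) q' c' \<xi>'"
      "coordinate_flags (Suc (Suc n)) q' \<xi>'"
      "\<forall>k<q. \<forall>m<q'. b (c k) (c' m) = incidence I k m \<and> b (c k) (J (c' m)) = 0"
      using next_basis[OF x(2,3)] by blast
    then show "\<exists>y. P (Suc n) y \<and> Q n x y"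
      by (intro exI[of _ "(q', c', \<xi>')"]) (auto simp: P_def Q_def x(1))
  qed
  then obtain g where g: "\<And>n. P n (g n)" "\<And>n. Q n (g n) (g (Suc n))" by blast
  define q2 where "q2 j = fst (g (j - 1))" for j
  define c2 where "c2 j = fst (snd (g (j - 1)))" for j
  define \<xi>2 where "\<xi>2 j = snd (snd (g (j - 1)))" for j
  have "\<exists>I. I \<subseteq> {..<q2 (Suc j)} \<and> card I = q2 (Suc (Suc j)) \<and>
      (\<forall>k<q2 (Suc j). \<forall>m<q2 (Suc (Suc j)).
        b (c2 (Suc j) k) (c2 (Suc (Suc j)) m) = incidence I k m \<and>
        b (c2 (Suc j) k) (J (c2 (Suc (Suc j)) m)) = 0)" for j
    using g(2)[of j] unfolding Q_def q2_def c2_def by (simp add: case_prod_beta)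
  then obtain I where I: "\<And>j. I j \<subseteq> {..<q2 (Suc j)} \<and> card (I j) = q2 (Suc (Suc j)) \<and>
      (\<forall>k<q2 (Suc j). \<forall>m<q2 (Suc (Suc j)).
        b (c2 (Suc j) k) (c2 (Suc (Suc j)) m) = incidence (I j) k m \<and>
        b (c2 (Suc j) k) (J (c2 (Suc (Suc j)) m)) = 0)"
    by metis
  have "complex_basis (Suc j) (q2 (Suc j)) (c2 (Suc j)) (\<xi>2 (Suc j))" for j
    using g(1)[of j] by (simp add: P_def q2_def c2_def \<xi>2_def case_prod_beta)
  moreover have "standard_start p (q2 (Suc 0)) f (c2 (Suc 0))"
    using g(1)[of 0] by (simp add: P_def q2_def c2_def case_prod_beta)
  ultimately show ?thesis
    using s(1) I
    by (intro exI[of _ p] exI[of _ f] exI[of _ \<eta>] exI[of _ q2] exI[of _ c2] exI[of _ \<xi>2]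
        exI[of _ "\<lambda>j. I (j - 1)"]) simp
qed

end

subsection \<open>The circle group\<close>

text \<open>By connectedness the real part of \<open>\<psi>\<close> takes all values between the one
  at \<open>r0\<close> and 1. So for large \<open>N\<close> the image contains
  \<open>cis (\<theta> / Suc N)\<close>, whose power with exponent \<open>Suc N\<close> is
  \<open>z\<close>.\<close>

lemma continuous_character_onto_circle:
  fixes \<psi> :: "real \<Rightarrow> complex"
  assumes cont: "continuous_on UNIV \<psi>" and hom: "\<And>r s. \<psi> (r + s) = \<psi> r * \<psi> s"
    and norm1: "\<And>r. norm (\<psi> r) = 1" and r0: "\<psi> r0 \<noteq> 1" and z: "norm z = 1"
  shows "\<exists>r. \<psi> r = z"
proof -
  have "\<psi> 0 * \<psi> 0 = \<psi> 0" using hom[of 0 0] by simp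
  then have \<psi>0: "\<psi> 0 = 1" using norm1[of 0] by auto
  have pow: "\<psi> (real N * r) = \<psi> r ^ N" for N r
    by (induction N) (simp_all add: \<psi>0 hom algebra_simps)
  have sq: "Re (\<psi> r) ^ 2 + Im (\<psi> r) ^ 2 = 1" for r using norm1[of r] by (simp add: cmod_def)
  have c: "Re (\<psi> r0) < 1"
  proof (rule ccontr)
    assume "\<not> Re (\<psi> r0) < 1"
    then have "1 \<le> Re (\<psi> r0) ^ 2" by (simp add: one_le_power not_less)
    moreover have "Re (\<psi> r0) \<le> 1" using complex_Re_le_cmod[of "\<psi> r0"] norm1 by simp
    ultimately have "Re (\<psi> r0) = 1" "Im (\<psi> r0) = 0"
      using sq[of r0] \<open>\<not> Re (\<psi> r0) < 1\<close> by auto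
    then show False using r0 by (simp add: complex_eq_iff)
  qed
  define \<theta> where "\<theta> = Arg z"
  have z\<theta>: "z = cis \<theta>" using z cis_Arg[of z] by (cases "z = 0") (simp_all add: \<theta>_def sgn_div_norm)
  have "(\<lambda>N. cos (\<theta> / real (Suc N))) \<longlonglongrightarrow> cos 0"
    by (intro tendsto_cos LIMSEQ_Suc[OF tendsto_divide_0[OF tendsto_const]])
       (auto intro: filterlim_at_top_imp_at_infinity filterlim_real_sequentially)
  then have "eventually (\<lambda>N. Re (\<psi> r0) < cos (\<theta> / real (Suc N))) sequentially"
    using c by (intro order_tendstoD) auto
  then obtain N where N: "Re (\<psi> r0) < cos (\<theta> / real (Suc N))"
    by (meson eventually_happens' sequentially_bot)
  have "connected (range (\<lambda>r. Re (\<psi> r)))"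
    by (intro connected_continuous_image continuous_intros cont connected_UNIV)
  then have "cos (\<theta> / real (Suc N)) \<in> range (\<lambda>r. Re (\<psi> r))"
    by (rule connectedD_interval[OF _ rangeI[of _ r0] rangeI[of _ 0]]) (use N \<psi>0 in auto)
  then obtain r where r: "Re (\<psi> r) = cos (\<theta> / real (Suc N))" by auto
  have "Im (\<psi> r) ^ 2 = sin (\<theta> / real (Suc N)) ^ 2"
    using sq[of r] unfolding r sin_squared_eq by simp
  \<comment> \<open>The real part determines \<open>\<psi> r\<close> up to conjugation, which
    corresponds to replacing \<open>r\<close> by \<open>- r\<close>.\<close>
  then consider "Im (\<psi> r) = sin (\<theta> / real (Suc N))" | "Im (\<psi> r) = - sin (\<theta> / real (Suc N))"
    by (auto simp: power2_eq_iff)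
  then have "\<exists>r'. \<psi> r' = cis (\<theta> / real (Suc N))"
  proof cases
    case 1
    then have "\<psi> r = cis (\<theta> / real (Suc N))" using r by (simp add: complex_eq_iff)
    then show ?thesis by blast
  next
    case 2
    then have "\<psi> r = cis (- (\<theta> / real (Suc N)))" using r by (simp add: complex_eq_iff)
    moreover have "\<psi> (- r) * \<psi> r = 1" using hom[of "- r" r] \<psi>0 by simp
    ultimately have "\<psi> (- r) = inverse (cis (- (\<theta> / real (Suc N))))"
      by (metis inverse_unique mult.commute)
    then show ?thesis by (metis cis_inverse minus_minus)
  qed
  then obtain r' where "\<psi> r' = cis (\<theta> / real (Suc N))" by blast
  then have "\<psi> (real (Suc N) * r') = cis (real (Suc N) * (\<theta> / real (Suc N)))"
    unfolding pow by (simp only: Complex.DeMoivre)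
  moreover have "real (Suc N) * (\<theta> / real (Suc N)) = \<theta>" by simp
  ultimately have "\<psi> (real (Suc N) * r') = z" using z\<theta> by simp
  then show ?thesis ..
qed

definition rotation_of :: "complex \<Rightarrow> real^2^2" where
  "rotation_of z = (\<chi> i j. if i = 1 then (if j = 1 then Re z else - Im z) else (if j = 1 then Im z else Re z))"

lemma rotation_of_simps [simp]:
  "rotation_of z $ 1 $ 1 = Re z" "rotation_of z $ 1 $ 2 = - Im z"
  "rotation_of z $ 2 $ 1 = Im z" "rotation_of z $ 2 $ 2 = Re z"
  by (simp_all add: rotation_of_def)

lemma rotation_of_mult: "rotation_of (z * w) = rotation_of z ** rotation_of w"
  by (simp add: Finite_Cartesian_Product.vec_eq_iff forall_2 matrix_matrix_mult_def sum_2)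

lemma continuous_rotation_of: "continuous_on S rotation_of"
proof -
  have "continuous_on S (\<lambda>z. if i = 1 then (if j = 1 then Re z else - Im z) else (if j = 1 then Im z else Re z))"
    for i j :: 2
    by (cases "i = 1"; cases "j = 1") (auto intro!: continuous_intros)
  then show ?thesis unfolding rotation_of_def by (intro continuous_on_vec_lambda)
qed

lemma bij_rotation_of: "bij_betw rotation_of (sphere 0 1) SO2"
proof (rule bij_betw_imageI)
  show "inj_on rotation_of (sphere 0 1)"
    by (rule inj_onI) (metis complex_eqI rotation_of_simps(1,3))
  show "rotation_of ` sphere 0 1 = SO2"
  proof (intro equalityI subsetI)
    fix A assume "A \<in> rotation_of ` sphere 0 1"
    then obtain z where z: "A = rotation_of z" "norm z = 1" by auto
    have "Re z * Re z + Im z * Im z = 1" using z(2) by (simp add: cmod_def power2_eq_square)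
    then show "A \<in> SO2"
      unfolding SO2_def rotation_matrix_def z(1) orthogonal_matrix
      by (simp add: Finite_Cartesian_Product.vec_eq_iff forall_2 matrix_matrix_mult_def sum_2
          Finite_Cartesian_Product.transpose_def Finite_Cartesian_Product.mat_def det_2 algebra_simps)
  next
    fix A :: "real^2^2" assume "A \<in> SO2"
    then have o: "Finite_Cartesian_Product.transpose A ** A = Finite_Cartesian_Product.mat 1"
      and d: "Determinants.det A = 1"
      by (auto simp: SO2_def rotation_matrix_def orthogonal_matrix)
    have 1: "(A $ 1 $ 1)\<^sup>2 + (A $ 2 $ 1)\<^sup>2 = 1" "(A $ 1 $ 2)\<^sup>2 + (A $ 2 $ 2)\<^sup>2 = 1"
      using o by (simp_all add: Finite_Cartesian_Product.vec_eq_iff forall_2 matrix_matrix_mult_def sum_2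
          Finite_Cartesian_Product.transpose_def Finite_Cartesian_Product.mat_def power2_eq_square)
    \<comment> \<open>The left side is the sum of the squared entries minus twice the determinant,
      that is, \<open>2 - 2\<close>.\<close>
    have "(A $ 1 $ 1 - A $ 2 $ 2)\<^sup>2 + (A $ 1 $ 2 + A $ 2 $ 1)\<^sup>2 = 0"
      using 1 d by (simp add: det_2 power2_eq_square algebra_simps)
    then have "A $ 2 $ 2 = A $ 1 $ 1" "A $ 1 $ 2 = - A $ 2 $ 1"
      by (simp_all add: sum_power2_eq_zero_iff)
    then have "A = rotation_of (Complex (A $ 1 $ 1) (A $ 2 $ 1))"
      by (simp add: Finite_Cartesian_Product.vec_eq_iff forall_2)
    moreover have "Complex (A $ 1 $ 1) (A $ 2 $ 1) \<in> sphere 0 1"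
      using 1 by (simp add: cmod_def)
    ultimately show "A \<in> rotation_of ` sphere 0 1" by blast
  qed
qed

text \<open>Followed by the inverse of an isomorphism from the circle to \<open>T\<close>,
  \<open>\<gamma>\<close> becomes a nontrivial character of the real line and hence is onto. The
  point is continuity of the composite, which comes from compactness of the circle.\<close>

lemma one_parameter_group_onto:
  fixes \<gamma> :: "real \<Rightarrow> 'a::euclidean_space \<Rightarrow> 'a"
  assumes T: "SO2_automorphism_group br T" and \<gamma>T: "\<And>r. \<gamma> r \<in> T"
    and hom: "\<And>r s u. \<gamma> (r + s) u = \<gamma> r (\<gamma> s u)"
    and cont: "\<And>u. continuous_on UNIV (\<lambda>r. \<gamma> r u)"
    and nontrivial: "\<gamma> r0 \<noteq> \<gamma> 0"
  shows "T = range \<gamma>"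
proof -
  let ?S = "sphere (0::complex) 1"
  have linT: "linear f" if "f \<in> T" for f
    using T that by (auto simp: SO2_automorphism_group_def lie_automorphism_def)
  obtain \<rho> where \<rho>: "bij_betw \<rho> SO2 T" "\<And>A B. A \<in> SO2 \<Longrightarrow> B \<in> SO2 \<Longrightarrow> \<rho> (A ** B) = \<rho> A \<circ> \<rho> B"
    "\<And>u. continuous_on SO2 (\<lambda>A. \<rho> A u)"
    using T unfolding SO2_automorphism_group_def by blast
  define \<tau> where "\<tau> z = \<rho> (rotation_of z)" for z
  have SO: "rotation_of ` ?S = SO2" using bij_rotation_of by (simp add: bij_betw_def)
  have \<tau>: "bij_betw \<tau> ?S T"
    using bij_betw_trans[OF bij_rotation_of \<rho>(1)] by (simp add: \<tau>_def[abs_def] comp_def)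
  have \<tau>T: "\<tau> z \<in> T" if "z \<in> ?S" for z using \<tau> that by (auto simp: bij_betw_def)
  have \<tau>mult: "\<tau> (z * w) = \<tau> z \<circ> \<tau> w" if "z \<in> ?S" "w \<in> ?S" for z w
    using that SO \<rho>(2) unfolding \<tau>_def rotation_of_mult by blast
  have \<tau>cont: "continuous_on ?S (\<lambda>z. \<tau> z u)" for u
    using continuous_on_compose[OF continuous_rotation_of, of ?S "\<lambda>A. \<rho> A u"] \<rho>(3)
    by (simp add: SO \<tau>_def comp_def)
  \<comment> \<open>Elements of \<open>T\<close> as bounded operators: in finite dimension pointwise
    continuity is continuity in the operator norm, so both parametrisations are continuous into one
    Hausdorff space.\<close>
  define B where "B f = Blinfun f" for f :: "'a \<Rightarrow> 'a"
  have B: "blinfun_apply (B f) = f" if "f \<in> T" for f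
    using linT[OF that] by (simp add: B_def bounded_linear_Blinfun_apply linear_conv_bounded_linear)
  have cB\<tau>: "continuous_on ?S (\<lambda>z. B (\<tau> z))"
  proof (rule continuous_on_blinfun_componentwise)
    show "continuous_on ?S (\<lambda>z. blinfun_apply (B (\<tau> z)) i)" for i
      using \<tau>cont[of i] by (rule continuous_on_eq) (use B \<tau>T in auto)
  qed
  have cB\<gamma>: "continuous_on UNIV (\<lambda>r. B (\<gamma> r))"
    by (rule continuous_on_blinfun_componentwise) (use cont B \<gamma>T in auto)
  define g where "g = inv_into ?S \<tau>"
  have g: "g f \<in> ?S" "\<tau> (g f) = f" if "f \<in> T" for f
    using \<tau> that unfolding g_def bij_betw_def by (metis inv_into_into f_inv_into_f)+
  have gi: "g (\<tau> z) = z" if "z \<in> ?S" for z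
    using \<tau> that unfolding g_def bij_betw_def by (simp add: inv_into_f_f)
  have "continuous_on ((\<lambda>z. B (\<tau> z)) ` ?S) (\<lambda>F. g (blinfun_apply F))"
    by (rule continuous_on_inv[OF cB\<tau>]) (use gi B \<tau>T in auto)
  moreover have "range (\<lambda>r. B (\<gamma> r)) \<subseteq> (\<lambda>z. B (\<tau> z)) ` ?S"
    using g \<gamma>T by (metis (no_types, lifting) image_subset_iff rev_image_eqI)
  ultimately have "continuous_on (range (\<lambda>r. B (\<gamma> r))) (\<lambda>F. g (blinfun_apply F))"
    by (rule continuous_on_subset)
  from continuous_on_compose[OF cB\<gamma> this]
  have c\<psi>: "continuous_on UNIV (\<lambda>r. g (\<gamma> r))" using B[OF \<gamma>T] by (simp add: comp_def)
  have h\<psi>: "g (\<gamma> (r + s)) = g (\<gamma> r) * g (\<gamma> s)" for r s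
  proof -
    have "g (\<gamma> r) * g (\<gamma> s) \<in> ?S" using g(1)[OF \<gamma>T] by (auto simp: norm_mult)
    moreover have "\<gamma> (r + s) = \<tau> (g (\<gamma> r) * g (\<gamma> s))"
      using \<tau>mult[OF g(1)[OF \<gamma>T] g(1)[OF \<gamma>T]] g(2)[OF \<gamma>T] hom by (auto simp: fun_eq_iff)
    ultimately show ?thesis using gi by simp
  qed
  have "\<gamma> r0 \<in> T" "\<gamma> 0 \<in> T" using \<gamma>T by auto
  then have "g (\<gamma> r0) \<noteq> g (\<gamma> 0)" using nontrivial g(2) by metis
  moreover have "g (\<gamma> 0) = 1"
  proof -
    have "g (\<gamma> 0) * g (\<gamma> 0) = g (\<gamma> 0)" using h\<psi>[of 0 0] by simp
    then show ?thesis using g(1)[OF \<gamma>T, of 0] by auto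
  qed
  ultimately have ne: "g (\<gamma> r0) \<noteq> 1" by simp
  have "f \<in> range \<gamma>" if f: "f \<in> T" for f
  proof -
    have "\<exists>r. g (\<gamma> r) = g f"
      by (rule continuous_character_onto_circle[OF c\<psi> h\<psi> _ ne]) (use g(1) \<gamma>T f in auto)
    then show ?thesis using g(2)[OF f] g(2)[OF \<gamma>T] by (metis rangeI)
  qed
  then show ?thesis using \<gamma>T by blast
qed

section \<open>Exponentials of maps that act by plane rotations\<close>

locale rotation_generator =
  fixes D :: "'a::euclidean_space \<Rightarrow> 'a" and Bs :: "'a set"
  assumes D: "linear D" and span: "span Bs = UNIV"
    and rot: "e \<in> Bs \<Longrightarrow> \<exists>w \<omega>. D e = - (\<omega> *\<^sub>R w) \<and> D w = \<omega> *\<^sub>R e"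
begin

definition flow :: "real \<Rightarrow> 'a \<Rightarrow> 'a" where "flow r = exp_map (\<lambda>u. r *\<^sub>R D u)"

text \<open>The plane of \<open>e\<close> and \<open>w\<close> as an image of the complex numbers,
  where \<open>D\<close> becomes multiplication by \<open>\<i> \<omega>\<close>. The two vectors may
  be dependent, which covers the kernel of \<open>D\<close>.\<close>

definition orbit :: "'a \<Rightarrow> 'a \<Rightarrow> complex \<Rightarrow> 'a" where
  "orbit e w z = Re z *\<^sub>R e - Im z *\<^sub>R w"

abbreviation iter :: "real \<Rightarrow> nat \<Rightarrow> 'a \<Rightarrow> 'a" where
  "iter r k \<equiv> (\<lambda>u. r *\<^sub>R D u) ^^ k"

lemma linear_iter: "linear (iter r k)"
proof (induction k)
  case 0
  then show ?case by (simp add: linear_iff)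
next
  case (Suc k)
  then show ?case by (simp add: linear_iff linear_add[OF D] linear_cmul[OF D] scaleR_add_right)
qed

lemma orbit_sums:
  assumes "D e = - (\<omega> *\<^sub>R w)" "D w = \<omega> *\<^sub>R e"
  shows "(\<lambda>k. iter r k (orbit e w z) /\<^sub>R fact k) sums orbit e w (exp (\<i> * of_real (r * \<omega>)) * z)"
proof -
  have h: "bounded_linear (orbit e w)"
    unfolding orbit_def[abs_def] by (intro bounded_linear_intros bounded_linear_Re bounded_linear_Im)
  have step: "r *\<^sub>R D (orbit e w y) = orbit e w (\<i> * of_real (r * \<omega>) * y)" for y
    using assms by (simp add: orbit_def linear_diff[OF D] linear_cmul[OF D] algebra_simps)
  have it: "iter r k (orbit e w z) = orbit e w ((\<i> * of_real (r * \<omega>)) ^ k * z)" for k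
    by (induction k) (simp_all only: funpow.simps comp_def id_def step power.simps mult.assoc mult_1)
  have "(\<lambda>k. (\<i> * of_real (r * \<omega>)) ^ k /\<^sub>R fact k * z) sums (exp (\<i> * of_real (r * \<omega>)) * z)"
    by (intro sums_mult2 exp_converges)
  from bounded_linear.sums[OF h this] show ?thesis
    by (simp add: it linear_cmul[OF bounded_linear.linear[OF h]] mult_scaleR_left)
qed

lemma flow_sums: "(\<lambda>k. iter r k u /\<^sub>R fact k) sums flow r u"
proof -
  define Z where "Z = {u. summable (\<lambda>k. iter r k u /\<^sub>R fact k)}"
  have "subspace Z" unfolding subspace_def
  proof (intro conjI ballI allI)
    show "0 \<in> Z" by (simp add: Z_def linear_0[OF linear_iter])
    show "x + y \<in> Z" if "x \<in> Z" "y \<in> Z" for x y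
      using that unfolding Z_def by (simp add: linear_add[OF linear_iter] scaleR_add_right summable_add)
    show "c *\<^sub>R x \<in> Z" if "x \<in> Z" for c x
      using summable_scaleR_right[of "\<lambda>k. iter r k x /\<^sub>R fact k" c] that unfolding Z_def
      by (simp add: linear_cmul[OF linear_iter] mult.commute)
  qed
  moreover have "Bs \<subseteq> Z"
  proof
    fix e assume "e \<in> Bs"
    then obtain w \<omega> where "D e = - (\<omega> *\<^sub>R w)" "D w = \<omega> *\<^sub>R e" using rot by blast
    from orbit_sums[OF this, of r 1] show "e \<in> Z" by (auto simp: Z_def orbit_def sums_iff)
  qed
  ultimately have "u \<in> Z" using span span_minimal by blast
  then show ?thesis by (simp add: Z_def flow_def exp_map_def summable_sums)
qed

lemma linear_flow: "linear (flow r)"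
proof (rule linearI)
  show "flow r (x + y) = flow r x + flow r y" for x y
    using sums_add[OF flow_sums[of r x] flow_sums[of r y]] flow_sums[of r "x + y"]
    by (intro sums_unique2[of "\<lambda>k. iter r k (x + y) /\<^sub>R fact k"])
      (simp_all add: linear_add[OF linear_iter] scaleR_add_right)
  show "flow r (c *\<^sub>R x) = c *\<^sub>R flow r x" for c x
    using sums_scaleR_right[OF flow_sums[of r x], of c] flow_sums[of r "c *\<^sub>R x"]
    by (intro sums_unique2[of "\<lambda>k. iter r k (c *\<^sub>R x) /\<^sub>R fact k"])
      (simp_all add: linear_cmul[OF linear_iter] mult.commute)
qed

lemma flow_orbit:
  assumes "D e = - (\<omega> *\<^sub>R w)" "D w = \<omega> *\<^sub>R e"
  shows "flow r (orbit e w z) = orbit e w (exp (\<i> * of_real (r * \<omega>)) * z)"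
  using orbit_sums[OF assms] flow_sums sums_unique2 by blast

lemma orbit_1: "orbit e w 1 = e" by (simp add: orbit_def)

lemma flow_add: "flow (r + s) u = flow r (flow s u)"
proof (rule linear_eq_on_span[of "flow (r + s)" "\<lambda>u. flow r (flow s u)" Bs])
  show "linear (flow (r + s))" "linear (\<lambda>u. flow r (flow s u))"
    using linear_flow linear_compose[OF linear_flow linear_flow] by (auto simp: comp_def)
  fix e assume "e \<in> Bs"
  then obtain w \<omega> where w: "D e = - (\<omega> *\<^sub>R w)" "D w = \<omega> *\<^sub>R e" using rot by blast
  show "flow (r + s) e = flow r (flow s e)"
    using flow_orbit[OF w, of "r + s" 1] flow_orbit[OF w, of s 1] flow_orbit[OF w, of r]
    by (simp add: orbit_1 exp_add[symmetric] algebra_simps)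
qed (simp add: span)

lemma continuous_flow: "continuous_on UNIV (\<lambda>r. flow r u)"
proof -
  define Z where "Z = {u. continuous_on UNIV (\<lambda>r. flow r u)}"
  have "subspace Z" unfolding subspace_def Z_def
    by (auto simp: linear_add[OF linear_flow] linear_cmul[OF linear_flow] linear_0[OF linear_flow]
        intro!: continuous_intros)
  moreover have "Bs \<subseteq> Z"
  proof
    fix e assume "e \<in> Bs"
    then obtain w \<omega> where w: "D e = - (\<omega> *\<^sub>R w)" "D w = \<omega> *\<^sub>R e" using rot by blast
    have "flow r e = orbit e w (exp (\<i> * of_real (r * \<omega>)))" for r
      using flow_orbit[OF w, of r 1] by (simp add: orbit_1)
    then show "e \<in> Z" by (simp add: Z_def orbit_def) (intro continuous_intros)
  qed
  ultimately show ?thesis using span span_minimal unfolding Z_def by blast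
qed

lemma flow_invariant:
  assumes S: "subspace S" and DS: "\<And>u. u \<in> S \<Longrightarrow> D u \<in> S" and u: "u \<in> S"
  shows "flow r u \<in> S"
proof -
  have "iter r k u \<in> S" for k by (induction k) (use u DS S in \<open>auto intro: subspace_mul\<close>)
  then have S': "(\<Sum>k<n. iter r k u /\<^sub>R fact k) \<in> S" for n
    by (intro subspace_sum[OF S] subspace_mul[OF S])
  show ?thesis
    using flow_sums[of r u] unfolding sums_def by (rule closed_sequentially[OF closed_subspace[OF S] S'])
qed

end

subsection \<open>Block matrices\<close>

definition acts_by :: "('a::euclidean_space \<Rightarrow> 'a) \<Rightarrow> 'a list \<Rightarrow> real mat \<Rightarrow> bool" where
  "acts_by D bs M \<longleftrightarrow> M \<in> carrier_mat (length bs) (length bs) \<and>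
     (\<forall>j<length bs. D (bs ! j) = (\<Sum>i<length bs. M $$ (i, j) *\<^sub>R bs ! i))"

lemma has_matrix_iff: "has_matrix bs D M \<longleftrightarrow> linear D \<and> acts_by D bs M"
  by (auto simp: has_matrix_def acts_by_def)

lemma sum_lessThan_add:
  fixes f :: "nat \<Rightarrow> 'b::comm_monoid_add"
  shows "(\<Sum>i<m + n. f i) = (\<Sum>i<m. f i) + (\<Sum>i<n. f (m + i))"
  by (induction n) (simp_all add: add.assoc)

lemma acts_by_append:
  assumes "acts_by D bs M" "acts_by D cs N"
  shows "acts_by D (bs @ cs) (four_block_mat M (0\<^sub>m (length bs) (length cs)) (0\<^sub>m (length cs) (length bs)) N)"
proof -
  let ?F = "four_block_mat M (0\<^sub>m (length bs) (length cs)) (0\<^sub>m (length cs) (length bs)) N"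
  have M: "M \<in> carrier_mat (length bs) (length bs)" and N: "N \<in> carrier_mat (length cs) (length cs)"
    and Mc: "\<And>j. j < length bs \<Longrightarrow> D (bs ! j) = (\<Sum>i<length bs. M $$ (i, j) *\<^sub>R bs ! i)"
    and Nc: "\<And>j. j < length cs \<Longrightarrow> D (cs ! j) = (\<Sum>i<length cs. N $$ (i, j) *\<^sub>R cs ! i)"
    using assms by (auto simp: acts_by_def)
  have "D ((bs @ cs) ! j) = (\<Sum>i<length (bs @ cs). ?F $$ (i, j) *\<^sub>R (bs @ cs) ! i)"
    if j: "j < length (bs @ cs)" for j
  proof (cases "j < length bs")
    case True
    have "(\<Sum>i<length bs. ?F $$ (i, j) *\<^sub>R (bs @ cs) ! i) = (\<Sum>i<length bs. M $$ (i, j) *\<^sub>R bs ! i)"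
      using M N True by (intro sum.cong) (auto simp: nth_append)
    moreover have "(\<Sum>i<length cs. ?F $$ (length bs + i, j) *\<^sub>R (bs @ cs) ! (length bs + i)) = 0"
      using M N True by (intro sum.neutral) auto
    ultimately show ?thesis using True Mc[OF True] by (simp add: sum_lessThan_add nth_append)
  next
    case False
    then have j': "j - length bs < length cs" using j by simp
    have "(\<Sum>i<length bs. ?F $$ (i, j) *\<^sub>R (bs @ cs) ! i) = 0"
      using M N False j by (intro sum.neutral) auto
    moreover have "(\<Sum>i<length cs. ?F $$ (length bs + i, j) *\<^sub>R (bs @ cs) ! (length bs + i)) =
        (\<Sum>i<length cs. N $$ (i, j - length bs) *\<^sub>R cs ! i)"
      using M N False j by (intro sum.cong) auto
    ultimately show ?thesis using False Nc[OF j'] by (simp add: sum_lessThan_add nth_append)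
  qed
  then show ?thesis using M N by (auto simp: acts_by_def)
qed

lemma acts_by_diag_block:
  "list_all2 (acts_by D) bss Ms \<Longrightarrow> acts_by D (concat bss) (diag_block_mat Ms)"
proof (induction rule: list_all2_induct)
  case Nil
  then show ?case by (simp add: acts_by_def)
next
  case (Cons bs bss M Ms)
  have "M \<in> carrier_mat (length bs) (length bs)"
    "diag_block_mat Ms \<in> carrier_mat (length (concat bss)) (length (concat bss))"
    using Cons by (auto simp: acts_by_def)
  then show ?case using acts_by_append[OF Cons(1) Cons(3)] by (simp add: Let_def)
qed

lemma acts_by_smult: "acts_by D bs M \<Longrightarrow> acts_by (\<lambda>u. t *\<^sub>R D u) bs (t \<cdot>\<^sub>m M)"
  by (auto simp: acts_by_def scaleR_sum_right intro!: sum.cong)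

lemma J_mat_simps [simp]:
  "J_mat \<in> carrier_mat 2 2" "dim_row J_mat = 2" "dim_col J_mat = 2"
  "J_mat $$ (0, 0) = 0" "J_mat $$ (0, Suc 0) = 1" "J_mat $$ (Suc 0, 0) = -1" "J_mat $$ (Suc 0, Suc 0) = 0"
  by (auto simp: J_mat_def mat_of_rows_list_def)

lemma acts_by_J:
  assumes "D e = - (\<omega> *\<^sub>R w)" "D w = \<omega> *\<^sub>R e"
  shows "acts_by D [e, w] (\<omega> \<cdot>\<^sub>m J_mat)"
  using assms by (auto simp: acts_by_def less_Suc_eq numeral_2_eq_2)

lemma acts_by_zero:
  assumes "\<And>e. e \<in> set bs \<Longrightarrow> D e = 0"
  shows "acts_by D bs (0\<^sub>m (length bs) (length bs))"
  using assms by (auto simp: acts_by_def)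

lemma acts_by_unique:
  assumes "linear D" "linear D'" "acts_by D bs M" "acts_by D' bs M" "span (set bs) = UNIV"
  shows "D = D'"
proof
  fix u
  show "D u = D' u"
    by (rule linear_eq_on_span[OF assms(1,2), of "set bs"])
       (use assms(3-5) in \<open>auto simp: acts_by_def in_set_conv_nth\<close>)
qed

text \<open>The real basis underlying a complex one, in the order expected by
  \<open>real_form\<close> and by the diagonal blocks \<open>J\<close>.\<close>

definition pairs :: "('a \<Rightarrow> 'a) \<Rightarrow> nat \<Rightarrow> (nat \<Rightarrow> 'a) \<Rightarrow> 'a list" where
  "pairs J q c = concat (map (\<lambda>k. [c k, J (c k)]) [0..<q])"

lemma pairs_Suc: "pairs J (Suc q) c = pairs J q c @ [c q, J (c q)]"
  by (simp add: pairs_def)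

lemma length_pairs [simp]: "length (pairs J q c) = 2 * q"
  by (induction q) (simp add: pairs_def, simp add: pairs_Suc)

lemma nth_pairs:
  "i < 2 * q \<Longrightarrow> pairs J q c ! i = (if even i then c (i div 2) else J (c (i div 2)))"
proof (induction q)
  case (Suc q)
  have "i < 2 * q \<or> i = 2 * q \<or> i = Suc (2 * q)" using Suc.prems by auto
  then consider "i < 2 * q" | "i = 2 * q" | "i = Suc (2 * q)" by blast
  then show ?case by cases (use Suc.IH in \<open>simp_all add: pairs_Suc nth_append\<close>)
qed simp

lemma set_pairs: "set (pairs J q c) = (\<Union>k<q. {c k, J (c k)})"
  by (auto simp: pairs_def)

lemma acts_by_copies:
  assumes "\<And>k. k < q \<Longrightarrow> D (c k) = - (\<omega> *\<^sub>R J (c k)) \<and> D (J (c k)) = \<omega> *\<^sub>R c k"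
  shows "acts_by D (pairs J q c) (copies q (\<omega> \<cdot>\<^sub>m J_mat))"
proof -
  have "list_all2 (acts_by D) (map (\<lambda>k. [c k, J (c k)]) [0..<q]) (replicate q (\<omega> \<cdot>\<^sub>m J_mat))"
    using assms by (auto simp: list_all2_conv_all_nth intro!: acts_by_J)
  from acts_by_diag_block[OF this] show ?thesis by (simp add: pairs_def copies_def)
qed

lemma copies_entries:
  assumes A: "A \<in> carrier_mat 2 2"
  shows "copies q A = mat (2 * q) (2 * q)
    (\<lambda>(r, s). if r div 2 = s div 2 then A $$ (r mod 2, s mod 2) else 0)"
proof (induction q)
  case 0
  then show ?case by (auto simp: copies_def)
next
  case (Suc q)
  have *: "copies (Suc q) A = four_block_mat A (0\<^sub>m 2 (2 * q)) (0\<^sub>m (2 * q) 2) (copies q A)"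
    using A Suc by (simp add: copies_def Let_def)
  have dims: "dim_row A = 2" "dim_col A = 2" using A by auto
  let ?B = "mat (2 * Suc q) (2 * Suc q)
    (\<lambda>(r, s). if r div 2 = s div 2 then A $$ (r mod 2, s mod 2) else 0)"
  show ?case
  proof (rule eq_matI)
    fix r s assume rs: "r < dim_row ?B"
      "s < dim_col ?B"
    consider "r < 2" "s < 2" | "r < 2" "\<not> s < 2" | "\<not> r < 2" "s < 2" | "\<not> r < 2" "\<not> s < 2" by blast
    then show "copies (Suc q) A $$ (r, s) = ?B $$ (r, s)"
    proof cases
      case 4
      then obtain r' s' where "r = r' + 2" "s = s' + 2" by (metis add.commute le_Suc_ex not_less)
      then show ?thesis using rs unfolding * Suc.IH by (auto simp: dims)
    qed (use rs in \<open>auto simp: * Suc.IH dims div_eq_0_iff\<close>)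
  qed (auto simp: * Suc.IH dims)
qed

text \<open>The blocks of the normal form are recognised as values of one form on lists of vectors,
  so that concatenation of lists replaces block arithmetic.\<close>

definition gram :: "('a \<Rightarrow> 'a \<Rightarrow> real) \<Rightarrow> 'a list \<Rightarrow> 'a list \<Rightarrow> real mat" where
  "gram f xs ys = mat (length xs) (length ys) (\<lambda>(i, j). f (xs ! i) (ys ! j))"

lemma gram_dim [simp]:
  "gram f xs ys \<in> carrier_mat (length xs) (length ys)"
  "dim_row (gram f xs ys) = length xs" "dim_col (gram f xs ys) = length ys"
  by (auto simp: gram_def)

lemma gram_index [simp]:
  "i < length xs \<Longrightarrow> j < length ys \<Longrightarrow> gram f xs ys $$ (i, j) = f (xs ! i) (ys ! j)"
  by (simp add: gram_def)

lemma gram_append_cols: "gram f xs (ys @ zs) = gram f xs ys @\<^sub>c gram f xs zs"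
  by (rule eq_matI) (auto simp: append_cols_def nth_append)

lemma gram_append_rows: "gram f (xs @ ws) ys = gram f xs ys @\<^sub>r gram f ws ys"
  by (rule eq_matI) (auto simp: append_rows_def nth_append)

lemma append_cols_empty: "A @\<^sub>c 0\<^sub>m 0 0 = A"
  by (rule eq_matI) (auto simp: append_cols_def)

lemma append_rows_empty: "A @\<^sub>r 0\<^sub>m 0 0 = A"
  by (rule eq_matI) (auto simp: append_rows_def)

lemma gram_concat_cols:
  "yss \<noteq> [] \<Longrightarrow> foldr (@\<^sub>c) (map (gram f xs) yss) (0\<^sub>m 0 0) = gram f xs (concat yss)"
proof (induction yss)
  case (Cons ys yss)
  then show ?case by (cases "yss = []") (simp_all add: append_cols_empty gram_append_cols)
qed simp

lemma gram_concat_rows: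
  "xss \<noteq> [] \<Longrightarrow> foldr (@\<^sub>r) (map (\<lambda>xs. gram f xs ys) xss) (0\<^sub>m 0 0) = gram f (concat xss) ys"
proof (induction xss)
  case (Cons xs xss)
  then show ?case by (cases "xss = []") (simp_all add: append_rows_empty gram_append_rows)
qed simp

text \<open>Both lists have to be nonempty: an empty fold is \<open>0\<^sub>m 0 0\<close>, which
  forgets the other dimension.\<close>

lemma block_mat_gram:
  assumes "xss \<noteq> []" "yss \<noteq> []"
  shows "block_mat (map (\<lambda>xs. map (gram f xs) yss) xss) = gram f (concat xss) (concat yss)"
proof -
  have "block_mat (map (\<lambda>xs. map (gram f xs) yss) xss) =
    foldr (@\<^sub>r) (map (\<lambda>xs. gram f xs (concat yss)) xss) (0\<^sub>m 0 0)"
    using gram_concat_cols[OF assms(2)] by (simp add: block_mat_def comp_def)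
  then show ?thesis using gram_concat_rows[OF assms(1)] by simp
qed

text \<open>Serves both coordinates of the bracket; skewness supplies the blocks below the
  diagonal.\<close>

lemma chain_mat_gram:
  assumes "\<And>i. i < l + 2 \<Longrightarrow> length (bl i) = d i"
    and "\<And>i. i \<le> l \<Longrightarrow> W i = gram f (bl i) (bl (i + 1))"
    and "\<And>i j u v. i < l + 2 \<Longrightarrow> j < l + 2 \<Longrightarrow> u \<in> set (bl i) \<Longrightarrow> v \<in> set (bl j) \<Longrightarrow> f u v = - f v u"
    and "\<And>i j u v. i < l + 2 \<Longrightarrow> j < l + 2 \<Longrightarrow> u \<in> set (bl i) \<Longrightarrow> v \<in> set (bl j) \<Longrightarrow>
      j \<noteq> i + 1 \<Longrightarrow> i \<noteq> j + 1 \<Longrightarrow> f u v = 0"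
  shows "chain_mat l d W = gram f (concat (map bl [0..<l + 2])) (concat (map bl [0..<l + 2]))"
proof -
  have E: "(if j = i + 1 then W i else if i = j + 1 then - transpose_mat (W j) else 0\<^sub>m (d i) (d j)) =
    gram f (bl i) (bl j)" if "i < l + 2" "j < l + 2" for i j
    using that assms(1)[OF that(1)] assms(1)[OF that(2)] assms(2)[of i] assms(2)[of j]
      assms(3)[OF that] assms(4)[OF that]
    by (auto intro!: eq_matI)
  have "chain_mat l d W = block_mat (map (\<lambda>xs. map (gram f xs) (map bl [0..<l + 2])) (map bl [0..<l + 2]))"
    unfolding chain_mat_def map_map comp_def
    by (intro arg_cong[of _ _ block_mat] map_cong refl) (rule E; auto)
  also have "\<dots> = gram f (concat (map bl [0..<l + 2])) (concat (map bl [0..<l + 2]))"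
    by (rule block_mat_gram) auto
  finally show ?thesis .
qed

text \<open>The passage from \<open>T\<^sub>1\<close> to \<open>T\<^sub>2\<close>: the second
  coordinate of the bracket is the first one with \<open>- J\<close> applied to the right
  argument.\<close>

lemma gram_times_copies_J:
  assumes "\<And>u k. u \<in> set xs \<Longrightarrow> k < q \<Longrightarrow> f' u (c k) = - f u (J (c k)) \<and> f' u (J (c k)) = f u (c k)"
  shows "gram f xs (pairs J q c) * copies q J_mat = gram f' xs (pairs J q c)"
proof (rule eq_matI)
  fix i j assume "i < dim_row (gram f' xs (pairs J q c))" "j < dim_col (gram f' xs (pairs J q c))"
  then have i: "i < length xs" and j: "j < 2 * q" by auto
  define k where "k = j div 2"
  have k: "2 * k < 2 * q" "Suc (2 * k) < 2 * q" "k < q" using j unfolding k_def by presburger+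
  let ?P = "pairs J q c"
  have "(gram f xs ?P * copies q J_mat) $$ (i, j) =
    (\<Sum>m<2 * q. f (xs ! i) (?P ! m) * copies q J_mat $$ (m, j))"
    using i j by (simp add: copies_entries scalar_prod_def atLeast0LessThan)
  also have "\<dots> = (\<Sum>m\<in>{2 * k, Suc (2 * k)}. f (xs ! i) (?P ! m) * copies q J_mat $$ (m, j))"
    using j k by (intro sum.mono_neutral_right) (auto simp: copies_entries k_def)
  also have "\<dots> = f (xs ! i) (c k) * J_mat $$ (0, j mod 2) + f (xs ! i) (J (c k)) * J_mat $$ (1, j mod 2)"
    using j k by (simp add: copies_entries nth_pairs k_def)
  also have "\<dots> = f' (xs ! i) (?P ! j)"
    using assms[of "xs ! i" k] i j k
    by (cases "even j") (auto simp: nth_pairs k_def odd_iff_mod_2_eq_one even_iff_mod_2_eq_zero)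
  finally show "(gram f xs ?P * copies q J_mat) $$ (i, j) = gram f' xs ?P $$ (i, j)"
    using i j by simp
qed (auto simp: copies_entries)

definition incidence_mat :: "nat \<Rightarrow> nat \<Rightarrow> nat set \<Rightarrow> complex mat" where
  "incidence_mat q q' I = mat q q' (\<lambda>(k, m). if k = sorted_list_of_set I ! m then 1 else 0)"

text \<open>Row \<open>k\<close> is nonzero exactly for \<open>k\<close> in \<open>I\<close>, and as
  \<open>I\<close> is enumerated increasingly the nonzero rows appear as unit vectors in their
  natural order.\<close>

lemma identity_with_zero_rows_incidence:
  assumes I: "I \<subseteq> {..<q}" "card I = q'"
  shows "identity_with_zero_rows q' (incidence_mat q q' I)"
proof -
  let ?A = "incidence_mat q q' I" and ?s = "sorted_list_of_set I"
  have fin: "finite I" using I(1) finite_subset by blast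
  have len: "length ?s = q'" using I(2) by simp
  have row_eq: "row ?A (?s ! m) = unit_vec q' m" if "m < q'" for m
  proof (rule eq_vecI)
    have "?s ! m \<in> I" using that len fin by (metis nth_mem set_sorted_list_of_set)
    then have "?s ! m < q" using I(1) by auto
    then show "row ?A (?s ! m) $ i = unit_vec q' m $ i" if "i < dim_vec (unit_vec q' m :: complex Matrix.vec)" for i
      using that \<open>m < q'\<close> len by (auto simp: incidence_mat_def nth_eq_iff_index_eq)
  qed (simp add: incidence_mat_def)
  have row0: "row ?A k = 0\<^sub>v q'" if "k < q" "k \<notin> I" for k
  proof (rule eq_vecI)
    show "row ?A k $ i = 0\<^sub>v q' $ i" if "i < dim_vec (0\<^sub>v q' :: complex Matrix.vec)" for i
    proof -
      have "?s ! i \<in> I" using that len fin by (metis index_zero_vec(2) nth_mem set_sorted_list_of_set)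
      then show ?thesis using that \<open>k < q\<close> \<open>k \<notin> I\<close> by (auto simp: incidence_mat_def)
    qed
  qed (simp add: incidence_mat_def)
  have nz: "row ?A k \<noteq> 0\<^sub>v q' \<longleftrightarrow> k \<in> I" if "k < q" for k
  proof
    assume "k \<in> I"
    then obtain m where m: "m < q'" "k = ?s ! m" using fin len by (metis in_set_conv_nth set_sorted_list_of_set)
    have "unit_vec q' m $ m \<noteq> (0\<^sub>v q' :: complex Matrix.vec) $ m" using m(1) by simp
    then show "row ?A k \<noteq> 0\<^sub>v q'" using row_eq[OF m(1)] m(2) by metis
  qed (use row0[OF that] in blast)
  have "filter (\<lambda>k. row ?A k \<noteq> 0\<^sub>v q') [0..<q] = filter (\<lambda>k. k \<in> I) [0..<q]"
    using nz by (intro filter_cong) auto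
  also have "\<dots> = ?s"
    using fin I(1) by (intro sorted_distinct_set_unique) (auto intro: sorted_wrt_filter)
  finally have "filter (\<lambda>v. v \<noteq> 0\<^sub>v q') (rows ?A) = map (row ?A) ?s"
    by (simp add: rows_def filter_map comp_def incidence_mat_def)
  also have "\<dots> = rows (1\<^sub>m q')"
    using len row_eq by (intro nth_equalityI) (auto simp: rows_def)
  finally show ?thesis by (simp add: identity_with_zero_rows_def incidence_mat_def)
qed

lemma gram_pairs_real_form:
  assumes e: "\<And>k m. k < q \<Longrightarrow> m < q' \<Longrightarrow>
    f (c k) (c' m) = (if k = sorted_list_of_set I ! m then 1 else 0) \<and> f (c k) (J (c' m)) = 0 \<and>
    f (J (c k)) (c' m) = 0 \<and> f (J (c k)) (J (c' m)) = (if k = sorted_list_of_set I ! m then 1 else 0)"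
  shows "gram f (pairs J q c) (pairs J q' c') = real_form (incidence_mat q q' I)"
proof (rule eq_matI)
  fix i j assume "i < dim_row (real_form (incidence_mat q q' I))" "j < dim_col (real_form (incidence_mat q q' I))"
  then have ij: "i < 2 * q" "j < 2 * q'" by (auto simp: real_form_def incidence_mat_def)
  then have "i div 2 < q" "j div 2 < q'" by auto
  note e' = e[OF this]
  have "i mod 2 = 0 \<or> i mod 2 = 1" "j mod 2 = 0 \<or> j mod 2 = 1" by auto
  then show "gram f (pairs J q c) (pairs J q' c') $$ (i, j) = real_form (incidence_mat q q' I) $$ (i, j)"
    using ij e' by (auto simp: real_form_def incidence_mat_def nth_pairs mat_of_rows_list_def Let_def
        even_iff_mod_2_eq_zero)
qed (auto simp: real_form_def incidence_mat_def)

lemma zero_cols_append: "0\<^sub>m (dim_row A) 0 @\<^sub>c A = A"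
  by (rule eq_matI) (auto simp: append_cols_def)

lemma W0_form_1: "W0_form 0 1 0 0 = mat 1 2 (\<lambda>(i, j). if j = 0 then 1 else 0)"
  by (rule eq_matI)
    (auto simp: W0_form_def block_mat_def append_cols_def append_rows_def copies_def L1_mat_def
      mat_of_rows_list_def less_Suc_eq numeral_2_eq_2 Let_def)

lemma W0_form_2: "W0_form 0 0 0 1 = 1\<^sub>m 2"
  by (rule eq_matI)
    (auto simp: W0_form_def block_mat_def append_cols_def append_rows_def copies_def Let_def)

lemma W0_form_3: "W0_form 0 0 1 0 = mat_of_rows_list 4 [[1, 0, 0, 1], [0, 1, 1, 0]]"
  by (rule eq_matI)
    (auto simp: W0_form_def block_mat_def append_cols_def append_rows_def copies_def Omega_mat_def
      mat_of_rows_list_def less_Suc_eq numeral_2_eq_2 eval_nat_numeral Let_def)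

lemma biorthogonal_independent:
  fixes xs :: "'a::real_vector list" and \<phi> :: "nat \<Rightarrow> 'a \<Rightarrow> real"
  assumes lin: "\<And>i. i < length xs \<Longrightarrow> linear (\<phi> i)"
    and bi: "\<And>i j. i < length xs \<Longrightarrow> j < length xs \<Longrightarrow> \<phi> i (xs ! j) = (if i = j then 1 else 0)"
  shows "distinct xs" "independent (set xs)"
proof -
  show d: "distinct xs"
    unfolding distinct_conv_nth using bi by (metis zero_neq_one)
  show "independent (set xs)"
    unfolding dependent_def
  proof
    assume "\<exists>a\<in>set xs. a \<in> span (set xs - {a})"
    then obtain j where j: "j < length xs" "xs ! j \<in> span (set xs - {xs ! j})"
      by (metis in_set_conv_nth)
    have "subspace {u. \<phi> j u = 0}"
      using lin[OF j(1)] by (auto simp: subspace_def linear_0 linear_add linear_cmul)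
    moreover have "set xs - {xs ! j} \<subseteq> {u. \<phi> j u = 0}"
      using bi[OF j(1)] by (auto simp: in_set_conv_nth)
    ultimately have "span (set xs - {xs ! j}) \<subseteq> {u. \<phi> j u = 0}" by (intro span_minimal)
    then show False using j bi[OF j(1) j(1)] by auto
  qed
qed

lemma pairs_nth: "pairs J (length cs) (\<lambda>k. cs ! k) = concat (map (\<lambda>v. [v, J v]) cs)"
proof -
  have "map (\<lambda>k. [cs ! k, J (cs ! k)]) [0..<length cs] = map (\<lambda>v. [v, J v]) (map (\<lambda>k. cs ! k) [0..<length cs])"
    by simp
  then show ?thesis unfolding pairs_def by (simp only: map_nth)
qed

text \<open>Joins the complex blocks into a single list of pairs, so that the columns numbered
  \<open>2j - 1\<close> and \<open>2j\<close> can be located without knowing their block.\<close>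

lemma concat_pairs:
  "concat (map (\<lambda>i. pairs J (q i) (c i)) is) =
   pairs J (length (concat (map (\<lambda>i. map (c i) [0..<q i]) is)))
     (\<lambda>k. concat (map (\<lambda>i. map (c i) [0..<q i]) is) ! k)"
  unfolding pairs_nth by (induction "is") (auto simp: pairs_def comp_def)

lemma W0_form_gram:
  fixes b :: "'a \<Rightarrow> 'a \<Rightarrow> real"
  assumes "p = 1 \<and> q = 1 \<and> b (f 0) (c 0) = 1 \<and> b (f 0) (J (c 0)) = 0 \<or>
     p = 2 \<and> q = 1 \<and> b (f 0) (c 0) = 1 \<and> b (f 0) (J (c 0)) = 0 \<and>
       b (f 1) (c 0) = 0 \<and> b (f 1) (J (c 0)) = 1 \<or>
     p = 2 \<and> q = 2 \<and> b (f 0) (c 0) = 1 \<and> b (f 0) (J (c 0)) = 0 \<and>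
       b (f 0) (c 1) = 0 \<and> b (f 0) (J (c 1)) = 1 \<and>
       b (f 1) (c 0) = 0 \<and> b (f 1) (J (c 0)) = 1 \<and>
       b (f 1) (c 1) = 1 \<and> b (f 1) (J (c 1)) = 0"
  shows "\<exists>z p' s t. gram b (map f [0..<p]) (pairs J q c) = W0_form z p' s t"
  using assms
proof (elim disjE, goal_cases)
  case 1
  then have "gram b (map f [0..<p]) (pairs J q c) = W0_form 0 1 0 0"
    unfolding W0_form_1 by (intro eq_matI) (auto simp: pairs_def less_Suc_eq numeral_2_eq_2)
  then show ?case by blast
next
  case 2
  then have "gram b (map f [0..<p]) (pairs J q c) = W0_form 0 0 0 1"
    unfolding W0_form_2
    by (intro eq_matI) (auto simp: pairs_def less_Suc_eq numeral_2_eq_2 nth_append)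
  then show ?case by blast
next
  case 3
  have pf: "pairs J 2 c = [c 0, J (c 0), c 1, J (c 1)]" "map f [0..<2] = [f 0, f 1]"
    by (simp_all add: pairs_def numeral_2_eq_2)
  from 3 have "gram b [f 0, f 1] [c 0, J (c 0), c 1, J (c 1)] = W0_form 0 0 1 0"
    unfolding W0_form_3
    by (intro eq_matI) (auto simp: mat_of_rows_list_def less_Suc_eq eval_nat_numeral)
  then show ?case using 3 pf by metis
qed

subsection \<open>Rotations of the Lie algebra\<close>

text \<open>\<open>J\<close> is the quarter turn in each rotation plane and \<open>wt\<close> the
  speed of rotation. \<open>J (J e) = - e\<close> is demanded for nonzero weight only, because for
  odd \<open>n\<close> the first basis vector has no partner and \<open>J\<close> sends it to
  0.\<close>

locale adapted_rotation =
  fixes br :: "'a::euclidean_space \<Rightarrow> 'a \<Rightarrow> 'a" and n :: nat and es :: "'a list" and x y :: 'a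
    and J D :: "'a \<Rightarrow> 'a" and wt :: "'a \<Rightarrow> real"
  assumes bil: "bilinear br" and alt: "br u u = 0"
    and basis: "adapted_basis br n es x y"
    and centre: "commutator_ideal br = lie_centre br"
    and J: "linear J" and D: "linear D"
    and derivation: "D (br u v) = br (D u) v + br u (D v)"
    and Dx: "D x = - y" and Dy: "D y = x"
    and wt: "e \<in> set es \<Longrightarrow> 0 \<le> wt e"
    and De: "e \<in> set es \<Longrightarrow> D e = - (wt e *\<^sub>R J e)"
    and DJe: "e \<in> set es \<Longrightarrow> D (J e) = wt e *\<^sub>R e"
    and Je: "e \<in> set es \<Longrightarrow> J e \<in> span {e' \<in> set es. wt e' = wt e}"
    and JJe: "e \<in> set es \<Longrightarrow> wt e \<noteq> 0 \<Longrightarrow> J (J e) = - e"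
begin

lemma len: "length es = n" and ind: "independent (set (es @ [x, y]))"
  and spn: "span (set (es @ [x, y])) = UNIV" and dist: "distinct (es @ [x, y])"
  and comm: "span {x, y} = commutator_ideal br"
  using basis by (auto simp: adapted_basis_def)

lemma br_simps [simp]:
  "br (u + v) w = br u w + br v w" "br (u - v) w = br u w - br v w" "br (c *\<^sub>R u) w = c *\<^sub>R br u w"
  "br (- u) w = - br u w" "br 0 w = 0"
  "br w (u + v) = br w u + br w v" "br w (u - v) = br w u - br w v" "br w (c *\<^sub>R u) = c *\<^sub>R br w u"
  "br w (- u) = - br w u" "br w 0 = 0"
  using bilinear_ladd[OF bil] bilinear_lsub[OF bil] bilinear_lmul[OF bil] bilinear_lneg[OF bil]
    bilinear_lzero[OF bil] bilinear_radd[OF bil] bilinear_rsub[OF bil] bilinear_rmul[OF bil]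
    bilinear_rneg[OF bil] bilinear_rzero[OF bil] by auto

lemma lin_simps [simp]:
  "J (u + v) = J u + J v" "J (u - v) = J u - J v" "J (c *\<^sub>R u) = c *\<^sub>R J u" "J (- u) = - J u" "J 0 = 0"
  "D (u + v) = D u + D v" "D (u - v) = D u - D v" "D (c *\<^sub>R u) = c *\<^sub>R D u" "D (- u) = - D u" "D 0 = 0"
  using linear_add[OF J] linear_diff[OF J] linear_cmul[OF J] linear_neg[OF J] linear_0[OF J]
    linear_add[OF D] linear_diff[OF D] linear_cmul[OF D] linear_neg[OF D] linear_0[OF D] by auto

lemma skew: "br u v = - br v u"
proof -
  have "br (u + v) (u + v) = 0" by (rule alt)
  then have "br u v + br v u = 0" using alt[of u] alt[of v] by (simp add: add.commute)
  then show ?thesis by (simp add: eq_neg_iff_add_eq_0)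
qed

lemma br_commutator: "br u v \<in> span {x, y}"
  unfolding comm commutator_ideal_def by (rule span_base) blast

lemma central: "z \<in> span {x, y} \<Longrightarrow> br z v = 0 \<and> br v z = 0"
  using skew[of v z] unfolding comm centre lie_centre_def by simp

section \<open>The two coordinates of the bracket\<close>

definition X :: "'a \<Rightarrow> real" where
  "X = (SOME f. linear f \<and> (\<forall>e\<in>set (es @ [x, y]). f e = (if e = x then 1 else 0)))"

definition Y :: "'a \<Rightarrow> real" where
  "Y = (SOME f. linear f \<and> (\<forall>e\<in>set (es @ [x, y]). f e = (if e = y then 1 else 0)))"

lemma XY: "linear X" "linear Y" "X x = 1" "X y = 0" "Y x = 0" "Y y = 1"
  "\<And>e. e \<in> set es \<Longrightarrow> X e = 0" "\<And>e. e \<in> set es \<Longrightarrow> Y e = 0"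
proof -
  have X: "linear X \<and> (\<forall>e\<in>set (es @ [x, y]). X e = (if e = x then 1 else 0))"
    unfolding X_def by (rule someI_ex[OF linear_independent_extend[OF ind, of "\<lambda>e. if e = x then 1 else 0"]])
  have Y: "linear Y \<and> (\<forall>e\<in>set (es @ [x, y]). Y e = (if e = y then 1 else 0))"
    unfolding Y_def by (rule someI_ex[OF linear_independent_extend[OF ind, of "\<lambda>e. if e = y then 1 else 0"]])
  show "linear X" "linear Y" "X x = 1" "X y = 0" "Y x = 0" "Y y = 1"
    "\<And>e. e \<in> set es \<Longrightarrow> X e = 0" "\<And>e. e \<in> set es \<Longrightarrow> Y e = 0"
    using X Y dist by auto
qed

lemma XY_simps [simp]:
  "X (u + v) = X u + X v" "X (u - v) = X u - X v" "X (c *\<^sub>R u) = c * X u" "X (- u) = - X u" "X 0 = 0"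
  "Y (u + v) = Y u + Y v" "Y (u - v) = Y u - Y v" "Y (c *\<^sub>R u) = c * Y u" "Y (- u) = - Y u" "Y 0 = 0"
  using linear_add[OF XY(1)] linear_diff[OF XY(1)] linear_cmul[OF XY(1)] linear_neg[OF XY(1)] linear_0[OF XY(1)]
    linear_add[OF XY(2)] linear_diff[OF XY(2)] linear_cmul[OF XY(2)] linear_neg[OF XY(2)] linear_0[OF XY(2)]
  by auto

lemma centre_expand:
  assumes "z \<in> span {x, y}" shows "z = X z *\<^sub>R x + Y z *\<^sub>R y"
proof -
  obtain a c where "z = a *\<^sub>R x + c *\<^sub>R y"
    using assms by (auto simp: span_insert span_singleton) (metis add.commute add_diff_cancel diff_add_cancel)
  then show ?thesis using XY by simp
qed

definition b :: "'a \<Rightarrow> 'a \<Rightarrow> real" where "b u v = X (br u v)"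
definition b' :: "'a \<Rightarrow> 'a \<Rightarrow> real" where "b' u v = Y (br u v)"

lemma br_eq: "br u v = b u v *\<^sub>R x + b' u v *\<^sub>R y"
  unfolding b_def b'_def by (rule centre_expand[OF br_commutator])

lemma bilinear_b: "bilinear b"
  unfolding bilinear_def by (intro conjI allI linearI) (simp_all add: b_def)

lemma b_simps [simp]:
  "b (u + v) w = b u w + b v w" "b (u - v) w = b u w - b v w" "b (c *\<^sub>R u) w = c * b u w"
  "b (- u) w = - b u w" "b 0 w = 0"
  "b w (u + v) = b w u + b w v" "b w (u - v) = b w u - b w v" "b w (c *\<^sub>R u) = c * b w u"
  "b w (- u) = - b w u" "b w 0 = 0"
  by (simp_all add: b_def)

lemma b_skew: "b u v = - b v u" "b' u v = - b' v u"
  unfolding b_def b'_def by (subst skew, simp)+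

text \<open>Comparison of the coefficients of \<open>x\<close> and \<open>y\<close> in the
  derivation rule, with \<open>D x = - y\<close> and \<open>D y = x\<close>.\<close>

lemma b'_eq: "b' u v = b (D u) v + b u (D v)"
  and b_eq: "- b u v = b' (D u) v + b' u (D v)"
proof -
  have "D (br u v) = b' u v *\<^sub>R x - b u v *\<^sub>R y"
    by (subst br_eq) (simp add: Dx Dy)
  then have *: "br (D u) v + br u (D v) = b' u v *\<^sub>R x - b u v *\<^sub>R y" using derivation by simp
  show "b' u v = b (D u) v + b u (D v)" using arg_cong[OF *, of X] XY by (simp add: b_def)
  show "- b u v = b' (D u) v + b' u (D v)" using arg_cong[OF *, of Y] XY by (simp add: b'_def)
qed

section \<open>Weight spaces\<close>

definition U :: "real \<Rightarrow> 'a set" where "U r = span {e \<in> set es. wt e = r}"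

lemma subspace_U: "subspace (U r)" by (simp add: U_def)

lemma U_simps [intro]:
  "0 \<in> U r" "u \<in> U r \<Longrightarrow> v \<in> U r \<Longrightarrow> u + v \<in> U r" "u \<in> U r \<Longrightarrow> v \<in> U r \<Longrightarrow> u - v \<in> U r"
  "u \<in> U r \<Longrightarrow> c *\<^sub>R u \<in> U r" "u \<in> U r \<Longrightarrow> - u \<in> U r"
  using subspace_U[of r] by (auto simp: subspace_0 subspace_add subspace_diff subspace_mul subspace_neg)

lemma U_induct:
  assumes "u \<in> U r" "subspace S" "\<And>e. e \<in> set es \<Longrightarrow> wt e = r \<Longrightarrow> e \<in> S"
  shows "u \<in> S"
  using assms(1) span_minimal[of "{e \<in> set es. wt e = r}" S] assms(2,3) unfolding U_def by blast

lemma subspace_eqs: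
  assumes "linear f" "linear g" shows "subspace {u. f u = g u}"
  using assms by (auto simp: subspace_def linear_0 linear_add linear_cmul)

lemma J_U: "u \<in> U r \<Longrightarrow> J u \<in> U r"
proof -
  assume u: "u \<in> U r"
  have "u \<in> {u. J u \<in> U r}"
    by (rule U_induct[OF u]) (use Je in \<open>auto simp: subspace_def U_def intro: span_add span_mul span_0\<close>)
  then show ?thesis by simp
qed

lemma D_U: assumes u: "u \<in> U r" shows "D u = - (r *\<^sub>R J u)"
proof -
  have "u \<in> {u. D u = - (r *\<^sub>R J u)}"
    by (rule U_induct[OF u subspace_eqs]) (use De in \<open>auto intro!: D linearI simp: algebra_simps\<close>)
  then show ?thesis by simp
qed

lemma DD_U: assumes u: "u \<in> U r" shows "D (D u) = - (r\<^sup>2 *\<^sub>R u)"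
proof -
  have "u \<in> {u. D (D u) = - (r\<^sup>2 *\<^sub>R u)}"
    by (rule U_induct[OF u subspace_eqs])
       (use De DJe in \<open>auto intro!: linearI simp: algebra_simps power2_eq_square\<close>)
  then show ?thesis by simp
qed

lemma JJ_U: assumes u: "u \<in> U r" and r: "r \<noteq> 0" shows "J (J u) = - u"
proof -
  have "u \<in> {u. J (J u) = - u}"
    by (rule U_induct[OF u subspace_eqs]) (use JJe r in \<open>auto intro!: linearI simp: algebra_simps\<close>)
  then show ?thesis by simp
qed

lemma D_in_U: "u \<in> U r \<Longrightarrow> D u \<in> U r"
  using D_U[of u r] U_simps(5)[OF U_simps(4)[OF J_U]] by simp

lemma XY_U: assumes u: "u \<in> U r" shows "X u = 0" "Y u = 0"
proof -
  have "u \<in> {u. X u = 0}" by (rule U_induct[OF u]) (use XY in \<open>auto simp: subspace_def\<close>)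
  moreover have "u \<in> {u. Y u = 0}" by (rule U_induct[OF u]) (use XY in \<open>auto simp: subspace_def\<close>)
  ultimately show "X u = 0" "Y u = 0" by auto
qed

lemma U_centre: "u \<in> U r \<Longrightarrow> u \<in> span {x, y} \<Longrightarrow> u = 0"
  using centre_expand[of u] XY_U[of u r] by simp

text \<open>On the values of the bracket \<open>D\<close> has square \<open>-1\<close>. Expanding
  this square by the derivation rule gives the terms with \<open>- r\<^sup>2\<close> and
  \<open>- s\<^sup>2\<close> and twice the mixed term.\<close>

lemma D_D_b:
  assumes "u \<in> U r" "v \<in> U s"
  shows "2 * b (D u) (D v) = (r\<^sup>2 + s\<^sup>2 - 1) * b u v"
  using b_eq[of u v] b'_eq[of "D u" v] b'_eq[of u "D v"] DD_U[OF assms(1)] DD_U[OF assms(2)]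
  by (simp add: algebra_simps)

text \<open>\<open>D_D_b\<close> for \<open>u, v\<close> and again for \<open>D u, D v\<close> gives
  \<open>4 r\<^sup>2 s\<^sup>2 b u v = (r\<^sup>2 + s\<^sup>2 - 1)\<^sup>2 b u v\<close>; the
  difference of the coefficients splits into the four linear factors excluded by the
  assumptions.\<close>

lemma weights_orthogonal:
  assumes u: "u \<in> U r" and v: "v \<in> U s" and rs: "r + s \<noteq> 1" "r - s \<noteq> 1" "s - r \<noteq> 1" "0 \<le> r" "0 \<le> s"
  shows "br u v = 0"
proof -
  have 0: "b u v = 0" if u: "u \<in> U r" and v: "v \<in> U s" for u v
  proof -
    have "2 * b (D (D u)) (D (D v)) = (r\<^sup>2 + s\<^sup>2 - 1) * b (D u) (D v)"
      by (rule D_D_b[OF D_in_U[OF u] D_in_U[OF v]])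
    moreover have "b (D (D u)) (D (D v)) = r\<^sup>2 * s\<^sup>2 * b u v"
      by (simp add: DD_U[OF u] DD_U[OF v])
    ultimately have "2 * (r\<^sup>2 * s\<^sup>2 * b u v) = (r\<^sup>2 + s\<^sup>2 - 1) * b (D u) (D v)" by simp
    note * = this
    have "4 * (r\<^sup>2 * s\<^sup>2 * b u v) = 2 * (2 * (r\<^sup>2 * s\<^sup>2 * b u v))" by simp
    also have "\<dots> = 2 * ((r\<^sup>2 + s\<^sup>2 - 1) * b (D u) (D v))" by (simp only: *)
    also have "\<dots> = (r\<^sup>2 + s\<^sup>2 - 1) * (2 * b (D u) (D v))" by (rule mult.left_commute)
    also have "\<dots> = (r\<^sup>2 + s\<^sup>2 - 1) * ((r\<^sup>2 + s\<^sup>2 - 1) * b u v)" using D_D_b[OF u v] by simp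
    finally have "4 * (r\<^sup>2 * s\<^sup>2 * b u v) = (r\<^sup>2 + s\<^sup>2 - 1) * ((r\<^sup>2 + s\<^sup>2 - 1) * b u v)" .
    then have "(1 - (r - s)) * (1 + (r - s)) * ((r + s) - 1) * ((r + s) + 1) * b u v = 0"
      by (simp add: algebra_simps power2_eq_square)
    moreover have "(r + s) + 1 \<noteq> 0" "1 - (r - s) \<noteq> 0" "1 + (r - s) \<noteq> 0" "(r + s) - 1 \<noteq> 0"
      using rs by auto
    ultimately show ?thesis by simp
  qed
  have "b' u v = 0" unfolding b'_eq using 0[OF D_in_U[OF u] v] 0[OF u D_in_U[OF v]] by simp
  then show ?thesis using 0[OF u v] by (simp add: br_eq)
qed

definition V :: "nat \<Rightarrow> 'a set" where "V j = U (real j)"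

lemma V_orthogonal:
  assumes "u \<in> V i" "v \<in> V j" "j \<noteq> Suc i" "i \<noteq> Suc j" shows "br u v = 0"
proof (rule weights_orthogonal)
  show "u \<in> U (real i)" "v \<in> U (real j)" using assms by (auto simp: V_def)
  have "i + j \<noteq> 1" using assms(3,4) by (cases i; cases j) auto
  then show "real i + real j \<noteq> 1" by (metis of_nat_1 of_nat_add of_nat_eq_iff)
  show "real i - real j \<noteq> 1" "real j - real i \<noteq> 1" using assms(3,4) by linarith+
qed auto

lemma V_orthogonal_other:
  assumes "u \<in> V i" "v \<in> U s" "s \<notin> \<nat>" "0 \<le> s" shows "br u v = 0"
proof (rule weights_orthogonal[OF _ assms(2)])
  show "u \<in> U (real i)" using assms by (simp add: V_def)
  have *: "s \<noteq> of_int k" for k :: int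
  proof
    assume k: "s = of_int k"
    then have "s = real (nat k)" using assms(4) by simp
    then show False using assms(3) by (metis of_nat_in_Nats)
  qed
  show "real i + s \<noteq> 1" using *[of "1 - int i"] by auto
  show "real i - s \<noteq> 1" using *[of "int i - 1"] by auto
  show "s - real i \<noteq> 1" using *[of "1 + int i"] by auto
qed (use assms in auto)

text \<open>For consecutive weights \<open>r\<^sup>2 + s\<^sup>2 - 1 = 2 r s\<close>, which cancels
  the factors by which \<open>D\<close> differs from \<open>J\<close>.\<close>

lemma b_JJ:
  assumes u: "u \<in> V (Suc j)" and v: "v \<in> V (Suc (Suc j))"
  shows "b (J u) (J v) = b u v"
proof -
  let ?r = "real (Suc j)" and ?s = "real (Suc (Suc j))"
  have "2 * (?r * (?s * b (J u) (J v))) = (?r\<^sup>2 + ?s\<^sup>2 - 1) * b u v"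
    using D_D_b[of u ?r v ?s] u v D_U[of u ?r] D_U[of v ?s] by (simp add: V_def ac_simps)
  also have "?r\<^sup>2 + ?s\<^sup>2 - 1 = 2 * (?r * ?s)" by (simp add: power2_eq_square algebra_simps)
  finally have "(2 * ?r * ?s) * b (J u) (J v) = (2 * ?r * ?s) * b u v" by (simp only: mult.assoc)
  moreover have "2 * ?r * ?s \<noteq> 0" by simp
  ultimately show ?thesis using mult_left_cancel by blast
qed

text \<open>After \<open>J\<close> is moved to the right argument, the two terms of
  \<open>b'_eq\<close> have coefficients \<open>j\<close> and \<open>- (j + 1)\<close>; over
  \<open>V 0\<close> only the second is present.\<close>

lemma b'_J:
  assumes u: "u \<in> V j" and v: "v \<in> V (Suc j)"
  shows "b' u v = - b u (J v)"
proof (cases j)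
  case 0
  then show ?thesis using D_U[of u 0] D_U[of v 1] u v by (simp add: b'_eq V_def)
next
  case (Suc i)
  have Jb: "b (J u) v = - b u (J v)"
    using b_JJ[of "J u" i v] JJ_U[of u "real j"] u v Suc J_U[of u "real j"] by (simp add: V_def)
  have "b' u v = - (real j * b (J u) v) - real (Suc j) * b u (J v)"
    using D_U[of u "real j"] D_U[of v "real (Suc j)"] u v by (simp add: b'_eq V_def)
  then show ?thesis by (simp add: Jb algebra_simps)
qed

lemma centre_trivial:
  assumes "\<And>v. v \<in> set es \<Longrightarrow> br u v = 0" shows "u \<in> span {x, y}"
proof -
  have "br u v = 0" for v
  proof -
    have "subspace {v. br u v = 0}" by (auto simp: subspace_def)
    moreover have "set (es @ [x, y]) \<subseteq> {v. br u v = 0}"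
      using assms central span_base[of x "{x, y}"] span_base[of y "{x, y}"] by auto
    ultimately show ?thesis using span_minimal spn by blast
  qed
  then show ?thesis unfolding comm centre lie_centre_def by simp
qed

text \<open>A vector of weight 0 commutes with all weights except 1, so if it is orthogonal to
  weight 1 as well, it is central, and no nonzero weight vector is central in the span of
  \<open>x\<close> and \<open>y\<close>.\<close>

lemma left_nondegenerate:
  assumes u: "u \<in> V 0" and 0: "\<And>v. v \<in> V (Suc 0) \<Longrightarrow> b u v = 0"
  shows "u = 0"
proof -
  have u0: "u \<in> U 0" using u by (simp add: V_def)
  have "br u e = 0" if e: "e \<in> set es" for e
  proof (cases "wt e = 1")
    case True
    then have "e \<in> V (Suc 0)" using e by (auto simp: V_def U_def intro: span_base)
    moreover from this have "J e \<in> V (Suc 0)" by (simp add: V_def J_U)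
    ultimately show ?thesis using 0 b'_J[OF u] by (simp add: br_eq)
  next
    case False
    have "e \<in> U (wt e)" using e by (auto simp: U_def intro: span_base)
    then show ?thesis using weights_orthogonal[OF u0, of e "wt e"] False wt[OF e] by auto
  qed
  then have "u \<in> span {x, y}" by (rule centre_trivial)
  then show ?thesis using U_centre[OF u0] by blast
qed

sublocale rotation_generator D "set (es @ [x, y])"
proof (rule rotation_generator.intro)
  show "linear D" by (rule D)
  show "span (set (es @ [x, y])) = UNIV" by (rule spn)
  show "\<exists>w \<omega>. D e = - (\<omega> *\<^sub>R w) \<and> D w = \<omega> *\<^sub>R e" if e: "e \<in> set (es @ [x, y])" for e
  proof -
    consider "e \<in> set es" | "e = x" | "e = y" using e by auto
    then show ?thesis
    proof cases
      case 1
      then show ?thesis using De DJe by blast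
    next
      case 2
      then show ?thesis using Dx Dy by (intro exI[of _ y] exI[of _ 1]) simp
    next
      case 3
      then show ?thesis using Dx Dy by (intro exI[of _ "- x"] exI[of _ 1]) simp
    qed
  qed
qed


lemma span_invariant:
  assumes "\<And>g. g \<in> G \<Longrightarrow> D g \<in> span G" "u \<in> span G"
  shows "D u \<in> span G"
proof -
  have "subspace {u. D u \<in> span G}" by (auto simp: subspace_def intro: span_add span_mul span_0)
  then have "span G \<subseteq> {u. D u \<in> span G}" using assms(1) by (intro span_minimal) auto
  then show ?thesis using assms(2) by blast
qed

lemma span_commute:
  assumes "\<And>g h. g \<in> G \<Longrightarrow> h \<in> H \<Longrightarrow> br g h = 0" "u \<in> span G" "v \<in> span H"
  shows "br u v = 0"
proof -
  have "br g v = 0" if "g \<in> G" for g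
  proof -
    have "subspace {v. br g v = 0}" by (auto simp: subspace_def)
    then have "span H \<subseteq> {v. br g v = 0}" using assms(1) that by (intro span_minimal) auto
    then show ?thesis using assms(3) by blast
  qed
  moreover have "subspace {u. br u v = 0}" by (auto simp: subspace_def)
  ultimately have "span G \<subseteq> {u. br u v = 0}" by (intro span_minimal) auto
  then show ?thesis using assms(2) by blast
qed

lemma subspace_V: "subspace (V j)"
  by (simp add: V_def subspace_U)

lemma es_in_U: "e \<in> set es \<Longrightarrow> e \<in> U (wt e)"
  by (auto simp: U_def intro: span_base)

text \<open>The ideals are \<open>I1\<close>, the centre with the images of all \<open>E j\<close>,
  and \<open>I2\<close>, the centre with their kernels and all basis vectors of nonintegral weight.
  If \<open>I1\<close> is everything, the maps are identities and the weights are integral; if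
  \<open>I2\<close> is, the maps are zero.\<close>

lemma indecomposable:
  fixes T
  assumes T: "T = range flow" and nd: "\<not> T_decomposable br T"
    and lin: "\<And>j. linear (E j)" and EV: "\<And>j v. v \<in> V j \<Longrightarrow> E j v \<in> V j"
    and EE: "\<And>j v. v \<in> V j \<Longrightarrow> E j (E j v) = E j v"
    and EJ: "\<And>j v. v \<in> V (Suc j) \<Longrightarrow> E (Suc j) (J v) = J (E (Suc j) v)"
    and adj: "\<And>j u v. u \<in> V j \<Longrightarrow> v \<in> V (Suc j) \<Longrightarrow> b (E j u) v = b u (E (Suc j) v)"
  shows "(\<forall>j. \<forall>v\<in>V j. E j v = 0) \<or> (\<forall>j. \<forall>v\<in>V j. E j v = v) \<and> (\<forall>e\<in>set es. wt e \<in> \<nat>)"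
proof (rule ccontr)
  assume contra: "\<not> ?thesis"
  \<comment> \<open>A single linear map that is \<open>E j\<close> on \<open>V j\<close> and kills
    the centre and the nonintegral weights. It separates the ideals: on \<open>I1\<close> it is the
    identity modulo the centre, on \<open>I2\<close> it is zero.\<close>
  obtain F where F: "linear F" and Fe: "\<And>e. e \<in> set (es @ [x, y]) \<Longrightarrow>
    F e = (if e \<in> set es \<and> wt e \<in> \<nat> then E (nat \<lfloor>wt e\<rfloor>) e else 0)"
    using linear_independent_extend[OF ind, of "\<lambda>e. if e \<in> set es \<and> wt e \<in> \<nat> then E (nat \<lfloor>wt e\<rfloor>) e else 0"]
    by blast
  have FV: "F v = E j v" if v: "v \<in> V j" for j v
  proof -
    have "v \<in> {v. F v = E j v}"
      by (rule U_induct[OF v[unfolded V_def] subspace_eqs[OF F lin]]) (simp add: Fe)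
    then show ?thesis by simp
  qed
  have Fxy: "F x = 0" "F y = 0" using Fe[of x] Fe[of y] dist by auto
  have F_centre: "F z = 0" if "z \<in> span {x, y}" for z
    by (subst centre_expand[OF that]) (simp add: linear_add[OF F] linear_cmul[OF F] Fxy)
  define A where "A = {E j v |j v. v \<in> V j}"
  define B where "B = {v - E j v |j v. v \<in> V j}"
  define Q where "Q = {e \<in> set es. wt e \<notin> \<nat>}"
  define I1 where "I1 = span ({x, y} \<union> A)"
  define I2 where "I2 = span ({x, y} \<union> (Q \<union> B))"
  have sub: "subspace I1" "subspace I2" by (simp_all add: I1_def I2_def)
  have C1: "span {x, y} \<subseteq> I1" and C2: "span {x, y} \<subseteq> I2"
    unfolding I1_def I2_def by (auto intro!: span_mono)
  have EJ': "D (E j v) = E j (- (real j *\<^sub>R J v))" if "v \<in> V j" for j v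
    using D_U[of "E j v" "real j"] EV[OF that] EJ[of v "j - 1"] that
    by (cases j) (simp_all add: V_def linear_neg[OF lin] linear_cmul[OF lin] linear_0[OF lin])
  have JV: "J v \<in> V j" if "v \<in> V j" for j v using that by (simp add: V_def J_U)
  have JV': "- (real j *\<^sub>R J v) \<in> V j" if "v \<in> V j" for j v
    using JV[OF that] unfolding V_def by auto
  have DV: "D v = - (real j *\<^sub>R J v)" if "v \<in> V j" for j v using D_U that by (simp add: V_def)
  have "D u \<in> I1" if "u \<in> I1" for u
    unfolding I1_def
  proof (rule span_invariant[OF _ that[unfolded I1_def]])
    fix g assume "g \<in> {x, y} \<union> A"
    then consider "g = x" | "g = y" | j v where "v \<in> V j" "g = E j v" by (auto simp: A_def)
    then show "D g \<in> span ({x, y} \<union> A)"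
    proof cases
      case 3
      then have "D g \<in> A" using EJ' JV' unfolding A_def by blast
      then show ?thesis by (auto intro: span_base)
    qed (auto simp: Dx Dy intro: span_base span_neg)
  qed
  then have inv1: "flow r u \<in> I1" if "u \<in> I1" for r u using flow_invariant[OF sub(1) _ that] by blast
  have "D u \<in> I2" if "u \<in> I2" for u
    unfolding I2_def
  proof (rule span_invariant[OF _ that[unfolded I2_def]])
    fix g assume "g \<in> {x, y} \<union> (Q \<union> B)"
    then consider "g = x" | "g = y" | "g \<in> Q" | j v where "v \<in> V j" "g = v - E j v" by (auto simp: B_def)
    then show "D g \<in> span ({x, y} \<union> (Q \<union> B))"
    proof cases
      case 3
      then have "J g \<in> span {e' \<in> set es. wt e' = wt g}" using Je by (auto simp: Q_def)
      moreover have "{e' \<in> set es. wt e' = wt g} \<subseteq> {x, y} \<union> (Q \<union> B)" using 3 by (auto simp: Q_def)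
      ultimately have "J g \<in> span ({x, y} \<union> (Q \<union> B))" using span_mono by blast
      then show ?thesis using De[of g] 3 by (auto simp: Q_def intro: span_neg span_mul)
    next
      case 4
      have "D g = - (real j *\<^sub>R J v) - E j (- (real j *\<^sub>R J v))"
        using EJ'[OF 4(1)] DV[OF 4(1)] 4(2) by simp
      then have "D g \<in> B" using JV'[OF 4(1)] unfolding B_def by blast
      then show ?thesis by (auto intro: span_base)
    qed (auto simp: Dx Dy intro: span_base span_neg)
  qed
  then have inv2: "flow r u \<in> I2" if "u \<in> I2" for r u using flow_invariant[OF sub(2) _ that] by blast
  have AB: "br (E j a) (w - E k w) = 0" if a: "a \<in> V j" and w: "w \<in> V k" for j k a w
  proof -
    have wk: "w - E k w \<in> V k" if "w \<in> V k" for w using EV[OF that] that by (auto simp: V_def)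
    \<comment> \<open>For neighbouring levels \<open>b\<close> vanishes by adjointness and
      idempotence, and so does \<open>b'\<close>, which is \<open>- b\<close> with \<open>J\<close>
      on the right, where \<open>J\<close> commutes with the maps.\<close>
    consider "k = Suc j" | "j = Suc k" | "k \<noteq> Suc j" "j \<noteq> Suc k" by blast
    then show ?thesis
    proof cases
      case 1
      have 0: "b (E j a) (w - E k w) = 0" if "w \<in> V k" for w
        using adj[of "E j a" j w] EV[OF a] EE[OF a] that 1 by simp
      have "b' (E j a) (w - E k w) = - b (E j a) (J w - E k (J w))"
        using b'_J[of "E j a" j "w - E k w"] EV[OF a] wk[OF w] 1 EJ[of w j] w by simp
      then show ?thesis using 0[OF w] 0[OF JV[OF w]] by (simp add: br_eq)
    next
      case 2
      have 0: "b (w - E k w) (E j a) = 0" if "a \<in> V j" for a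
        using adj[of w k "E j a"] EV[OF that] EE[OF that] w 2 by simp
      have "b' (w - E k w) (E j a) = - b (w - E k w) (E j (J a))"
        using b'_J[of "w - E k w" k "E j a"] EV[OF a] wk[OF w] 2 EJ[of a k] a by simp
      then have "br (w - E k w) (E j a) = 0" using 0[OF a] 0[OF JV[OF a]] by (simp add: br_eq)
      then show ?thesis by (subst skew) simp
    next
      case 3
      then show ?thesis using V_orthogonal[OF EV[OF a] wk[OF w]] by simp
    qed
  qed
  have AQ: "br (E j a) e = 0" if a: "a \<in> V j" and e: "e \<in> Q" for j a e
    using V_orthogonal_other[OF EV[OF a] es_in_U[of e]] e wt[of e] by (auto simp: Q_def)
  have comm12: "br u v = 0" if "u \<in> I1" "v \<in> I2" for u v
  proof (rule span_commute[OF _ that[unfolded I1_def I2_def]])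
    fix g h assume g: "g \<in> {x, y} \<union> A" and h: "h \<in> {x, y} \<union> (Q \<union> B)"
    show "br g h = 0"
    proof (cases "g \<in> {x, y} \<or> h \<in> {x, y}")
      case True
      then show ?thesis using central span_base by blast
    next
      case False
      then show ?thesis using g h AB AQ unfolding A_def B_def by blast
    qed
  qed
  have sumUNIV: "{u + v |u v. u \<in> I1 \<and> v \<in> I2} = UNIV"
  proof -
    let ?S = "{u + v |u v. u \<in> I1 \<and> v \<in> I2}"
    have S: "subspace ?S" by (rule subspace_sums[OF sub])
    have "e \<in> ?S" if e: "e \<in> set (es @ [x, y])" for e
    proof -
      consider "e \<in> {x, y}" | "e \<in> Q" | "e \<in> set es" "wt e \<in> \<nat>" using e by (auto simp: Q_def)
      then have "\<exists>u\<in>I1. \<exists>v\<in>I2. e = u + v"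
      proof cases
        case 1
        then have "e \<in> I1" using C1 span_base by blast
        then show ?thesis using subspace_0[OF sub(2)] by (metis add.right_neutral)
      next
        case 2
        then have "e \<in> I2" unfolding I2_def by (auto intro: span_base)
        then show ?thesis using subspace_0[OF sub(1)] by (metis add.left_neutral)
      next
        case 3
        then obtain j where "wt e = real j" by (auto simp: Nats_def)
        then have "e \<in> V j" using es_in_U[OF 3(1)] by (simp add: V_def)
        then have "E j e \<in> I1" "e - E j e \<in> I2"
          unfolding I1_def I2_def A_def B_def by (auto intro!: span_base)
        then show ?thesis by (metis add.commute diff_add_cancel)
      qed
      then show ?thesis by blast
    qed
    then have "set (es @ [x, y]) \<subseteq> ?S" by blast
    then have "span (set (es @ [x, y])) \<subseteq> ?S" using S by (rule span_minimal)
    then show ?thesis using spn by auto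
  qed
  have F1: "v - F v \<in> span {x, y}" if "v \<in> I1" for v
  proof -
    let ?S = "{v. v - F v \<in> span {x, y}}"
    have "subspace ?S"
      unfolding subspace_def
    proof (intro conjI ballI allI)
      show "0 \<in> ?S" by (simp add: linear_0[OF F] span_0)
      show "u + v \<in> ?S"
        if "u \<in> ?S" "v \<in> ?S" for u v
        using span_add[of "u - F u" "{x, y}" "v - F v"] that by (simp add: linear_add[OF F] algebra_simps)
      show "c *\<^sub>R v \<in> ?S" if "v \<in> ?S" for c v
        using span_mul[of "v - F v" "{x, y}" c] that by (simp add: linear_cmul[OF F] algebra_simps)
    qed
    moreover have "{x, y} \<union> A \<subseteq> ?S"
      using Fxy FV[OF EV] EE by (auto simp: A_def span_base span_0)
    ultimately have "I1 \<subseteq> ?S" unfolding I1_def by (rule span_minimal[rotated])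
    then show ?thesis using that by blast
  qed
  have F2: "F v = 0" if "v \<in> I2" for v
  proof -
    have "subspace {v. F v = 0}"
      by (auto simp: subspace_def linear_0[OF F] linear_add[OF F] linear_cmul[OF F])
    moreover have "F (v - E j v) = 0" if v: "v \<in> V j" for j v
      using FV[OF v] FV[OF EV[OF v]] EE[OF v] by (simp add: linear_diff[OF F])
    then have "{x, y} \<union> (Q \<union> B) \<subseteq> {v. F v = 0}"
      using Fxy Fe by (auto simp: B_def Q_def)
    ultimately have "I2 \<subseteq> {v. F v = 0}" unfolding I2_def by (rule span_minimal[rotated])
    then show ?thesis using that by blast
  qed
  have "v \<in> span {x, y}" if "v \<in> I1" "v \<in> I2" for v using F1[OF that(1)] F2[OF that(2)] by simp
  then have inter: "I1 \<inter> I2 = commutator_ideal br"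
    using C1 C2 unfolding comm[symmetric] by blast
  have "I1 \<noteq> UNIV"
  proof
    assume U: "I1 = UNIV"
    have "E j v = v" if v: "v \<in> V j" for j v
    proof -
      have "v - E j v \<in> span {x, y}" using F1[of v] FV[OF v] U by simp
      moreover have "v - E j v \<in> U (real j)" using v EV[OF v] by (auto simp: V_def)
      ultimately have "v - E j v = 0" using U_centre by blast
      then show ?thesis by simp
    qed
    moreover have "wt e \<in> \<nat>" if e: "e \<in> set es" for e
    proof (rule ccontr)
      assume "wt e \<notin> \<nat>"
      then have "F e = 0" using Fe e by simp
      then have "e \<in> span {x, y}" using F1[of e] U by simp
      then have "e = 0" using U_centre[OF es_in_U[OF e]] by simp
      then show False using ind e dependent_zero[of "set (es @ [x, y])"] by auto
    qed
    ultimately show False using contra by blast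
  qed
  moreover have "I2 \<noteq> UNIV"
  proof
    assume "I2 = UNIV"
    then have "E j v = 0" if "v \<in> V j" for j v using F2[of v] FV[OF that] by simp
    then show False using contra by blast
  qed
  moreover have "lie_ideal br I1" "lie_ideal br I2"
    using sub br_commutator C1 C2 unfolding lie_ideal_def by blast+
  moreover have "T_invariant T I1" "T_invariant T I2"
    using inv1 inv2 unfolding T_invariant_def T by blast+
  ultimately have "T_decomposable br T"
    unfolding T_decomposable_def using sumUNIV comm12 inter by blast
  then show False using nd by blast
qed

lemma T2_gram:
  assumes "\<And>u. u \<in> set us \<Longrightarrow> u \<in> V j" "\<And>k. k < q \<Longrightarrow> c k \<in> V (Suc j)"
  shows "gram b us (pairs J q c) * copies q J_mat = gram b' us (pairs J q c)"
proof (rule gram_times_copies_J)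
  fix u k assume "u \<in> set us" "k < q"
  then have u: "u \<in> V j" and c: "c k \<in> V (Suc j)" "J (c k) \<in> V (Suc j)"
    using assms J_U by (auto simp: V_def)
  have "J (J (c k)) = - c k" using c(1) JJ_U[of "c k" "real (Suc j)"] by (simp add: V_def)
  then show "b' u (c k) = - b u (J (c k)) \<and> b' u (J (c k)) = b u (c k)"
    using b'_J[OF u c(1)] b'_J[OF u c(2)] by simp
qed

section \<open>Assembling the basis and the matrices of the normal form\<close>

lemma normal_form:
  assumes T: "T = range flow" and nd: "\<not> T_decomposable br T" and zero: "\<exists>e\<in>set es. wt e = 0"
    and dimn: "DIM('a) = n + 2"
  shows "\<exists>(l::nat) (d::nat \<Rightarrow> nat) (es::'a list) (x::'a) (y::'a)
            (W::nat \<Rightarrow> real mat) (T1::real mat) (T2::real mat).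
     adapted_basis br n es x y \<and>
     (\<Sum>i\<le>l + 1. d i) = n \<and> (\<forall>i\<le>l + 1. 0 < d i) \<and> (\<forall>i\<in>{1..l + 1}. even (d i)) \<and>
     T = {exp_map D | D t. has_matrix (es @ [x, y]) D (normal_derivation l d t)} \<and>
     (\<forall>i\<le>l. W i \<in> carrier_mat (d i) (d (i + 1))) \<and>
     T1 = chain_mat l d W \<and>
     T2 = chain_mat l d (\<lambda>i. W i * copies (d (i + 1) div 2) J_mat) \<and>
     described_by br es x y T1 T2 \<and>
     (\<exists>z p s t. W 0 = W0_form z p s t) \<and>
     (\<forall>i\<in>{1..l}. \<exists>c r A. identity_with_zero_rows r A \<and>
        W i = real_form (0\<^sub>m (dim_row A) c @\<^sub>c A) \<and> (i = l \<longrightarrow> c = 0)) \<and>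
     (\<forall>j\<in>{1..n div 2}.
        \<not> (numbered_col n T1 (2 * j - 1) = 0\<^sub>v n \<and> numbered_col n T1 (2 * j) = 0\<^sub>v n))"
proof -
  have es0: "e \<noteq> 0" if "e \<in> set es" for e
    using ind that dependent_zero[of "set (es @ [x, y])"] by auto
  have "finite {j. \<exists>e\<in>set es. wt e = real j}"
  proof (rule finite_subset)
    show "{j. \<exists>e\<in>set es. wt e = real j} \<subseteq> (\<lambda>e. nat \<lfloor>wt e\<rfloor>) ` set es"
    proof
      fix j assume "j \<in> {j. \<exists>e\<in>set es. wt e = real j}"
      then obtain e where "e \<in> set es" "wt e = real j" by blast
      then show "j \<in> (\<lambda>e. nat \<lfloor>wt e\<rfloor>) ` set es" by (intro image_eqI[of _ _ e]) simp_all
    qed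
  qed simp
  then obtain M where "\<forall>j\<in>{j. \<exists>e\<in>set es. wt e = real j}. j \<le> M"
    unfolding finite_nat_set_iff_bounded_le ..
  then have M: "j \<le> M" if "e \<in> set es" "wt e = real j" for j e using that by blast
  have V_top: "V j = {0}" if "M < j" for j
  proof -
    have "{e \<in> set es. wt e = real j} = {}" using M[of _ j] that by fastforce
    then show ?thesis by (simp only: V_def U_def span_empty)
  qed
  have V0: "V 0 \<noteq> {0}"
  proof -
    obtain e where "e \<in> set es" "wt e = 0" using zero by blast
    then have "e \<in> V 0" "e \<noteq> 0" using es_in_U[of e] es0[of e] by (simp_all add: V_def)
    then show ?thesis by blast
  qed
  have VJ: "J v \<in> V j" if "v \<in> V j" for v j using that J_U by (simp add: V_def)
  have VJJ: "J (J v) = - v" if "v \<in> V (Suc j)" for v j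
    using that JJ_U[of v "real (Suc j)"] by (simp add: V_def)
  interpret G: graded_pairing V J b M
  proof (rule graded_pairing.intro)
    show "(\<forall>j. \<forall>v\<in>V j. E j v = 0) \<or> (\<forall>j. \<forall>v\<in>V j. E j v = v)"
      if "\<And>j. linear (E j)" "\<And>j v. v \<in> V j \<Longrightarrow> E j v \<in> V j"
        "\<And>j v. v \<in> V j \<Longrightarrow> E j (E j v) = E j v"
        "\<And>j v. v \<in> V (Suc j) \<Longrightarrow> E (Suc j) (J v) = J (E (Suc j) v)"
        "\<And>j u v. u \<in> V j \<Longrightarrow> v \<in> V (Suc j) \<Longrightarrow> b (E j u) v = b u (E (Suc j) v)" for E
      using indecomposable[OF T nd that] by blast
    show "u = 0" if "u \<in> V 0" "\<And>v. v \<in> V (Suc 0) \<Longrightarrow> b u v = 0" for u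
      using that by (rule left_nondegenerate)
  qed (fact subspace_V J VJ VJJ bilinear_b b_JJ V_top V0)+
  have wtN: "wt e \<in> \<nat>" if "e \<in> set es" for e
  proof -
    \<comment> \<open>Undecomposability applied to the identity maps; \<open>V 0\<close> being
      nonzero excludes the first alternative and leaves integrality.\<close>
    have "(\<forall>j. \<forall>v\<in>V j. v = 0) \<or> (\<forall>j. \<forall>v\<in>V j. v = v) \<and> (\<forall>e\<in>set es. wt e \<in> \<nat>)"
      by (rule indecomposable[OF T nd]) (simp_all add: linear_id[unfolded id_def])
    moreover obtain v where "v \<in> V 0" "v \<noteq> 0" using V0 subspace_0[OF subspace_V] by blast
    ultimately show ?thesis using that by blast
  qed
  obtain p f \<eta> q c \<xi> I where rb: "G.real_basis p f \<eta>"
    and st: "G.standard_start p (q (Suc 0)) f (c (Suc 0))"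
    and cb: "\<And>j. G.complex_basis (Suc j) (q (Suc j)) (c (Suc j)) (\<xi> (Suc j))"
    and I: "\<And>j. I (Suc j) \<subseteq> {..<q (Suc j)} \<and> card (I (Suc j)) = q (Suc (Suc j)) \<and>
      (\<forall>k<q (Suc j). \<forall>m<q (Suc (Suc j)).
        b (c (Suc j) k) (c (Suc (Suc j)) m) = G.incidence (I (Suc j)) k m \<and>
        b (c (Suc j) k) (J (c (Suc (Suc j)) m)) = 0)"
    using G.normal_bases by blast
  have cV: "c (Suc j) k \<in> V (Suc j)" "linear (\<xi> (Suc j) k)" if "k < q (Suc j)" for j k
    using cb[of j] that unfolding G.complex_basis_def by blast+
  have \<xi>c: "\<xi> (Suc j) k (c (Suc j) m) = (if k = m then 1 else 0)" "\<xi> (Suc j) k (J (c (Suc j) m)) = 0"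
    if "k < q (Suc j)" "m < q (Suc j)" for j k m
    using cb[of j] that unfolding G.complex_basis_def by blast+
  have c0: "c (Suc j) k \<noteq> 0" if "k < q (Suc j)" for j k
    using \<xi>c(1)[OF that that] linear_0[OF cV(2)[OF that]] by auto
  have expand: "v = (\<Sum>k<q (Suc j). \<xi> (Suc j) k v *\<^sub>R c (Suc j) k - \<xi> (Suc j) k (J v) *\<^sub>R J (c (Suc j) k))"
    if "v \<in> V (Suc j)" for v j
    using cb[of j] that unfolding G.complex_basis_def by blast
  have fV: "f k \<in> V 0" "linear (\<eta> k)" if "k < p" for k
    using rb that unfolding G.real_basis_def by blast+
  have \<eta>f: "\<eta> k (f m) = (if k = m then 1 else 0)" if "k < p" "m < p" for k m
    using rb that unfolding G.real_basis_def by blast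
  have V0f: "V 0 \<subseteq> span (f ` {..<p})" using rb unfolding G.real_basis_def by blast
  have p12: "p = 1 \<or> p = 2" "0 < q (Suc 0)" "0 < p" using st by (auto simp: G.standard_start_def)
  have qle: "q (Suc (Suc j)) \<le> q (Suc j)" for j
    using I[of j] card_mono[of "{..<q (Suc j)}" "I (Suc j)"] by simp
  have qM: "q (Suc M) = 0"
  proof (rule ccontr)
    assume "q (Suc M) \<noteq> 0"
    then show False using cV(1)[of 0 M] c0[of 0 M] V_top[of "Suc M"] by simp
  qed
  \<comment> \<open>\<open>N\<close> is the number of nonzero spaces among
    \<open>V 1, V 2, ...\<close>, so with \<open>N = Suc l\<close> the chain ends at
    \<open>V (l + 1)\<close>.\<close>
  define N where "N = (LEAST j. q (Suc j) = 0)"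
  have N: "q (Suc N) = 0" unfolding N_def by (rule LeastI[of "\<lambda>j. q (Suc j) = 0", OF qM])
  have Npos: "0 < q (Suc j)" if "j < N" for j
    using not_less_Least[of j "\<lambda>j. q (Suc j) = 0"] that by (simp add: N_def)
  have "N \<noteq> 0" using N p12(2) by (metis less_irrefl)
  then obtain l where l: "N = Suc l" using not0_implies_Suc by blast
  have qz: "q (Suc j) = 0" if "Suc l \<le> j" for j
    using that
  proof (induction j rule: dec_induct)
    case base
    show ?case using N l by simp
  next
    case (step j)
    then show ?case using qle[of j] by simp
  qed
  define bl where "bl i = (if i = 0 then map f [0..<p] else pairs J (q i) (c i))" for i
  define d where "d i = (if i = 0 then p else 2 * q i)" for i
  have bl0: "bl 0 = map f [0..<p]" and blS: "bl (Suc i) = pairs J (q (Suc i)) (c (Suc i))" for i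
    by (simp_all add: bl_def)
  have dlen: "length (bl i) = d i" for i by (simp add: bl_def d_def)
  have blV: "u \<in> V i" if "u \<in> set (bl i)" for u i
    using that fV(1) cV(1) VJ by (cases i) (auto simp: bl_def set_pairs)
  have Vbl: "V i \<subseteq> span (set (bl i))" for i
  proof (cases i)
    case 0
    then show ?thesis using V0f by (simp add: bl_def atLeast0LessThan)
  next
    case (Suc j)
    show ?thesis
    proof
      fix v assume v: "v \<in> V i"
      have "(\<Sum>k<q i. \<xi> i k v *\<^sub>R c i k - \<xi> i k (J v) *\<^sub>R J (c i k)) \<in> span (set (bl i))"
        unfolding Suc blS set_pairs
        by (intro span_sum span_diff span_mul span_base) auto
      then show "v \<in> span (set (bl i))" using expand[of v j] v Suc by simp
    qed
  qed
  have bl_ind: "distinct (bl i) \<and> independent (set (bl i))" for i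
  proof (cases i)
    case 0
    have "distinct (bl 0)" "independent (set (bl 0))"
      using biorthogonal_independent[of "bl 0" \<eta>] fV \<eta>f by (auto simp: bl0)
    then show ?thesis using 0 by simp
  next
    case (Suc j)
    \<comment> \<open>The dual family of \<open>c k, J (c k)\<close>: the real coefficient of
      \<open>J (c k)\<close> is \<open>- \<xi> k (J v)\<close>.\<close>
    define \<phi> where "\<phi> k = (if even k then \<xi> i (k div 2) else (\<lambda>v. - \<xi> i (k div 2) (J v)))" for k
    have lin: "linear (\<phi> k)" if "k < length (bl i)" for k
    proof -
      have "k div 2 < q i" using that Suc by (simp add: blS)
      then have "linear (\<xi> i (k div 2))" using cV(2) Suc by simp
      then show ?thesis
        by (auto simp: \<phi>_def intro!: linearI simp: linear_add linear_cmul)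
    qed
    have bi: "\<phi> k (bl i ! m) = (if k = m then 1 else 0)" if "k < length (bl i)" "m < length (bl i)" for k m
    proof -
      have km: "k div 2 < q (Suc j)" "m div 2 < q (Suc j)" "m < 2 * q (Suc j)"
        using that Suc by (auto simp: blS)
      have "\<xi> (Suc j) (k div 2) (- c (Suc j) (m div 2)) = - \<xi> (Suc j) (k div 2) (c (Suc j) (m div 2))"
        using linear_neg[OF cV(2)[OF km(1)]] .
      moreover have "k = m \<longleftrightarrow> k div 2 = m div 2 \<and> (even k \<longleftrightarrow> even m)" by presburger
      ultimately show ?thesis
        using \<xi>c[OF km(1,2)] VJJ[OF cV(1)[OF km(2)]] km(3)
        by (cases "k div 2 = m div 2") (simp_all add: \<phi>_def Suc blS nth_pairs)
    qed
    show ?thesis using biorthogonal_independent[OF lin bi] by blast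
  qed
  have dimV: "dim (V i) = d i" for i
  proof -
    have "card (set (bl i)) = d i" using bl_ind[of i] dlen distinct_card by metis
    moreover have "dim (V i) = card (set (bl i))"
      using bl_ind[of i] blV Vbl by (intro basis_card_eq_dim[symmetric]) auto
    ultimately show ?thesis by simp
  qed
  have Vz: "V i = {0}" if li: "l + 2 \<le> i" for i
  proof -
    obtain j where j: "i = Suc j" "Suc l \<le> j" using li by (cases i) auto
    have "V i \<subseteq> {0}" using Vbl[of i] qz[OF j(2)] by (simp add: j(1) blS pairs_def)
    then show ?thesis using subspace_0[OF subspace_V] by blast
  qed
  \<comment> \<open>Counting the original basis by weight shows that the new list has
    \<open>n\<close> members; as it spans together with \<open>x\<close> and \<open>y\<close>, it is
    then part of a basis.\<close>
  have sumd: "(\<Sum>i<l + 2. d i) = n"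
  proof -
    have es_eq: "set es = (\<Union>i<l + 2. {e \<in> set es. wt e = real i})"
    proof (intro equalityI subsetI)
      fix e assume e: "e \<in> set es"
      then obtain j where j: "wt e = real j" using wtN by (auto simp: Nats_def)
      then have "e \<in> V j" using es_in_U[OF e] by (simp add: V_def)
      then have "j < l + 2" using Vz[of j] es0[OF e] by (cases "j < l + 2") auto
      then show "e \<in> (\<Union>i<l + 2. {e \<in> set es. wt e = real i})" using e j by auto
    qed auto
    have "card {e \<in> set es. wt e = real i} = d i" for i
    proof -
      have "independent {e \<in> set es. wt e = real i}" using ind by (rule independent_mono) auto
      then have "dim (span {e \<in> set es. wt e = real i}) = card {e \<in> set es. wt e = real i}"
        by (rule dim_span_eq_card_independent)
      then show ?thesis using dimV[of i] by (simp add: V_def U_def)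
    qed
    moreover have "card (set es) = (\<Sum>i<l + 2. card {e \<in> set es. wt e = real i})"
      by (subst es_eq, rule card_UN_disjoint) auto
    ultimately show ?thesis using distinct_card[of es] dist len by simp
  qed
  define es' where "es' = concat (map bl [0..<l + 2])"
  have len': "length es' = n"
    using sumd by (simp only: es'_def length_concat map_map comp_def dlen
        sum_set_upt_conv_sum_list_nat[symmetric] atLeast0LessThan set_upt)
  have set': "set es' = (\<Union>i<l + 2. set (bl i))"
    by (simp only: es'_def set_concat set_map set_upt atLeast0LessThan image_image)
  have V_span: "V i \<subseteq> span (set es')" for i
  proof (cases "i < l + 2")
    case True
    then have "set (bl i) \<subseteq> set es'" using set' by blast
    then show ?thesis using Vbl span_mono by blast
  next
    case False
    then show ?thesis using Vz[of i] span_0 by auto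
  qed
  have es_span: "set es \<subseteq> span (set es')"
  proof
    fix e assume e: "e \<in> set es"
    then obtain j where "wt e = real j" using wtN by (auto simp: Nats_def)
    then have "e \<in> V j" using es_in_U[OF e] by (simp add: V_def)
    then show "e \<in> span (set es')" using V_span by blast
  qed
  have span': "span (set (es' @ [x, y])) = UNIV"
  proof -
    have "set (es @ [x, y]) \<subseteq> span (set (es' @ [x, y]))"
      using es_span span_mono[of "set es'" "set (es' @ [x, y])"] by (auto intro: span_base)
    then have "span (set (es @ [x, y])) \<subseteq> span (set (es' @ [x, y]))"
      by (intro span_minimal subspace_span)
    then show ?thesis using spn by blast
  qed
  have card': "card (set (es' @ [x, y])) = n + 2"
  proof (rule antisym)
    show "card (set (es' @ [x, y])) \<le> n + 2" using card_length[of "es' @ [x, y]"] len' by simp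
    have "dim (UNIV :: 'a set) \<le> card (set (es' @ [x, y]))"
      by (rule dim_le_card) (use span' in auto)
    then show "n + 2 \<le> card (set (es' @ [x, y]))" using dimn by simp
  qed
  have adapted: "adapted_basis br n es' x y"
    unfolding adapted_basis_def
  proof (intro conjI)
    show "length es' = n" by (rule len')
    show "distinct (es' @ [x, y])" by (rule card_distinct) (use card' len' in simp)
    show "independent (set (es' @ [x, y]))"
      by (rule card_le_dim_spanning[of _ UNIV]) (use span' card' dimn in auto)
    show "span (set (es' @ [x, y])) = UNIV" by (rule span')
    show "span {x, y} = commutator_ideal br" by (rule comm)
  qed
  define W where "W i = gram b (bl i) (bl (i + 1))" for i
  have bl_orth: "br u v = 0" if "u \<in> set (bl i)" "v \<in> set (bl j)" "j \<noteq> i + 1" "i \<noteq> j + 1" for u v i j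
    using V_orthogonal[OF blV[OF that(1)] blV[OF that(2)]] that by simp
  have T1: "chain_mat l d W = gram b es' es'"
    unfolding es'_def
  proof (rule chain_mat_gram)
    show "b u v = - b v u" for u v by (rule b_skew)
    show "b u v = 0" if "u \<in> set (bl i)" "v \<in> set (bl j)" "j \<noteq> i + 1" "i \<noteq> j + 1" for u v i j
      using bl_orth[OF that] by (simp add: b_def)
  qed (simp_all only: dlen W_def)
  have T2: "chain_mat l d (\<lambda>i. W i * copies (d (i + 1) div 2) J_mat) = gram b' es' es'"
    unfolding es'_def
  proof (rule chain_mat_gram)
    show "W i * copies (d (i + 1) div 2) J_mat = gram b' (bl i) (bl (i + 1))" for i
      using T2_gram[of "bl i" i "q (Suc i)" "c (Suc i)"] blV cV by (simp add: W_def blS d_def)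
    show "b' u v = - b' v u" for u v by (rule b_skew)
    show "b' u v = 0" if "u \<in> set (bl i)" "v \<in> set (bl j)" "j \<noteq> i + 1" "i \<noteq> j + 1" for u v i j
      using bl_orth[OF that] by (simp add: b'_def)
  qed (simp only: dlen)
  have descr: "described_by br es' x y (gram b es' es') (gram b' es' es')"
    unfolding described_by_def alternating_mat_def
  proof (intro conjI allI impI)
    show "transpose_mat (gram b es' es') = - gram b es' es'"
      by (rule eq_matI) (simp_all, rule b_skew)
    show "transpose_mat (gram b' es' es') = - gram b' es' es'"
      by (rule eq_matI) (simp_all, rule b_skew)
    show "br (es' ! i) (es' ! j) = gram b es' es' $$ (i, j) *\<^sub>R x + gram b' es' es' $$ (i, j) *\<^sub>R y"
      if "i < length es'" "j < length es'" for i j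
      using that br_eq[of "es' ! i" "es' ! j"] by simp
  qed simp_all
  have bl_D: "acts_by D (bl i) (copies (d i div 2) (real i \<cdot>\<^sub>m J_mat))" if i: "i \<in> set [1..<l + 2]" for i
  proof -
    have "i \<noteq> 0" using i unfolding set_upt atLeastLessThan_iff by linarith
    then obtain j where j: "i = Suc j" using not0_implies_Suc by blast
    have "D (c i k) = - (real i *\<^sub>R J (c i k)) \<and> D (J (c i k)) = real i *\<^sub>R c i k" if "k < q i" for k
    proof -
      have ck: "c i k \<in> V i" using cV(1) that j by simp
      then have "D (c i k) = - (real i *\<^sub>R J (c i k))" "D (J (c i k)) = - (real i *\<^sub>R J (J (c i k)))"
        using D_U[of _ "real i"] VJ[OF ck] by (simp_all add: V_def)
      then show ?thesis using VJJ[of "c i k" j] ck j by simp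
    qed
    then show ?thesis using acts_by_copies[of "q i" D "c i" "real i" J] by (simp add: j blS d_def)
  qed
  let ?M = "diag_block_mat (0\<^sub>m (d 0) (d 0) # map (\<lambda>i. copies (d i div 2) (real i \<cdot>\<^sub>m J_mat)) [1..<l + 2])"
  have upt: "[0..<l + 2] = 0 # [1..<l + 2]" 
    by (rule upt_conv_Cons[of 0 "l + 2", unfolded One_nat_def[symmetric]]) simp
  have acts: "acts_by D es' ?M"
    unfolding es'_def
  proof (rule acts_by_diag_block)
    have "D e = 0" if "e \<in> set (bl 0)" for e using D_U[of e 0] blV[OF that] by (simp add: V_def)
    then have "acts_by D (bl 0) (0\<^sub>m (d 0) (d 0))" using acts_by_zero[of "bl 0" D] dlen by simp
    moreover have "list_all2 (acts_by D) (map bl [1..<l + 2])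
        (map (\<lambda>i. copies (d i div 2) (real i \<cdot>\<^sub>m J_mat)) [1..<l + 2])"
      unfolding list.rel_map by (rule list.rel_refl_strong) (rule bl_D)
    ultimately show "list_all2 (acts_by D) (map bl [0..<l + 2])
      (0\<^sub>m (d 0) (d 0) # map (\<lambda>i. copies (d i div 2) (real i \<cdot>\<^sub>m J_mat)) [1..<l + 2])"
      unfolding upt by simp
  qed
  have acts_t: "acts_by (\<lambda>u. t *\<^sub>R D u) (es' @ [x, y]) (normal_derivation l d t)" for t
  proof -
    have "acts_by (\<lambda>u. t *\<^sub>R D u) [x, y] (t \<cdot>\<^sub>m J_mat)"
      by (rule acts_by_J) (simp_all add: Dx Dy)
    then have "list_all2 (acts_by (\<lambda>u. t *\<^sub>R D u)) [es', [x, y]] [t \<cdot>\<^sub>m ?M, t \<cdot>\<^sub>m J_mat]"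
      using acts_by_smult[OF acts, of t] by simp
    from acts_by_diag_block[OF this] show ?thesis by (simp add: normal_derivation_def)
  qed
  have lin_t: "linear (\<lambda>u. t *\<^sub>R D u)" for t by (intro linearI) (simp_all add: algebra_simps)
  have Tset: "T = {exp_map D' | D' t. has_matrix (es' @ [x, y]) D' (normal_derivation l d t)}" (is "_ = ?S")
  proof (intro equalityI subsetI)
    fix g assume "g \<in> T"
    then obtain t where "g = exp_map (\<lambda>u. t *\<^sub>R D u)" unfolding T flow_def by blast
    then show "g \<in> ?S"
      using acts_t lin_t unfolding has_matrix_iff by blast
  next
    fix g assume "g \<in> ?S"
    then obtain D' t where g: "g = exp_map D'" "linear D'" "acts_by D' (es' @ [x, y]) (normal_derivation l d t)"
      unfolding has_matrix_iff by blast
    have "D' = (\<lambda>u. t *\<^sub>R D u)" by (rule acts_by_unique[OF g(2) lin_t g(3) acts_t span'])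
    then show "g \<in> T" using g(1) unfolding T flow_def by blast
  qed
  have W0: "\<exists>z p s t. W 0 = W0_form z p s t"
    using W0_form_gram[OF st[unfolded G.standard_start_def]] by (simp add: W_def bl_def)
  have Wi: "\<exists>e r A. identity_with_zero_rows r A \<and>
        W i = real_form (0\<^sub>m (dim_row A) e @\<^sub>c A) \<and> (i = l \<longrightarrow> e = 0)" if i: "i \<in> {1..l}" for i
  proof -
    obtain j where j: "i = Suc j" using i by (cases i) auto
    let ?A = "incidence_mat (q i) (q (Suc i)) (I i)"
    have "W i = real_form ?A"
      unfolding W_def j blS Suc_eq_plus1[symmetric]
    proof (rule gram_pairs_real_form)
      fix k m assume km: "k < q (Suc j)" "m < q (Suc (Suc j))"
      note ck = cV(1)[OF km(1)] and cm = cV(1)[OF km(2)]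
      have "b (c (Suc j) k) (c (Suc (Suc j)) m) = (if k = sorted_list_of_set (I (Suc j)) ! m then 1 else 0)"
        "b (c (Suc j) k) (J (c (Suc (Suc j)) m)) = 0"
        using I[of j] km by (simp_all add: G.incidence_def)
      moreover have "b (J (c (Suc j) k)) (J (c (Suc (Suc j)) m)) = b (c (Suc j) k) (c (Suc (Suc j)) m)"
        by (rule b_JJ[OF ck cm])
      moreover have "b (J (c (Suc j) k)) (c (Suc (Suc j)) m) = - b (c (Suc j) k) (J (c (Suc (Suc j)) m))"
        using b_JJ[OF VJ[OF ck] cm] VJJ[OF ck] by simp
      ultimately show "b (c (Suc j) k) (c (Suc (Suc j)) m) = (if k = sorted_list_of_set (I (Suc j)) ! m then 1 else 0) \<and>
        b (c (Suc j) k) (J (c (Suc (Suc j)) m)) = 0 \<and> b (J (c (Suc j) k)) (c (Suc (Suc j)) m) = 0 \<and>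
        b (J (c (Suc j) k)) (J (c (Suc (Suc j)) m)) = (if k = sorted_list_of_set (I (Suc j)) ! m then 1 else 0)"
        by simp
    qed
    moreover have "identity_with_zero_rows (q (Suc i)) ?A"
      using I[of j] j by (intro identity_with_zero_rows_incidence) auto
    \<comment> \<open>The number of leading zero columns is taken to be 0 for every
      \<open>i\<close>: each column of \<open>?A\<close> carries a 1.\<close>
    ultimately show ?thesis using zero_cols_append[of ?A] by metis
  qed
  define cs where "cs = concat (map (\<lambda>i. map (c i) [0..<q i]) [1..<l + 2])"
  have es'_cs: "es' = map f [0..<p] @ pairs J (length cs) (\<lambda>k. cs ! k)"
  proof -
    have "map bl [1..<l + 2] = map (\<lambda>i. pairs J (q i) (c i)) [1..<l + 2]"
      by (intro map_cong) (auto simp: bl_def)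
    then show ?thesis unfolding es'_def upt cs_def
      by (simp only: list.map concat.simps bl0 concat_pairs)
  qed
  have n_eq: "n = p + 2 * length cs" using len' unfolding es'_cs by simp
  have cs_mem: "\<exists>i m. cs ! k = c (Suc i) m \<and> m < q (Suc i)" if "k < length cs" for k
  proof -
    have "set cs = (\<Union>i\<in>{1..<l + 2}. c i ` {..<q i})"
      by (simp only: cs_def set_concat set_map set_upt atLeast0LessThan image_image)
    moreover have "cs ! k \<in> set cs" using that by simp
    ultimately obtain i m where "i \<in> {1..<l + 2}" "m < q i" "cs ! k = c i m" by blast
    then show ?thesis by (intro exI[of _ "i - 1"] exI[of _ m]) auto
  qed
  let ?G = "gram b es' es'"
  have col0: "b u (es' ! k) = 0" if z: "col ?G k = 0\<^sub>v n" and k: "k < n" and u: "u \<in> V i" for u k i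
  proof -
    have "b (es' ! m) (es' ! k) = 0" if "m < n" for m
      using arg_cong[OF z, of "\<lambda>v. v $ m"] that k len' by simp
    then have "set es' \<subseteq> {u. b u (es' ! k) = 0}" using len' by (auto simp: in_set_conv_nth)
    moreover have "subspace {u. b u (es' ! k) = 0}" by (auto simp: subspace_def)
    ultimately have "span (set es') \<subseteq> {u. b u (es' ! k) = 0}" by (intro span_minimal)
    then show ?thesis using V_span u by blast
  qed
  have no_pair: False if k: "k < length cs" and z: "col ?G (p + 2 * k) = 0\<^sub>v n"
    "col ?G (Suc (p + 2 * k)) = 0\<^sub>v n" for k
  proof -
    obtain i m where im: "cs ! k = c (Suc i) m" "m < q (Suc i)" using cs_mem[OF k] by blast
    have e: "es' ! (p + 2 * k) = c (Suc i) m" "es' ! Suc (p + 2 * k) = J (c (Suc i) m)"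
      using k im(1) by (simp_all add: es'_cs nth_append nth_pairs)
    have "p + 2 * k < n" "Suc (p + 2 * k) < n" using k n_eq by auto
    then have "b u (c (Suc i) m) = 0 \<and> b u (J (c (Suc i) m)) = 0" if "u \<in> V i" for u
      using col0[OF z(1) _ that] col0[OF z(2) _ that] e by simp
    then show False
      using G.right_nondeg[of i] cV(1)[OF im(2)] c0[OF im(2)] unfolding G.right_nondeg_def by blast
  qed
  have cols: "\<not> (numbered_col n ?G (2 * j - 1) = 0\<^sub>v n \<and> numbered_col n ?G (2 * j) = 0\<^sub>v n)"
    if j: "j \<in> {1..n div 2}" for j
  proof
    assume z: "numbered_col n ?G (2 * j - 1) = 0\<^sub>v n \<and> numbered_col n ?G (2 * j) = 0\<^sub>v n"
    \<comment> \<open>For \<open>p = 1\<close> the numbering starts with 0, column 0 belongs to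
      \<open>V 0\<close>, and the columns \<open>2j - 1, 2j\<close> belong to one complex line. For
      \<open>p = 2\<close> it starts with 1, and \<open>j = 1\<close> stands for the two columns of
      \<open>V 0\<close>.\<close>
    from p12(1) show False
    proof
      assume p: "p = 1"
      then have "odd n" "j - 1 < length cs" using n_eq j by auto
      moreover have "2 * j - 1 = p + 2 * (j - 1)" "2 * j = Suc (p + 2 * (j - 1))" using j p by auto
      ultimately show False using no_pair[of "j - 1"] z unfolding numbered_col_def by simp
    next
      assume p: "p = 2"
      then have ev: "even n" using n_eq by simp
      show False
      proof (cases "j = 1")
        case True
        then have "col ?G 0 = 0\<^sub>v n" using z ev by (simp add: numbered_col_def)
        then have "b (c (Suc 0) 0) (es' ! 0) = 0"
          by (rule col0) (use n_eq p cV(1) p12(2) in auto)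
        moreover have "es' ! 0 = f 0" using p by (simp add: es'_cs nth_append)
        moreover have "b (f 0) (c (Suc 0) 0) = 1" using st unfolding G.standard_start_def by auto
        ultimately show False using b_skew(1)[of "f 0" "c (Suc 0) 0"] by simp
      next
        case False
        then have "j - 2 < length cs" using n_eq j p by auto
        moreover have "2 * j - 1 - 1 = p + 2 * (j - 2)" "2 * j - 1 = Suc (p + 2 * (j - 2))"
          using j p False by auto
        ultimately show False using no_pair[of "j - 2"] z ev unfolding numbered_col_def by simp
      qed
    qed
  qed
  have sum: "(\<Sum>i\<le>l + 1. d i) = n" using sumd by (simp add: lessThan_Suc_atMost)
  have pos: "\<forall>i\<le>l + 1. 0 < d i"
  proof (intro allI impI)
    fix i assume "i \<le> l + 1"
    then show "0 < d i" using p12(3) Npos[of "i - 1"] l by (cases i) (auto simp: d_def)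
  qed
  have even: "\<forall>i\<in>{1..l + 1}. even (d i)" by (auto simp: d_def)
  have carrier: "\<forall>i\<le>l. W i \<in> carrier_mat (d i) (d (i + 1))"
    unfolding W_def dlen[symmetric] by simp
  have Wi': "\<forall>i\<in>{1..l}. \<exists>e r A. identity_with_zero_rows r A \<and>
      W i = real_form (0\<^sub>m (dim_row A) e @\<^sub>c A) \<and> (i = l \<longrightarrow> e = 0)"
    by (rule ballI) (rule Wi)
  have cols': "\<forall>j\<in>{1..n div 2}. \<not> (numbered_col n (gram b es' es') (2 * j - 1) = 0\<^sub>v n \<and>
      numbered_col n (gram b es' es') (2 * j) = 0\<^sub>v n)"
    by (rule ballI) (rule cols)
  show ?thesis
    by (rule exI[of _ l], rule exI[of _ d], rule exI[of _ es'], rule exI[of _ x], rule exI[of _ y],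
        rule exI[of _ W], rule exI[of _ "gram b es' es'"], rule exI[of _ "gram b' es' es'"], intro conjI)
      (fact adapted sum pos even Tset carrier T1[symmetric] T2[symmetric] descr W0 Wi' cols')+
qed

end

section \<open>From the action coefficients to a generator\<close>

lemma linear_extension_list:
  fixes bs :: "'a::real_vector list" and g :: "nat \<Rightarrow> 'b::real_vector"
  assumes "distinct bs" "independent (set bs)"
  shows "\<exists>f. linear f \<and> (\<forall>k<length bs. f (bs ! k) = g k)"
proof -
  obtain f where f: "linear f" "\<And>e. e \<in> set bs \<Longrightarrow> f e = g (THE k. k < length bs \<and> bs ! k = e)"
    using linear_independent_extend[OF assms(2), of "\<lambda>e. g (THE k. k < length bs \<and> bs ! k = e)"] by blast
  have "(THE k'. k' < length bs \<and> bs ! k' = bs ! k) = k" if "k < length bs" for k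
    by (rule the_equality) (use that assms(1) in \<open>auto simp: nth_eq_iff_index_eq\<close>)
  then show ?thesis using f by (intro exI[of _ f]) auto
qed

lemma take_pairs:
  "2 * m \<le> length xs \<Longrightarrow> take (2 * m) xs = concat (map (\<lambda>h. [xs ! (2 * h), xs ! Suc (2 * h)]) [0..<m])"
proof (induction m)
  case (Suc m)
  have "take (2 * Suc m) xs = take (2 * m) xs @ [xs ! (2 * m), xs ! Suc (2 * m)]"
    using Suc.prems by (simp add: take_Suc_conv_app_nth)
  then show ?case using Suc by simp
qed simp

text \<open>For odd \<open>n\<close> a 1 by 1 zero block comes first, so the pair number
  \<open>h\<close> starts at position \<open>n mod 2 + 2 * h\<close>; positions and \<open>h\<close>
  count from 0 but \<open>\<alpha>\<close> from 1.\<close>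

lemma action_matrix_acts:
  fixes D :: "'a::euclidean_space \<Rightarrow> 'a"
  assumes len: "length es = n"
    and z: "odd n \<Longrightarrow> D (es ! 0) = 0"
    and h: "\<And>h. h < n div 2 \<Longrightarrow> D (es ! (n mod 2 + 2 * h)) = - ((\<alpha> (Suc h) * t) *\<^sub>R es ! Suc (n mod 2 + 2 * h)) \<and>
      D (es ! Suc (n mod 2 + 2 * h)) = (\<alpha> (Suc h) * t) *\<^sub>R es ! (n mod 2 + 2 * h)"
    and xy: "D x = - ((\<beta> * t) *\<^sub>R y)" "D y = (\<beta> * t) *\<^sub>R x"
  shows "acts_by D (es @ [x, y]) (action_matrix n \<alpha> \<beta> t)"
proof -
  let ?o = "n mod 2" and ?m = "n div 2"
  let ?P = "\<lambda>h. [es ! (?o + 2 * h), es ! Suc (?o + 2 * h)]"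
  have "es = take ?o es @ take (2 * ?m) (drop ?o es)"
    using len by (simp add: minus_mod_eq_mult_div[symmetric])
  also have "take ?o es = (if odd n then [es ! 0] else [])"
    using len by (cases es) (auto simp: odd_iff_mod_2_eq_one even_iff_mod_2_eq_zero)
  also have "take (2 * ?m) (drop ?o es) = concat (map ?P [0..<?m])"
    using len by (subst take_pairs) (auto simp: minus_mod_eq_mult_div intro!: arg_cong[of _ _ concat])
  finally have es: "es = (if odd n then [es ! 0] else []) @ concat (map ?P [0..<?m])" .
  have "list_all2 (acts_by D) ((if odd n then [[es ! 0]] else []) @ map ?P [0..<?m] @ [[x, y]])
    ((if odd n then [0\<^sub>m 1 1] else []) @ map (\<lambda>h. (\<alpha> (Suc h) * t) \<cdot>\<^sub>m J_mat) [0..<?m] @ [(\<beta> * t) \<cdot>\<^sub>m J_mat])"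
  proof (intro list_all2_appendI)
    show "list_all2 (acts_by D) (if odd n then [[es ! 0]] else []) (if odd n then [0\<^sub>m 1 1] else [])"
      using acts_by_zero[of "[es ! 0]" D] z by simp
    show "list_all2 (acts_by D) (map ?P [0..<?m]) (map (\<lambda>h. (\<alpha> (Suc h) * t) \<cdot>\<^sub>m J_mat) [0..<?m])"
      unfolding list.rel_map by (rule list.rel_refl_strong) (use h in \<open>auto intro!: acts_by_J\<close>)
    show "list_all2 (acts_by D) [[x, y]] [(\<beta> * t) \<cdot>\<^sub>m J_mat]"
      using acts_by_J[OF xy] by simp
  qed
  from acts_by_diag_block[OF this]
  have "acts_by D (((if odd n then [es ! 0] else []) @ concat (map ?P [0..<?m])) @ [x, y])
    (diag_block_mat ((if odd n then [0\<^sub>m 1 1] else []) @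
      map (\<lambda>h. (\<alpha> (Suc h) * t) \<cdot>\<^sub>m J_mat) [0..<?m] @ [(\<beta> * t) \<cdot>\<^sub>m J_mat]))"
    by (cases "odd n") simp_all
  moreover have "map (\<lambda>h. (\<alpha> (Suc h) * t) \<cdot>\<^sub>m J_mat) [0..<?m] =
    map (\<lambda>h. (\<alpha> h * t) \<cdot>\<^sub>m J_mat) [1..<Suc ?m]"
    unfolding One_nat_def map_Suc_upt[symmetric] by simp
  ultimately show ?thesis unfolding es[symmetric] action_matrix_def by simp
qed

text \<open>The generator is the derivation with parameter \<open>t = 1\<close>. Its exponentials
  lie in \<open>T\<close> by definition of the derivation algebra, and they fill \<open>T\<close>
  because a nontrivial one-parameter subgroup of the circle is everything.\<close>

lemma adapted_rotation_exists:
  fixes br :: "'a::euclidean_space \<Rightarrow> 'a \<Rightarrow> 'a"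
  assumes n: "n \<ge> 3" and type: "nilpotent_type2 br n" and T: "SO2_automorphism_group br T"
    and coeff: "action_coefficients br T n \<alpha> 1" and min: "Min (coefficient_set n \<alpha>) = 0"
  shows "\<exists>es x y J D wt. adapted_rotation br n es x y J D wt \<and>
    T = range (\<lambda>r. exp_map (\<lambda>u. r *\<^sub>R D u)) \<and> (\<exists>e\<in>set es. wt e = 0)"
proof -
  obtain es x y where ab: "adapted_basis br n es x y" and
    DA: "derivation_algebra br T = {D. \<exists>t. has_matrix (es @ [x, y]) D (action_matrix n \<alpha> 1 t)}"
    using coeff unfolding action_coefficients_def by blast
  have \<alpha>0: "0 \<le> \<alpha> h" if "h \<in> {1..n div 2}" for h
    using coeff that unfolding action_coefficients_def by blast
  have len: "length es = n" and dist: "distinct (es @ [x, y])" and ind: "independent (set (es @ [x, y]))"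
    and spn: "span (set (es @ [x, y])) = UNIV"
    using ab by (auto simp: adapted_basis_def)
  have lie: "bilinear br" "\<And>u. br u u = 0" and centre: "commutator_ideal br = lie_centre br"
    using type by (auto simp: nilpotent_type2_def nilpotent_lie_def lie_algebra_def)
  define o' where "o' = n mod 2"
  have o1: "o' \<le> 1" "odd n \<longleftrightarrow> o' = 1" "n = o' + 2 * (n div 2)"
    by (auto simp: o'_def odd_iff_mod_2_eq_one)
  let ?bs = "es @ [x, y]"
  have bs: "?bs ! k = es ! k" if "k < n" for k using that len by (simp add: nth_append)
  have bsx: "?bs ! n = x" "?bs ! Suc n = y" using len by (simp_all add: nth_append)
  have lbs: "length ?bs = n + 2" using len by simp
  define jv where "jv k = (if k < o' then 0 else if k < n then (if even (k - o') then es ! Suc k else - es ! (k - 1))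
    else if k = n then y else - x)" for k
  define ws where "ws k = (if k < o' then 0 else \<alpha> (Suc ((k - o') div 2)))" for k
  obtain J where J: "linear J" and Jv: "\<And>k. k < n + 2 \<Longrightarrow> J (?bs ! k) = jv k"
    using linear_extension_list[OF dist ind, of jv] lbs by metis
  define dv where "dv k = (if k < n then - (ws k *\<^sub>R jv k) else if k = n then - y else x)" for k
  obtain D where D: "linear D" and Dv: "\<And>k. k < n + 2 \<Longrightarrow> D (?bs ! k) = dv k"
    using linear_extension_list[OF dist ind, of dv] lbs by metis
  \<comment> \<open>A function of vectors rather than of positions, well defined since the basis
    vectors are distinct.\<close>
  define wt where "wt e = ws (THE k. k < n \<and> es ! k = e)" for e
  have wt_es: "wt (es ! k) = ws k" if "k < n" for k
  proof -
    have "(THE k'. k' < n \<and> es ! k' = es ! k) = k"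
      by (rule the_equality) (use that dist len in \<open>auto simp: nth_eq_iff_index_eq\<close>)
    then show ?thesis by (simp add: wt_def)
  qed
  have Jes: "J (es ! k) = jv k" and Des: "D (es ! k) = - (ws k *\<^sub>R jv k)" if "k < n" for k
    using Jv[of k] Dv[of k] bs[OF that] that by (auto simp: dv_def)
  have Dxy: "D x = - y" "D y = x" using Dv[of n] Dv[of "Suc n"] bsx by (auto simp: dv_def)
  have idx: "o' + 2 * h < n" "Suc (o' + 2 * h) < n" if "h < n div 2" for h using o1(3) that by linarith+
  have jv_e: "jv (o' + 2 * h) = es ! Suc (o' + 2 * h)" "jv (Suc (o' + 2 * h)) = - es ! (o' + 2 * h)"
    and ws_e: "ws (o' + 2 * h) = \<alpha> (Suc h)" "ws (Suc (o' + 2 * h)) = \<alpha> (Suc h)" if "h < n div 2" for h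
    using idx[OF that] by (auto simp: jv_def ws_def)
  have acts: "acts_by (\<lambda>u. t *\<^sub>R D u) ?bs (action_matrix n \<alpha> 1 t)" for t
  proof (rule action_matrix_acts[OF len], unfold o'_def[symmetric])
    show "t *\<^sub>R D (es ! 0) = 0" if "odd n" using that Des[of 0] n o1 by (simp add: ws_def)
    show "t *\<^sub>R D (es ! (o' + 2 * h)) = - ((\<alpha> (Suc h) * t) *\<^sub>R es ! Suc (o' + 2 * h)) \<and>
      t *\<^sub>R D (es ! Suc (o' + 2 * h)) = (\<alpha> (Suc h) * t) *\<^sub>R es ! (o' + 2 * h)" if "h < n div 2" for h
      using Des[OF idx(1)[OF that]] Des[OF idx(2)[OF that]] jv_e[OF that] ws_e[OF that]
      by (simp add: mult.commute)
  qed (simp_all add: Dxy)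
  have "has_matrix ?bs D (action_matrix n \<alpha> 1 1)"
    using acts[of 1] D by (simp add: has_matrix_iff)
  then have "D \<in> derivation_algebra br T" unfolding DA by blast
  then have der: "D (br u v) = br (D u) v + br u (D v)" and expT: "exp_map (\<lambda>u. r *\<^sub>R D u) \<in> T" for u v r
    unfolding derivation_algebra_def lie_derivation_def by blast+
  have cases_e: "(\<exists>k. e = es ! k \<and> k < n \<and> k < o') \<or>
     (\<exists>h < n div 2. e = es ! (o' + 2 * h) \<or> e = es ! Suc (o' + 2 * h))" if e: "e \<in> set es" for e
  proof -
    obtain k where k: "k < n" "e = es ! k" using e len by (metis in_set_conv_nth)
    show ?thesis
    proof (cases "k < o'")
      case False
      define h where "h = (k - o') div 2"
      have "h < n div 2" "k = o' + 2 * h \<or> k = Suc (o' + 2 * h)"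
        using False k(1) o1(3) unfolding h_def by presburger+
      then show ?thesis using k by blast
    qed (use k in blast)
  qed
  have loc: "adapted_rotation br n es x y J D wt"
  proof (rule adapted_rotation.intro)
    fix e assume e: "e \<in> set es"
    have "0 \<le> wt e \<and> D e = - (wt e *\<^sub>R J e) \<and> D (J e) = wt e *\<^sub>R e \<and>
      J e \<in> span {e' \<in> set es. wt e' = wt e} \<and> (wt e \<noteq> 0 \<longrightarrow> J (J e) = - e)"
      using cases_e[OF e]
    proof (elim disjE exE conjE)
      fix k assume k: "e = es ! k" "k < n" "k < o'"
      then have "J e = 0" "wt e = 0" using Jes wt_es by (auto simp: jv_def ws_def)
      moreover have "D e = 0" using Des[OF k(2)] k by (simp add: ws_def)
      ultimately show ?thesis by (simp add: span_0 linear_0[OF D])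
    next
      fix h assume h: "h < n div 2" "e = es ! (o' + 2 * h)"
      have mem: "es ! Suc (o' + 2 * h) \<in> {e' \<in> set es. wt e' = wt e}"
        using idx[OF h(1)] wt_es ws_e[OF h(1)] len h(2) by simp
      show ?thesis
        using Jes idx[OF h(1)] wt_es ws_e[OF h(1)] jv_e[OF h(1)] Des \<alpha>0[of "Suc h"] h span_base[OF mem]
        by simp
    next
      fix h assume h: "h < n div 2" "e = es ! Suc (o' + 2 * h)"
      have mem: "es ! (o' + 2 * h) \<in> {e' \<in> set es. wt e' = wt e}"
        using idx[OF h(1)] wt_es ws_e[OF h(1)] len h(2) by simp
      show ?thesis
        using Jes idx[OF h(1)] wt_es ws_e[OF h(1)] jv_e[OF h(1)] Des \<alpha>0[of "Suc h"] h span_neg[OF span_base[OF mem]]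
        by (simp add: linear_neg[OF D] linear_neg[OF J])
    qed
    then show "0 \<le> wt e" "D e = - (wt e *\<^sub>R J e)" "D (J e) = wt e *\<^sub>R e"
      "J e \<in> span {e' \<in> set es. wt e' = wt e}" "wt e \<noteq> 0 \<Longrightarrow> J (J e) = - e" by auto
  qed (fact lie ab centre J D der Dxy)+
  then interpret adapted_rotation br n es x y J D wt .
  \<comment> \<open>The half turn moves \<open>x\<close>, so the one-parameter group is nontrivial;
    here \<open>\<beta> = 1\<close> enters.\<close>
  have "flow pi x = - x"
    using flow_orbit[of x 1 y pi 1] by (simp add: Dx Dy orbit_def)
  moreover have "flow 0 x = x"
    using flow_orbit[of x 1 y 0 1] by (simp add: Dx Dy orbit_def)
  moreover have "x \<noteq> 0" using ind dependent_zero[of "set ?bs"] by auto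
  ultimately have ne: "flow pi \<noteq> flow 0" by (metis neg_eq_iff_add_eq_0 scaleR_2 scaleR_eq_0_iff zero_neq_numeral)
  have "T = range flow"
  proof (rule one_parameter_group_onto[OF T _ _ _ ne])
    show "flow r \<in> T" for r unfolding flow_def by (rule expT)
    show "flow (r + s) u = flow r (flow s u)" for r s u by (rule flow_add)
    show "continuous_on UNIV (\<lambda>r. flow r u)" for u by (rule continuous_flow)
  qed
  moreover have "flow = (\<lambda>r. exp_map (\<lambda>u. r *\<^sub>R D u))" by (simp add: flow_def fun_eq_iff)
  \<comment> \<open>For odd \<open>n\<close> the unpaired basis vector has weight 0; for even
    \<open>n\<close> the minimum is attained at some \<open>\<alpha> h\<close>.\<close>
  moreover have "\<exists>e\<in>set es. wt e = 0"
  proof (cases "odd n")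
    case True
    then have "wt (es ! 0) = 0" using wt_es[of 0] n o1 by (simp add: ws_def)
    moreover have "es ! 0 \<in> set es" using n len by simp
    ultimately show ?thesis by blast
  next
    case False
    have "finite (coefficient_set n \<alpha>)" "coefficient_set n \<alpha> \<noteq> {}"
      using n by (auto simp: coefficient_set_def)
    then have "0 \<in> coefficient_set n \<alpha>" using Min_in min by metis
    then obtain h where h: "h \<in> {1..n div 2}" "\<alpha> h = 0" using False by (auto simp: coefficient_set_def)
    then have h': "h - 1 < n div 2" by auto
    have "wt (es ! (o' + 2 * (h - 1))) = 0" using wt_es[OF idx(1)[OF h']] ws_e(1)[OF h'] h by simp
    moreover have "es ! (o' + 2 * (h - 1)) \<in> set es" using idx(1)[OF h'] len by simp
    ultimately show ?thesis by blast
  qed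
  ultimately show ?thesis using loc by metis
qed

theorem theorem7:
  fixes br :: "'a::euclidean_space \<Rightarrow> 'a \<Rightarrow> 'a"
    and T :: "('a \<Rightarrow> 'a) set"
    and n :: nat
    and \<alpha> :: "nat \<Rightarrow> real"
    and \<beta> :: real
  assumes "n \<ge> 3"
    and "nilpotent_type2 br n"
    and "SO2_automorphism_group br T"
    and "\<not> T_decomposable br T"
    and "action_coefficients br T n \<alpha> \<beta>"
    and "\<beta> = 1"
    and "Min (coefficient_set n \<alpha>) = 0"
  shows "\<exists>(l::nat) (d::nat \<Rightarrow> nat) (es::'a list) (x::'a) (y::'a)
            (W::nat \<Rightarrow> real mat) (T1::real mat) (T2::real mat).
     adapted_basis br n es x y \<and>
     (\<Sum>i\<le>l + 1. d i) = n \<and> (\<forall>i\<le>l + 1. 0 < d i) \<and> (\<forall>i\<in>{1..l + 1}. even (d i)) \<and>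
     T = {exp_map D | D t. has_matrix (es @ [x, y]) D (normal_derivation l d t)} \<and>
     (\<forall>i\<le>l. W i \<in> carrier_mat (d i) (d (i + 1))) \<and>
     T1 = chain_mat l d W \<and>
     T2 = chain_mat l d (\<lambda>i. W i * copies (d (i + 1) div 2) J_mat) \<and>
     described_by br es x y T1 T2 \<and>
     (\<exists>z p s t. W 0 = W0_form z p s t) \<and>
     (\<forall>i\<in>{1..l}. \<exists>c r A. identity_with_zero_rows r A \<and>
        W i = real_form (0\<^sub>m (dim_row A) c @\<^sub>c A) \<and> (i = l \<longrightarrow> c = 0)) \<and>
     (\<forall>j\<in>{1..n div 2}.
        \<not> (numbered_col n T1 (2 * j - 1) = 0\<^sub>v n \<and> numbered_col n T1 (2 * j) = 0\<^sub>v n))"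
proof -
  have "action_coefficients br T n \<alpha> 1" using assms(5,6) by simp
  from adapted_rotation_exists[OF assms(1-3) this assms(7)]
  obtain es x y J D wt where rotation: "adapted_rotation br n es x y J D wt"
    and T: "T = range (\<lambda>r. exp_map (\<lambda>u. r *\<^sub>R D u))" and zero: "\<exists>e\<in>set es. wt e = 0"
    by blast
  interpret adapted_rotation br n es x y J D wt by (rule rotation)
  have "T = range flow" using T by (simp add: flow_def[abs_def])
  moreover have "DIM('a) = n + 2" using assms(2) by (simp add: nilpotent_type2_def)
  ultimately show ?thesis using assms(4) zero by (intro normal_form)
qed

end
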